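(* Let $0\le k<n$ be integers. For each one of the following four properties of a set $B\subset\mathbb{R}^n$, the minimal Hausdorff dimension of a Borel set $B\subset\mathbb{R}^n$ with that property is $k+1$ (that is, every Borel set $B$ with that property has Hausdorff dimension at least $k+1$, and there exists a Borel set $B$ with that property of Hausdorff dimension exactly $k+1$): (i) for every $x\in\mathbb{R}^n$, $B$ contains the $k$-skeleton of a (possibly rotated) unit $n$-dimensional cube centered at $x$; (ii) for every $x\in\mathbb{R}^n$ and every size $\ell>0$, $B$ contains the $k$-skeleton of a (possibly rotated) $n$-dimensional cube of side length $\ell$ centered at $x$; (iii) for every $x\in\mathbb{R}^n$, $B$ contains a $k$-dimensional affine subspace at distance $1$ from $x$; (iv) for every $x\in\mathbb{R}^n$ and every $d>0$, $B$ contains a $k$-dimensional affine subspace at distance $d$ from $x$.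
   Context: The $k$-skeleton of an $n$-dimensional cube is the union of its $k$-dimensional faces (for $k=0$, its set of vertices; for $k=n-1$, its boundary). A (possibly rotated) cube of side length $\ell$ centered at $x$ is a set $x+\alpha\left([-\ell/2,\ell/2]^n\right)$ with $\alpha\in SO(n)$, which need not be axis-parallel; a unit cube has $\ell=1$. The distance of an affine subspace $P$ from $x$ is the Euclidean distance $\inf_{y\in P}|x-y|$. *)

theory Defs
  imports "HOL-Analysis.Analysis"
begin

(* Convention: |U|^0 = 1 for nonempty U (so the 0-dimensional measure counts points),
   and the empty set always costs nothing. Note that 0 powr 0 = 0 in HOL. *)
definition diam_cost :: "real \<Rightarrow> 'a::metric_space set \<Rightarrow> ennreal" where
  "diam_cost s U =
     (if U = {} then 0 else if s = 0 then 1 else ennreal (diameter U powr s))"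

(* The boundedness requirement is needed because diameter is a junk value on unbounded sets.
   Empty members are allowed, so finite covers are included. *)
definition hausdorff_premeasure :: "real \<Rightarrow> real \<Rightarrow> 'a::metric_space set \<Rightarrow> ennreal" where
  "hausdorff_premeasure \<delta> s A =
     (INF U\<in>{U :: nat \<Rightarrow> 'a set. A \<subseteq> (\<Union>i. U i) \<and> (\<forall>i. bounded (U i) \<and> diameter (U i) \<le> \<delta>)}.
        \<Sum>i. diam_cost s (U i))"

definition hausdorff_measure :: "real \<Rightarrow> 'a::metric_space set \<Rightarrow> ennreal" where
  "hausdorff_measure s A = (SUP \<delta>\<in>{0<..}. hausdorff_premeasure \<delta> s A)"

definition hausdorff_dim :: "'a::metric_space set \<Rightarrow> ennreal" where
  "hausdorff_dim A = (INF s\<in>{s. 0 \<le> s \<and> hausdorff_measure s A = 0}. ennreal s)"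

definition is_min_hausdorff_dim :: "('a::metric_space set \<Rightarrow> bool) \<Rightarrow> ennreal \<Rightarrow> bool" where
  "is_min_hausdorff_dim P d \<longleftrightarrow>
     (\<forall>B. B \<in> sets borel \<and> P B \<longrightarrow> d \<le> hausdorff_dim B) \<and>
     (\<exists>B. B \<in> sets borel \<and> P B \<and> hausdorff_dim B = d)"

definition rotated_cube :: "real^'n \<Rightarrow> real \<Rightarrow> real^'n^'n \<Rightarrow> (real^'n) set" where
  "rotated_cube x l \<alpha> = (\<lambda>y. x + \<alpha> *v y) ` cbox (\<chi> i. - l / 2) (\<chi> i. l / 2)"

definition skeleton :: "nat \<Rightarrow> 'a::euclidean_space set \<Rightarrow> 'a set" where
  "skeleton k C = \<Union>{F. F face_of C \<and> aff_dim F = int k}"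

definition contains_cube_skeleton :: "nat \<Rightarrow> real \<Rightarrow> real^'n \<Rightarrow> (real^'n) set \<Rightarrow> bool" where
  "contains_cube_skeleton k l x B \<longleftrightarrow>
     (\<exists>\<alpha>. rotation_matrix \<alpha> \<and> skeleton k (rotated_cube x l \<alpha>) \<subseteq> B)"

definition contains_affine_subspace_at_dist ::
    "nat \<Rightarrow> real \<Rightarrow> 'a::euclidean_space \<Rightarrow> 'a set \<Rightarrow> bool" where
  "contains_affine_subspace_at_dist k d x B \<longleftrightarrow>
     (\<exists>P. affine P \<and> aff_dim P = int k \<and> infdist x P = d \<and> P \<subseteq> B)"

end

theory Submission
  imports Defs
begin

text \<open>  All four properties share one lower bound and use two constructions.

  \<^bold>\<open>Lower bound.\<close> In (i) and (iii) every point x is assigned a piece of a k-plane inside B whose affine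
  hull P(x) has a fixed distance r > 0 from x; (ii) and (iv) are stronger. The piece is parametrised by an
  orthonormal frame as \<phi>(t) with t in a unit box. The set of points at distance r from a given k-plane
  is a hypersurface, so the planes P(x) form a family that is at least one-dimensional: only a fraction
  O(\<rho>) of all x has P(x) within \<rho> of a given P(x'). Two planes at separation \<rho> are transversal in the
  sense that the set of t for which \<phi>(t) is \<delta>-close to the other plane has measure O(\<delta>/\<rho>). A Cordoba type
  L2 argument then shows, up to a factor linear in j, that at scale \<delta> = 2^-j at least \<delta>^-(k+1) balls are
  needed to cover a fixed proportion of each piece, for a positive proportion of points x. If H^s(B) = 0
  with s < k+1, B has covers with at most 2^(jt) sets of size 2^-j for some t < k+1; pigeonholing over j
  which scale covers a sizable part of the piece belonging to x contradicts this. Working with finite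
  2^-j-separated sets of points x avoids any measurable choice of P(x). The estimates are
  \<open>measure_shell_le\<close>, \<open>measure_affine_sublevel_le\<close>, \<open>frame_distance_shell\<close>, \<open>energy_estimate\<close> and
  \<open>incidence_estimate\<close>; they are assembled in \<open>hausdorff_dim_ge_of_frames\<close>.

  \<^bold>\<open>Affine subspaces.\<close> The union of the translates of one (k+1)-dimensional subspace by a countable dense set
  works: some translate comes closer to x than d, and inside it k-planes at distance exactly d can be
  found (\<open>exists_borel_affine_subspaces\<close>).

  \<^bold>\<open>Cube skeletons.\<close> Each k-face of a cube spans together with the centre a (k+1)-plane. When the centre is
  moved slightly, a small rotation brings the face back into that same (k+1)-plane
  (\<open>rotate_into_subspace\<close>). So by an arbitrarily small change of the choice of rotations, the copies of one
  chosen face F over all centres and sizes in a bounded range can be put into finitely many (k+1)-planes,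
  hence into finitely many balls of small total cost (\<open>perturb_rotations_for_face\<close>). Iterating this with
  rapidly decreasing perturbations, treating every face infinitely often, and passing to the limit gives a
  choice of rotations for which the union of all copies of every face is null for H^s, s > k+1. This is a
  Baire category argument carried out by hand.\<close>

section \<open>Sets of Hausdorff measure zero\<close>

lemma diam_cost_pos: "s > 0 \<Longrightarrow> diam_cost s U = ennreal (diameter U powr s)"
  by (auto simp: diam_cost_def)

lemma hausdorff_measure_eq_0_iff:
  "hausdorff_measure s A = 0 \<longleftrightarrow>
    (\<forall>\<delta>>0. \<forall>\<epsilon>>0. \<exists>U :: nat \<Rightarrow> 'a::metric_space set. A \<subseteq> (\<Union>i. U i) \<and>
       (\<forall>i. bounded (U i) \<and> diameter (U i) \<le> \<delta>) \<and> (\<Sum>i. diam_cost s (U i)) < ennreal \<epsilon>)"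
proof -
  have "hausdorff_measure s A = 0 \<longleftrightarrow> (\<forall>\<delta>>0. hausdorff_premeasure \<delta> s A \<le> 0)"
    unfolding hausdorff_measure_def by (subst le_zero_eq[symmetric], subst SUP_le_iff) auto
  also have "\<dots> \<longleftrightarrow> (\<forall>\<delta>>0. \<forall>\<epsilon>>0. hausdorff_premeasure \<delta> s A < ennreal \<epsilon>)"
  proof (intro all_cong1 imp_cong refl)
    fix \<delta> :: real
    show "hausdorff_premeasure \<delta> s A \<le> 0 \<longleftrightarrow> (\<forall>\<epsilon>>0. hausdorff_premeasure \<delta> s A < ennreal \<epsilon>)"
    proof
      assume "\<forall>\<epsilon>>0. hausdorff_premeasure \<delta> s A < ennreal \<epsilon>"
      then show "hausdorff_premeasure \<delta> s A \<le> 0"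
        using ennreal_le_epsilon[of 0 "hausdorff_premeasure \<delta> s A"] by (auto simp: less_imp_le)
    qed auto
  qed
  also have "\<dots> \<longleftrightarrow> (\<forall>\<delta>>0. \<forall>\<epsilon>>0. \<exists>U :: nat \<Rightarrow> 'a set. A \<subseteq> (\<Union>i. U i) \<and>
       (\<forall>i. bounded (U i) \<and> diameter (U i) \<le> \<delta>) \<and> (\<Sum>i. diam_cost s (U i)) < ennreal \<epsilon>)"
    unfolding hausdorff_premeasure_def INF_less_iff by (simp add: conj_assoc)
  finally show ?thesis .
qed

lemma hausdorff_measure_0_mono:
  assumes "A \<subseteq> B" "hausdorff_measure s B = 0"
  shows "hausdorff_measure s A = 0"
  using assms unfolding hausdorff_measure_eq_0_iff by (meson order_trans)

lemma hausdorff_measure_0_UN: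
  fixes A :: "nat \<Rightarrow> 'a::metric_space set"
  assumes "\<And>m. hausdorff_measure s (A m) = 0"
  shows "hausdorff_measure s (\<Union>m. A m) = 0"
  unfolding hausdorff_measure_eq_0_iff
proof (intro allI impI)
  fix \<delta> \<epsilon> :: real assume \<delta>: "\<delta> > 0" and \<epsilon>: "\<epsilon> > 0"
  have "\<forall>m. \<exists>U. A m \<subseteq> (\<Union>i. U i) \<and> (\<forall>i. bounded (U i) \<and> diameter (U i) \<le> \<delta>) \<and>
      (\<Sum>i. diam_cost s (U i)) < ennreal (\<epsilon> / 2 * (1/2)^Suc m)"
    using assms \<delta> \<epsilon> unfolding hausdorff_measure_eq_0_iff by (auto simp del: power_Suc)
  then obtain U where U: "\<And>m. A m \<subseteq> (\<Union>i. U m i)"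
    "\<And>m i. bounded (U m i)" "\<And>m i. diameter (U m i) \<le> \<delta>"
    "\<And>m. (\<Sum>i. diam_cost s (U m i)) < ennreal (\<epsilon> / 2 * (1/2)^Suc m)"
    by metis
  define V where "V n = (case prod_decode n of (m, i) \<Rightarrow> U m i)" for n
  have cov: "(\<Union>m. A m) \<subseteq> (\<Union>n. V n)"
  proof
    fix x assume "x \<in> (\<Union>m. A m)"
    then obtain m i where "x \<in> U m i" using U(1) by blast
    then have "x \<in> V (prod_encode (m, i))" by (simp add: V_def)
    then show "x \<in> (\<Union>n. V n)" by blast
  qed
  have "(\<Sum>n. diam_cost s (V n)) = (\<Sum>m. \<Sum>i. diam_cost s (U m i))"
    by (rule suminf_ennreal_2dimen[where g = "\<lambda>m. \<Sum>i. diam_cost s (U m i)"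
          and f = "\<lambda>p. diam_cost s (U (fst p) (snd p))", unfolded V_def comp_def, simplified split_def fst_conv snd_conv,
          THEN trans[rotated]])
      (auto simp: V_def split_def)
  also have "\<dots> \<le> (\<Sum>m. ennreal (\<epsilon> / 2 * (1/2)^Suc m))"
    using U(4) by (intro suminf_le summableI) (auto intro: less_imp_le)
  also have "\<dots> = ennreal (\<epsilon> / 2)"
    using \<epsilon> sums_mult[OF power_half_series, of "\<epsilon>/2"] by (intro suminf_ennreal_eq) auto
  also have "\<dots> < ennreal \<epsilon>" using \<epsilon> by (simp add: ennreal_lessI)
  finally show "\<exists>U. (\<Union>m. A m) \<subseteq> (\<Union>i. U i) \<and> (\<forall>i. bounded (U i) \<and> diameter (U i) \<le> \<delta>) \<and>
      (\<Sum>i. diam_cost s (U i)) < ennreal \<epsilon>"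
    using cov U(2,3) by (intro exI[of _ V]) (auto simp: V_def split: prod.split)
qed

lemma hausdorff_measure_0_Union:
  assumes "countable \<A>" "\<And>A. A \<in> \<A> \<Longrightarrow> hausdorff_measure s A = 0" 
  shows "hausdorff_measure s (\<Union>\<A>) = 0"
proof (cases "\<A> = {}")
  case True
  have "\<exists>U :: nat \<Rightarrow> 'a set. {} \<subseteq> (\<Union>i. U i) \<and>
       (\<forall>i. bounded (U i) \<and> diameter (U i) \<le> \<delta>) \<and> (\<Sum>i. diam_cost s (U i)) < ennreal \<epsilon>"
    if "\<delta> > 0" "\<epsilon> > 0" for \<delta> \<epsilon>
    using that by (intro exI[of _ "\<lambda>_. {}"]) (auto simp: diam_cost_def diameter_def)
  then show ?thesis using True by (simp add: hausdorff_measure_eq_0_iff)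
next
  case False
  then have "\<Union>\<A> = (\<Union>m. from_nat_into \<A> m)"
    using assms(1) by (simp add: range_from_nat_into)
  also have "hausdorff_measure s \<dots> = 0"
    using assms False by (intro hausdorff_measure_0_UN) (auto simp: from_nat_into)
  finally show ?thesis .
qed

text \<open>The form in which smallness of the constructed sets is verified: finite covers by balls of one common
  radius r. Passing from radius to diameter only costs the factor 2^s.\<close>

lemma hausdorff_measure_0_ball_covers:
  fixes A :: "'a::euclidean_space set"
  assumes s: "s > 0"
    and cov: "\<And>e::real. e > 0 \<Longrightarrow> \<exists>G r. finite G \<and> 0 < r \<and> r \<le> e \<and> real (card G) * r powr s \<le> e \<and>
                 A \<subseteq> (\<Union>c\<in>G. cball c r)"
  shows "hausdorff_measure s A = 0"
  unfolding hausdorff_measure_eq_0_iff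
proof (intro allI impI)
  fix \<delta> \<epsilon> :: real assume \<delta>: "\<delta> > 0" and \<epsilon>: "\<epsilon> > 0"
  define e where "e = min (\<delta>/2) (\<epsilon> / (2 * 2 powr s))"
  have "e > 0" using \<delta> \<epsilon> by (auto simp: e_def)
  from cov[OF this] obtain G r where G: "finite G" "0 < r" "r \<le> e" "real (card G) * r powr s \<le> e"
     "A \<subseteq> (\<Union>c\<in>G. cball c r)" by blast
  obtain h :: "nat \<Rightarrow> 'a" where h: "bij_betw h {..<card G} G"
    using G(1) ex_bij_betw_nat_finite atLeast0LessThan by metis
  define U where "U i = (if i < card G then cball (h i) r else {})" for i
  have diamU: "diameter (U i) \<le> 2 * r" for i
    using G(2) by (auto simp: U_def)
  have *: "diam_cost s (U i) \<le> (if i < card G then ennreal ((2 * r) powr s) else 0)" for i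
  proof (cases "i < card G")
    case True
    have "0 \<le> diameter (U i)" by (intro diameter_ge_0) (auto simp: U_def)
    then show ?thesis using True s diamU[of i]
      by (auto simp: diam_cost_pos intro!: ennreal_leI powr_mono2)
  qed (auto simp: diam_cost_def U_def)
  have "(\<Sum>i. diam_cost s (U i)) \<le> (\<Sum>i. if i < card G then ennreal ((2 * r) powr s) else 0)"
    by (intro suminf_le * summableI)
  also have "\<dots> = (\<Sum>i<card G. ennreal ((2 * r) powr s))"
    by (subst suminf_finite[of "{..<card G}"]) auto
  also have "\<dots> = ennreal (2 powr s * (real (card G) * r powr s))"
    using G(2) by (simp add: powr_mult ennreal_mult' mult_ac flip: ennreal_of_nat_eq_real_of_nat)
  also have "\<dots> \<le> ennreal (\<epsilon> / 2)"
  proof (rule ennreal_leI)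
    have "2 powr s * (real (card G) * r powr s) \<le> 2 powr s * (\<epsilon> / (2 * 2 powr s))"
      using G(4) by (intro mult_left_mono) (auto simp: e_def)
    then show "2 powr s * (real (card G) * r powr s) \<le> \<epsilon> / 2" by simp
  qed
  also have "\<dots> < ennreal \<epsilon>" using \<epsilon> by (simp add: ennreal_lessI)
  finally have 1: "(\<Sum>i. diam_cost s (U i)) < ennreal \<epsilon>" .
  have 2: "diameter (U i) \<le> \<delta>" for i using diamU[of i] G(3) by (auto simp: e_def)
  have 3: "A \<subseteq> (\<Union>i. U i)"
  proof
    fix x assume "x \<in> A"
    then obtain c where c: "c \<in> G" "x \<in> cball c r" using G(5) by blast
    then obtain i where "i < card G" "h i = c" using h unfolding bij_betw_def by (metis imageE lessThan_iff)
    then have "x \<in> U i" using c by (auto simp: U_def)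
    then show "x \<in> (\<Union>i. U i)" by blast
  qed
  show "\<exists>U. A \<subseteq> (\<Union>i. U i) \<and> (\<forall>i. bounded (U i) \<and> diameter (U i) \<le> \<delta>) \<and>
      (\<Sum>i. diam_cost s (U i)) < ennreal \<epsilon>"
    using 1 2 3 by (intro exI[of _ U]) (auto simp: U_def)
qed

lemma hausdorff_dim_leI:
  assumes "\<And>s. s > d \<Longrightarrow> hausdorff_measure s A = 0" "d \<ge> 0"
  shows "hausdorff_dim A \<le> ennreal d"
proof (rule ennreal_le_epsilon)
  fix e :: real assume "e > 0"
  then have "hausdorff_dim A \<le> ennreal (d + e)"
    unfolding hausdorff_dim_def using assms by (intro INF_lower) auto
  then show "hausdorff_dim A \<le> ennreal d + ennreal e"
    using assms(2) \<open>e > 0\<close> by (simp add: ennreal_plus)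
qed

lemma hausdorff_dim_geI:
  assumes "\<And>s. 0 \<le> s \<Longrightarrow> s < d \<Longrightarrow> hausdorff_measure s A \<noteq> 0"
  shows "ennreal d \<le> hausdorff_dim A"
  unfolding hausdorff_dim_def using assms by (intro INF_greatest) (force intro!: ennreal_leI simp: not_less[symmetric])

text \<open>The counting form of H^s(B) = 0: dyadic covers with at most 2^(jt) members at scale 2^-j. As t is
  positive, members of diameter zero, which have no scale of their own, can be assigned a very fine
  one at little cost.\<close>

lemma hausdorff_null_dyadic_cover:
  fixes B :: "'a::metric_space set"
  assumes null: "hausdorff_measure s B = 0" and s: "0 \<le> s" "s < t"
  obtains U :: "nat \<Rightarrow> 'a set" and J :: "nat \<Rightarrow> nat"
  where "B \<subseteq> (\<Union>i. U i)" "\<And>i. closed (U i)" "\<And>i. bounded (U i)" "\<And>i. diameter (U i) \<le> (1/2) ^ J i"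
    "\<And>i. j0 \<le> J i" "\<And>j. finite {i. J i = j}" "\<And>j. real (card {i. J i = j}) * ((1/2)^j) powr t \<le> 1"
proof -
  have t: "t > 0" using s by linarith
  \<comment> \<open>Rounding a diameter up to a power of 1/2 costs a factor of at most 2^t; this leaves 1/2 for all members of diameter zero together.\<close>
  define \<epsilon> where "\<epsilon> = 1 / (2 * 2 powr t)"
  have \<epsilon>: "\<epsilon> > 0" by (simp add: \<epsilon>_def)
  have "(1/2::real)^j0 > 0" by simp
  with null \<epsilon> obtain U :: "nat \<Rightarrow> 'a set" where U: "B \<subseteq> (\<Union>i. U i)" "\<And>i. bounded (U i)" "\<And>i. diameter (U i) \<le> (1/2)^j0"
    "(\<Sum>i. diam_cost s (U i)) < ennreal \<epsilon>"
    unfolding hausdorff_measure_eq_0_iff by meson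
  have d0: "diameter (U i) \<ge> 0" for i by (intro diameter_ge_0 U)
  have d1: "diameter (U i) \<le> 1" for i using U(3)[of i] by (rule order_trans) (simp add: power_le_one)
  define c where "c i = diameter (U i) powr t" for i
  have c_le: "ennreal (c i) \<le> diam_cost s (U i)" for i
  proof (cases "diameter (U i) = 0")
    case False
    then have "U i \<noteq> {}" by auto
    have "diameter (U i) powr t \<le> diameter (U i) powr s"
      using s d0[of i] d1[of i] False by (intro powr_mono') auto
    moreover have "diameter (U i) powr t \<le> 1" using powr_mono2[of t "diameter (U i)" 1] t d0 d1 by auto
    ultimately show ?thesis using \<open>U i \<noteq> {}\<close>
      by (auto simp: diam_cost_def c_def ennreal_leI simp flip: ennreal_1)
  qed (auto simp: c_def)
  have c0: "c i \<ge> 0" for i by (simp add: c_def)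
  have csum: "summable c" and csuml: "(\<Sum>i. c i) < \<epsilon>"
  proof -
    have "(\<Sum>i. ennreal (c i)) < ennreal \<epsilon>"
      using suminf_le[OF c_le summableI summableI] U(4) by (rule le_less_trans)
    moreover from this show "summable c"
      by (intro summable_suminf_not_top) (auto simp: c_def)
    ultimately have "ennreal (\<Sum>i. c i) < ennreal \<epsilon>"
      by (subst (asm) suminf_ennreal2) (auto simp: c0)
    then show "(\<Sum>i. c i) < \<epsilon>" using \<epsilon> by (metis ennreal_leI leD leI)
  qed
  have exJ: "\<exists>m\<ge>j0. diameter (U i) \<le> (1/2)^m \<and> ((1/2)^m) powr t \<le> 2 powr t * c i + 1/2 * (1/2)^Suc i" for i
  proof (cases "diameter (U i) = 0")
    case True
    have "((\<lambda>m. ((1/2::real)^m) powr t) \<longlongrightarrow> 0) sequentially"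
      using tendsto_powr'[OF LIMSEQ_power_zero[of "1/2::real"] tendsto_const, of t] t by auto
    then have "eventually (\<lambda>m. ((1/2::real)^m) powr t < 1/2 * (1/2)^Suc i) sequentially"
      by (rule order_tendstoD) auto
    then obtain m where "m \<ge> j0" "((1/2::real)^m) powr t < 1/2 * (1/2)^Suc i"
      unfolding eventually_sequentially by (metis nat_le_linear)
    then show ?thesis using True by (intro exI[of _ m]) (auto simp: c_def)
  next
    case False
    then have pos: "diameter (U i) > 0" using d0[of i] by linarith
    have "\<exists>m. \<not> diameter (U i) \<le> (1/2)^m"
      using real_arch_pow_inv[OF pos, of "1/2"] by (auto simp: not_le)
    define m where "m = (LEAST m. \<not> diameter (U i) \<le> (1/2)^m)"
    have m: "\<not> diameter (U i) \<le> (1/2)^m" unfolding m_def by (rule LeastI_ex) fact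
    have least: "diameter (U i) \<le> (1/2)^l" if "l < m" for l using not_less_Least that unfolding m_def by blast
    have "m > j0"
    proof (rule ccontr)
      assume "\<not> m > j0"
      then have "(1/2::real) ^ j0 \<le> (1/2) ^ m" by (intro power_decreasing) auto
      then show False using m U(3)[of i] by linarith
    qed
    then obtain m' where m': "m = Suc m'" by (cases m) auto
    have "((1/2::real)^m') powr t \<le> (2 * diameter (U i)) powr t"
      using m t by (intro powr_mono2) (auto simp: m')
    also have "\<dots> = 2 powr t * c i" using pos by (simp add: c_def powr_mult)
    finally have "((1/2::real)^m') powr t \<le> 2 powr t * c i + 1/2 * (1/2)^Suc i" by (rule order_trans) auto
    then show ?thesis using least[of m'] \<open>m > j0\<close> by (intro exI[of _ m']) (auto simp: m')
  qed
  then obtain J where J: "\<And>i. j0 \<le> J i" "\<And>i. diameter (U i) \<le> (1/2)^J i"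
     "\<And>i. ((1/2)^J i) powr t \<le> 2 powr t * c i + 1/2 * (1/2)^Suc i" by metis
  define b where "b i = 2 powr t * c i + 1/2 * (1/2::real)^Suc i" for i
  have bsum: "summable b" "(\<Sum>i. b i) \<le> 1"
  proof -
    have 1: "(\<lambda>i. 1/2 * (1/2::real)^Suc i) sums (1/2)" using sums_mult[OF power_half_series, of "1/2"] by simp
    have 2: "(\<lambda>i. 2 powr t * c i) sums (2 powr t * (\<Sum>i. c i))" using csum by (intro sums_mult summable_sums)
    have 3: "b sums (2 powr t * (\<Sum>i. c i) + 1/2)" unfolding b_def by (rule sums_add[OF 2 1])
    then show "summable b" by (rule sums_summable)
    have "2 powr t * (\<Sum>i. c i) \<le> 2 powr t * \<epsilon>" using csuml by (intro mult_left_mono) auto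
    also have "\<dots> = 1/2" by (simp add: \<epsilon>_def)
    finally show "(\<Sum>i. b i) \<le> 1" using 3 by (simp add: sums_iff)
  qed
  have b0: "b i \<ge> 0" for i by (auto simp: b_def c_def)
  have cardF: "real (card F) * ((1/2)^j) powr t \<le> 1" if "finite F" "F \<subseteq> {i. J i = j}" for F j
  proof -
    have "real (card F) * ((1/2)^j) powr t = (\<Sum>i\<in>F. ((1/2)^J i) powr t)"
      using that by (simp add: subset_iff)
    also have "\<dots> \<le> (\<Sum>i\<in>F. b i)" unfolding b_def by (intro sum_mono J)
    also have "\<dots> \<le> (\<Sum>i. b i)" using bsum b0 that by (intro sum_le_suminf) auto
    finally show ?thesis using bsum by linarith
  qed
  have fin: "finite {i. J i = j}" for j
  proof (rule ccontr)
    assume inf: "infinite {i. J i = j}"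
    obtain N :: nat where N: "real N > 1 / ((1/2)^j) powr t" using reals_Archimedean2 by blast
    obtain F where "F \<subseteq> {i. J i = j}" "finite F" "card F = N" using infinite_arbitrarily_large[OF inf] by blast
    with cardF[of F j] have "real N * ((1/2)^j) powr t \<le> 1" by auto
    moreover have "((1/2::real)^j) powr t > 0" by simp
    ultimately show False using N by (simp add: field_simps)
  qed
  show thesis
  proof (rule that[of "\<lambda>i. closure (U i)" J])
    show "B \<subseteq> (\<Union>i. closure (U i))" using U(1) closure_subset by blast
  qed (use J U fin cardF in \<open>auto simp: diameter_closure\<close>)
qed

section \<open>Volume estimates\<close>

text \<open>The translates of S by multiples of \<tau> e are disjoint, and about 1/\<tau> of them fit into a slightly larger
  ball. This replaces Fubini's theorem in the two estimates below.\<close>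

lemma measure_translates_le:
  fixes S :: "'a::euclidean_space set"
  assumes S: "S \<in> lmeasurable" "S \<subseteq> cball 0 R" and e: "norm e = 1" and \<tau>: "\<tau> > 0"
    and sep: "\<And>x s. x \<in> S \<Longrightarrow> s \<ge> \<tau> \<Longrightarrow> x + s *\<^sub>R e \<notin> S"
  shows "measure lebesgue S \<le> \<tau> * measure lebesgue (cball (0::'a) (R + 1))"
proof (cases "\<tau> \<ge> 1")
  case True
  have "measure lebesgue S \<le> measure lebesgue (cball (0::'a) (R + 1))"
    using S by (intro measure_mono_fmeasurable) auto
  also have "\<dots> \<le> \<tau> * \<dots>" using True by (simp add: mult_le_cancel_right1)
  finally show ?thesis .
next
  case False
  define N where "N = nat \<lfloor>1 / \<tau>\<rfloor>"
  have N: "real N \<le> 1 / \<tau>" "1 / \<tau> \<le> real (Suc N)"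
    using \<tau> zero_le_divide_1_iff[of \<tau>] unfolding N_def by linarith+
  define T where "T i = (+) ((real i * \<tau>) *\<^sub>R e) ` S" for i :: nat
  have Tm: "T i \<in> lmeasurable" "measure lebesgue (T i) = measure lebesgue S" for i
    unfolding T_def using S by (auto simp: measurable_translation measure_translation)
  have disj: "disjoint_family_on T {..N}"
    unfolding disjoint_family_on_def
  proof (intro ballI impI)
    have *: "T i \<inter> T j = {}" if "i < j" for i j
    proof (rule ccontr)
      assume "T i \<inter> T j \<noteq> {}"
      then obtain x y where xy: "x \<in> S" "y \<in> S" "(real i * \<tau>) *\<^sub>R e + x = (real j * \<tau>) *\<^sub>R e + y"
        unfolding T_def by auto
      then have "x = y + (real (j - i) * \<tau>) *\<^sub>R e" using that
        by (simp add: of_nat_diff algebra_simps)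
      moreover have "real (j - i) * \<tau> \<ge> \<tau>" using that \<tau> by (simp add: mult_le_cancel_right1)
      ultimately show False using sep xy by blast
    qed
    fix i j :: nat assume "i \<noteq> j"
    then show "T i \<inter> T j = {}" using *[of i j] *[of j i] by (cases "i < j") auto
  qed
  have "1 / \<tau> * measure lebesgue S \<le> real (Suc N) * measure lebesgue S"
    using N by (intro mult_right_mono) auto
  also have "\<dots> = (\<Sum>i\<le>N. measure lebesgue (T i))" by (simp add: Tm)
  also have "\<dots> = measure lebesgue (\<Union>i\<le>N. T i)"
    using Tm disj by (intro measure_finite_Union[symmetric]) (auto simp: fmeasurableD2 fmeasurableD simp del: emeasure_completion)
  also have "\<dots> \<le> measure lebesgue (cball (0::'a) (R + 1))"
  proof (rule measure_mono_fmeasurable)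
    show "(\<Union>i\<le>N. T i) \<subseteq> cball 0 (R + 1)"
    proof
      fix y assume "y \<in> (\<Union>i\<le>N. T i)"
      then obtain i x where i: "i \<le> N" "x \<in> S" "y = (real i * \<tau>) *\<^sub>R e + x" unfolding T_def by auto
      have "real i * \<tau> \<le> real N * \<tau>" using i \<tau> by simp
      also have "\<dots> \<le> 1" using N \<tau> by (simp add: field_simps)
      finally have "real i * \<tau> \<le> 1" .
      then have "norm y \<le> 1 + R" using i S(2) e \<tau>
        by (intro order_trans[OF eq_refl norm_triangle_mono]) auto
      then show "y \<in> cball 0 (R + 1)" by simp
    qed
  qed (use Tm in auto)
  finally show ?thesis using \<tau> by (simp add: field_simps)
qed

lemma measure_lebesgue_ball:
  fixes c :: "'a::euclidean_space"
  assumes "r \<ge> 0"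
  shows "measure lebesgue (ball c r) = r ^ DIM('a) * measure lebesgue (ball (0::'a) 1)"
  using content_ball_conv_unit_ball[OF assms, of c] by (simp add: measure_completion)

lemma measure_lebesgue_ball_1_pos: "measure lebesgue (ball (0::'a::euclidean_space) 1) > 0"
  using content_ball_pos[of 1 "0::'a"] by (simp add: measure_completion)

text \<open>The balls of radius \<delta>/2 around the points of G are disjoint.\<close>

lemma card_separated_le:
  fixes G :: "'a::euclidean_space set"
  assumes G: "finite G" "pairwise (\<lambda>x y. \<delta> \<le> dist x y) G" and \<delta>: "\<delta> > 0"
    and Y: "Y \<in> lmeasurable" "(\<Union>x\<in>G. ball x (\<delta>/2)) \<subseteq> Y"
  shows "real (card G) * ((\<delta>/2) ^ DIM('a) * measure lebesgue (ball (0::'a) 1)) \<le> measure lebesgue Y"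
proof -
  have "disjoint_family_on (\<lambda>x. ball x (\<delta>/2)) G"
    unfolding disjoint_family_on_def
  proof (intro ballI impI)
    fix x y assume "x \<in> G" "y \<in> G" "x \<noteq> y"
    then have "\<delta> \<le> dist x y" using G(2) by (auto simp: pairwise_def)
    then show "ball x (\<delta>/2) \<inter> ball y (\<delta>/2) = {}" by (intro disjoint_ballI) auto
  qed
  then have "measure lebesgue (\<Union>x\<in>G. ball x (\<delta>/2)) = (\<Sum>x\<in>G. measure lebesgue (ball x (\<delta>/2)))"
    using G(1) by (intro measure_finite_Union)
      (auto simp: fmeasurableD2[OF lmeasurable_ball] simp del: emeasure_completion)
  moreover have "\<dots> = real (card G) * ((\<delta>/2) ^ DIM('a) * measure lebesgue (ball (0::'a) 1))"
    using \<delta> by (subst sum.cong[OF refl measure_lebesgue_ball]) auto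
  moreover have "measure lebesgue (\<Union>x\<in>G. ball x (\<delta>/2)) \<le> measure lebesgue Y"
    using G(1) by (intro measure_mono_fmeasurable Y sets.finite_UN) auto
  ultimately show ?thesis by linarith
qed

lemma maximal_separated_subset:
  fixes X :: "'a::euclidean_space set"
  assumes X: "bounded X" and \<delta>: "\<delta> > 0"
  obtains G where "finite G" "G \<subseteq> X" "pairwise (\<lambda>x y. \<delta> \<le> dist x y) G" "X \<subseteq> (\<Union>x\<in>G. ball x \<delta>)"
proof -
  define P where "P G \<longleftrightarrow> finite G \<and> G \<subseteq> X \<and> pairwise (\<lambda>x y. \<delta> \<le> dist x y) G" for G
  obtain R where R: "X \<subseteq> ball 0 R" using bounded_subset_ballD[OF X] by blast
  define \<omega> where "\<omega> = (\<delta>/2) ^ DIM('a) * measure lebesgue (ball (0::'a) 1)"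
  have \<omega>: "\<omega> > 0" unfolding \<omega>_def using \<delta> measure_lebesgue_ball_1_pos by auto
  define V where "V = measure lebesgue (ball (0::'a) (R + \<delta>))"
  have bd: "card G \<le> nat \<lceil>V / \<omega>\<rceil>" if "P G" for G
  proof -
    have "real (card G) * \<omega> \<le> V"
      unfolding V_def \<omega>_def
    proof (rule card_separated_le)
      show "(\<Union>x\<in>G. ball x (\<delta>/2)) \<subseteq> ball 0 (R + \<delta>)"
      proof
        fix y assume "y \<in> (\<Union>x\<in>G. ball x (\<delta>/2))"
        then obtain x where x: "x \<in> G" "dist x y < \<delta>/2" by auto
        with that R have "dist 0 x < R" by (auto simp: P_def)
        with x dist_triangle[of 0 y x] \<delta> show "y \<in> ball 0 (R + \<delta>)" by simp
      qed
    qed (use that \<delta> in \<open>auto simp: P_def\<close>)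
    then have "real (card G) \<le> V / \<omega>" using \<omega> by (simp add: field_simps)
    then show ?thesis by linarith
  qed
  have "P {}" by (simp add: P_def)
  then obtain G where G: "P G" "\<And>H. P H \<Longrightarrow> card H \<le> card G"
    using ex_has_greatest_nat[of P "{}" card] bd by (metis less_Suc_eq_le)
  have "X \<subseteq> (\<Union>x\<in>G. ball x \<delta>)"
  proof (rule ccontr)
    assume "\<not> ?thesis"
    then obtain x where x: "x \<in> X" "\<And>y. y \<in> G \<Longrightarrow> \<delta> \<le> dist y x" by (force simp: not_less)
    then have "x \<notin> G" using \<delta> by force
    have "P (insert x G)" using x G(1) unfolding P_def pairwise_insert by (auto simp: dist_commute)
    from G(2)[OF this] show False using \<open>x \<notin> G\<close> G(1) by (auto simp: P_def)
  qed
  then show thesis using that G(1) by (auto simp: P_def)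
qed

text \<open>The \<tau>-neighbourhood of the hypersurface of points at distance r from an affine subspace has volume
  O(\<tau>). Here A stands for the orthogonal projection along the subspace, so norm (A (z - p)) is the distance
  of z. Moving along a coordinate direction e that makes a definite angle with A (z - p) increases that
  distance at a definite rate, so the shell splits into 2n pieces to which the translation argument
  applies; splitting is needed because a line may be tangent to the hypersurface.\<close>

lemma measure_shell_le:
  fixes A :: "'a::euclidean_space \<Rightarrow> 'a"
  assumes A: "linear A" "\<And>v w. A v \<bullet> A w = A v \<bullet> w" and r: "r > 0" and \<tau>: "\<tau> > 0"
  shows "measure lebesgue {z \<in> cball 0 R. \<bar>norm (A (z - p)) - r\<bar> \<le> \<tau>}
    \<le> (2 / r + 10 * (real DIM('a))\<^sup>2) * measure lebesgue (cball (0::'a) (R + 1)) * \<tau>"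
proof -
  let ?n = "real DIM('a)" and ?V = "measure lebesgue (cball (0::'a) (R + 1))"
  let ?S = "{z \<in> cball 0 R. \<bar>norm (A (z - p)) - r\<bar> \<le> \<tau>}"
  have contA: "continuous_on UNIV A" using A(1) by (simp add: linear_continuous_on linear_conv_bounded_linear)
  have contA': "continuous_on X (\<lambda>z. A (z - p))" for X
    by (rule continuous_on_compose2[OF contA]) (auto intro!: continuous_intros)
  have n: "?n > 0" by simp
  show ?thesis
  proof (cases "\<tau> \<ge> r / 2")
    case True
    have "?S = cball 0 R \<inter> {z. \<bar>norm (A (z - p)) - r\<bar> \<le> \<tau>}" by auto
    moreover have "compact \<dots>"
      by (intro compact_Int_closed closed_Collect_le continuous_intros contA' compact_cball)
    ultimately have Sm: "?S \<in> lmeasurable" by (simp add: lmeasurable_compact)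
    have "measure lebesgue ?S \<le> ?V * 1"
      unfolding mult_1_right by (rule measure_mono_fmeasurable) (use Sm in \<open>auto simp del: measure_completion\<close>)
    also have "\<dots> \<le> ?V * ((2 / r + 10 * ?n\<^sup>2) * \<tau>)"
    proof (rule mult_left_mono)
      have "1 \<le> 2 / r * \<tau>" using True r by (simp add: field_simps)
      also have "\<dots> \<le> (2 / r + 10 * ?n\<^sup>2) * \<tau>" using \<tau> by (intro mult_right_mono) auto
      finally show "1 \<le> (2 / r + 10 * ?n\<^sup>2) * \<tau>" .
    qed auto
    finally show ?thesis by (simp add: mult_ac)
  next
    case False
    define Q where "Q e = {z \<in> cball 0 R. \<bar>norm (A (z - p)) - r\<bar> \<le> \<tau> \<and> A (z - p) \<bullet> e \<ge> r / (2 * ?n)}" for e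
    let ?E = "Basis \<union> uminus ` Basis :: 'a set"
    have Qm: "Q e \<in> lmeasurable" for e
    proof -
      have "Q e = cball 0 R \<inter> ({z. \<bar>norm (A (z - p)) - r\<bar> \<le> \<tau>} \<inter> {z. A (z - p) \<bullet> e \<ge> r / (2 * ?n)})"
        by (auto simp: Q_def)
      moreover have "compact \<dots>"
        by (intro compact_Int_closed closed_Int closed_Collect_le continuous_intros contA' compact_cball)
      ultimately show ?thesis by (simp add: lmeasurable_compact)
    qed
    have Qle: "measure lebesgue (Q e) \<le> 5 * ?n * \<tau> * ?V" if e: "e \<in> ?E" for e
    proof (rule measure_translates_le[OF Qm])
      show "norm e = 1" using e by auto
      show "Q e \<subseteq> cball 0 R" by (auto simp: Q_def)
      show "5 * ?n * \<tau> > 0" using \<tau> by simp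
      fix z s assume z: "z \<in> Q e" and s: "5 * ?n * \<tau> \<le> s"
      have s0: "s > 0" using s \<tau> n by (meson less_le_trans mult_pos_pos zero_less_numeral)
      show "z + s *\<^sub>R e \<notin> Q e"
      proof
        assume z': "z + s *\<^sub>R e \<in> Q e"
        define v where "v = A (z - p)"
        have v: "A (z + s *\<^sub>R e - p) = v + s *\<^sub>R A e"
          using linear_add[OF A(1), of "z - p" "s *\<^sub>R e"] linear_cmul[OF A(1), of s e]
          by (simp add: v_def algebra_simps)
        have "(norm v)\<^sup>2 + s * (r / ?n) \<le> (norm v)\<^sup>2 + 2 * s * (v \<bullet> e)"
          using z s0 by (auto simp: Q_def v_def field_simps)
        also have "\<dots> = (norm v)\<^sup>2 + 2 * s * (v \<bullet> A e)" by (simp add: v_def A(2))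
        also have "\<dots> \<le> (norm (v + s *\<^sub>R A e))\<^sup>2"
          using s0 unfolding power2_norm_eq_inner by (simp add: inner_simps inner_commute mult_ac)
        also have "\<dots> \<le> (r + \<tau>)\<^sup>2"
          using z' unfolding v[symmetric] Q_def by (intro power_mono) auto
        finally have 1: "(norm v)\<^sup>2 + s * (r / ?n) \<le> (r + \<tau>)\<^sup>2" .
        have "(r - \<tau>)\<^sup>2 \<le> (norm v)\<^sup>2"
          using z False r unfolding Q_def v_def by (intro power_mono) auto
        with 1 have "s * (r / ?n) \<le> 4 * r * \<tau>" by (simp add: power2_eq_square algebra_simps)
        then have "s \<le> 4 * ?n * \<tau>" using r n by (simp add: field_simps)
        moreover have "4 * ?n * \<tau> < 5 * ?n * \<tau>" using \<tau> n by simp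
        ultimately show False using s by linarith
      qed
    qed
    have cover: "?S \<subseteq> (\<Union>e\<in>?E. Q e)"
    proof
      fix z assume z: "z \<in> ?S"
      define v where "v = A (z - p)"
      have "r / 2 \<le> norm v" using z False by (auto simp: v_def)
      also have "\<dots> \<le> (\<Sum>b\<in>Basis. \<bar>v \<bullet> b\<bar>)" by (rule norm_le_l1)
      finally have *: "r / 2 \<le> (\<Sum>b\<in>Basis. \<bar>v \<bullet> b\<bar>)" .
      have "\<exists>b\<in>Basis. r / (2 * ?n) \<le> \<bar>v \<bullet> b\<bar>"
      proof (rule ccontr)
        assume "\<not> ?thesis"
        then have "(\<Sum>b\<in>Basis. \<bar>v \<bullet> b\<bar>) < (\<Sum>b\<in>(Basis::'a set). r / (2 * ?n))"
          by (intro sum_strict_mono) auto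
        then show False using * by simp
      qed
      then obtain b where b: "b \<in> Basis" "r / (2 * ?n) \<le> \<bar>v \<bullet> b\<bar>" by blast
      then have "z \<in> Q b \<or> z \<in> Q (- b)" using z by (auto simp: Q_def v_def abs_if split: if_splits)
      then show "z \<in> (\<Union>e\<in>?E. Q e)" using b by blast
    qed
    have "measure lebesgue ?S \<le> measure lebesgue (\<Union>e\<in>?E. Q e)"
    proof (rule measure_mono_fmeasurable[OF cover])
      have "?S = cball 0 R \<inter> {z. \<bar>norm (A (z - p)) - r\<bar> \<le> \<tau>}" by auto
      moreover have "compact \<dots>"
        by (intro compact_Int_closed closed_Int closed_Collect_le continuous_intros contA' compact_cball)
      ultimately show "?S \<in> sets lebesgue" by (simp add: lmeasurable_compact fmeasurableD)
    qed (auto intro!: fmeasurable.finite_UN Qm)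
    also have "\<dots> \<le> (\<Sum>e\<in>?E. measure lebesgue (Q e))"
      by (intro measure_UNION_le) (use Qm in auto)
    also have "\<dots> \<le> (\<Sum>e\<in>?E. 5 * ?n * \<tau> * ?V)" by (intro sum_mono Qle)
    also have "\<dots> = real (card ?E) * (5 * ?n * \<tau> * ?V)" by simp
    also have "\<dots> \<le> (2 * ?n) * (5 * ?n * \<tau> * ?V)"
    proof (rule mult_right_mono)
      have "card ?E \<le> card (Basis :: 'a set) + card (uminus ` Basis :: 'a set)" by (rule card_Un_le)
      also have "\<dots> \<le> DIM('a) + DIM('a)" by (intro add_mono card_image_le) auto
      finally show "real (card ?E) \<le> 2 * ?n" by linarith
    qed (use \<tau> in auto)
    also have "\<dots> = (0 + 10 * ?n\<^sup>2) * ?V * \<tau>" by (simp add: power2_eq_square)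
    also have "\<dots> \<le> (2 / r + 10 * ?n\<^sup>2) * ?V * \<tau>"
      using r \<tau> by (intro mult_right_mono add_mono) auto
    finally show ?thesis by simp
  qed
qed

text \<open>The cube of side length 1 centred at 0; it serves both as the standard cube and as the parameter domain
  of pieces of k-planes.\<close>

abbreviation unit_box :: "'a::euclidean_space set" where
  "unit_box \<equiv> cbox (- ((1/2) *\<^sub>R One)) ((1/2) *\<^sub>R One)"

lemma mem_unit_box: "t \<in> unit_box \<longleftrightarrow> (\<forall>b\<in>Basis. \<bar>t \<bullet> b\<bar> \<le> 1/2)"
  unfolding mem_box by (intro ball_cong refl) (auto simp: abs_le_iff)

lemma measure_unit_box: "measure lebesgue (unit_box :: 'a::euclidean_space set) = 1"
  by (simp add: measure_completion content_cbox_cases)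

lemma unit_box_subset_cball: "unit_box \<subseteq> cball (0::'a::euclidean_space) DIM('a)"
proof
  fix t :: 'a assume "t \<in> unit_box"
  then have "(\<Sum>b\<in>Basis. \<bar>t \<bullet> b\<bar>) \<le> (\<Sum>b\<in>(Basis::'a set). 1)"
    unfolding mem_unit_box by (intro sum_mono) fastforce
  then show "t \<in> cball 0 DIM('a)" using norm_le_l1[of t] by simp
qed

text \<open>Transversality: an affine map of size \<rho> is at most \<delta> in norm only on a set of measure O(\<delta>/\<rho>). Unless that set
  is empty or \<delta> is comparable to \<rho>, some partial derivative has size comparable to \<rho>, and two points of the set on
  a line in that direction are O(\<delta>/\<rho>) apart.\<close>

lemma measure_affine_sublevel_le:
  fixes L :: "'a::euclidean_space \<Rightarrow> 'b::euclidean_space"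
  assumes L: "linear L" and \<delta>: "\<delta> > 0" and \<rho>: "\<rho> = norm a + (\<Sum>b\<in>Basis. norm (L b))" "\<rho> > 0"
  shows "measure lebesgue {t \<in> unit_box. norm (a + L t) \<le> \<delta>}
    \<le> (2 + 9 * real DIM('a) * measure lebesgue (cball (0::'a) (real DIM('a) + 1))) * (\<delta> / \<rho>)"
proof -
  let ?n = "real DIM('a)" and ?V = "measure lebesgue (cball (0::'a) (real DIM('a) + 1))"
  let ?S = "{t \<in> unit_box. norm (a + L t) \<le> \<delta>}"
  have n: "?n > 0" by simp
  have "continuous_on UNIV L" using L by (simp add: linear_continuous_on linear_conv_bounded_linear)
  moreover have "?S = unit_box \<inter> {t. norm (a + L t) \<le> \<delta>}" by auto
  ultimately have "compact ?S"
    by (auto intro!: compact_Int_closed closed_Collect_le continuous_intros compact_cbox)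
  then have Sm: "?S \<in> lmeasurable" by (rule lmeasurable_compact)
  consider "\<delta> \<ge> \<rho> / 2" | "\<delta> < \<rho> / 2" "?S = {}" | "\<delta> < \<rho> / 2" "?S \<noteq> {}" by linarith
  then show ?thesis
  proof cases
    case 1
    have "measure lebesgue ?S \<le> measure lebesgue (unit_box :: 'a set)"
      using Sm by (intro measure_mono_fmeasurable) auto
    also have "\<dots> \<le> 2 * (\<delta> / \<rho>)" using 1 \<rho>(2) unfolding measure_unit_box by (simp add: field_simps)
    also have "\<dots> \<le> (2 + 9 * ?n * ?V) * (\<delta> / \<rho>)" using \<delta> \<rho>(2) by (intro mult_right_mono) auto
    finally show ?thesis .
  next
    case 2
    have "0 \<le> (2 + 9 * ?n * ?V) * (\<delta> / \<rho>)" using \<delta> \<rho>(2) by (intro mult_nonneg_nonneg) auto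
    then show ?thesis unfolding 2(2) by simp
  next
    case 3
    have "\<exists>b\<in>Basis. \<rho> / (4 * ?n) \<le> norm (L b)"
    proof (rule ccontr)
      assume *: "\<not> ?thesis"
      have "(\<Sum>b\<in>Basis. norm (L b)) \<le> (\<Sum>b\<in>(Basis::'a set). \<rho> / (4 * ?n))"
        using * by (intro sum_mono) (force simp: not_le)
      then have le: "(\<Sum>b\<in>Basis. norm (L b)) \<le> \<rho> / 4" by simp
      obtain t where t: "t \<in> unit_box" "norm (a + L t) \<le> \<delta>" using 3 by auto
      have "L t = (\<Sum>b\<in>Basis. (t \<bullet> b) *\<^sub>R L b)"
        using L by (subst (1) euclidean_representation[symmetric])
          (simp add: linear_sum linear_cmul)
      also have "norm \<dots> \<le> (\<Sum>b\<in>Basis. 1 * norm (L b))"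
        using t(1) unfolding mem_unit_box
        by (intro order_trans[OF norm_sum] sum_mono, unfold norm_scaleR, intro mult_right_mono) force+
      finally have "norm (L t) \<le> \<rho> / 4" using le by simp
      moreover have "norm a \<le> norm (a + L t) + norm (L t)"
        using norm_triangle_ineq4[of "a + L t" "L t"] by simp
      ultimately show False using t 3 le \<rho> by linarith
    qed
    then obtain b where b: "b \<in> Basis" "\<rho> / (4 * ?n) \<le> norm (L b)" by blast
    have "measure lebesgue ?S \<le> 9 * ?n * \<delta> / \<rho> * ?V"
    proof (rule measure_translates_le[OF Sm, of "DIM('a)"])
      show "?S \<subseteq> cball 0 ?n" using unit_box_subset_cball by blast
      show "norm b = 1" using b by simp
      show "9 * ?n * \<delta> / \<rho> > 0" using \<delta> \<rho> by simp
      fix t s assume t: "t \<in> ?S" and s: "9 * ?n * \<delta> / \<rho> \<le> s"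
      have s0: "s > 0" using s \<open>9 * ?n * \<delta> / \<rho> > 0\<close> by linarith
      show "t + s *\<^sub>R b \<notin> ?S"
      proof
        assume t': "t + s *\<^sub>R b \<in> ?S"
        have "s * norm (L b) = norm ((a + L (t + s *\<^sub>R b)) - (a + L t))"
          using L s0 by (simp add: linear_add linear_cmul)
        also have "\<dots> \<le> 2 * \<delta>" using t t' by (intro order_trans[OF norm_triangle_ineq4]) auto
        finally have 1: "s * norm (L b) \<le> 2 * \<delta>" .
        have "9 / 4 * \<delta> = (9 * ?n * \<delta> / \<rho>) * (\<rho> / (4 * ?n))" using n \<rho>(2) by (simp add: field_simps)
        also have "\<dots> \<le> s * norm (L b)" using s b s0 \<rho>(2) n by (intro mult_mono) auto
        finally show False using 1 \<delta> by linarith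
      qed
    qed
    also have "\<dots> = (0 + 9 * ?n * ?V) * (\<delta> / \<rho>)" by simp
    also have "\<dots> \<le> (2 + 9 * ?n * ?V) * (\<delta> / \<rho>)" using \<delta> \<rho>(2) by (intro mult_right_mono) auto
    finally show ?thesis by simp
  qed
qed

section \<open>Orthonormal frames and transversality\<close>

definition orthonormal_on :: "'b set \<Rightarrow> ('b \<Rightarrow> 'a::real_inner) \<Rightarrow> bool" where
  "orthonormal_on K u \<longleftrightarrow> (\<forall>b\<in>K. \<forall>c\<in>K. u b \<bullet> u c = (if b = c then 1 else 0))"

text \<open>For an orthonormal family u this is the orthogonal projection onto the complement of its span, so that
  norm (perp K u (y - p)) is the distance of y from the affine subspace p + span (u ` K).\<close>

definition perp :: "'b set \<Rightarrow> ('b \<Rightarrow> 'a::real_inner) \<Rightarrow> 'a \<Rightarrow> 'a" where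
  "perp K u v = v - (\<Sum>b\<in>K. (v \<bullet> u b) *\<^sub>R u b)"

lemma linear_perp: "linear (perp K u)"
  unfolding perp_def
  by (rule linearI) (auto simp: inner_add_left sum.distrib algebra_simps scaleR_sum_right)

lemma inner_perp_frame:
  assumes "finite K" "orthonormal_on K u" "c \<in> K"
  shows "perp K u v \<bullet> u c = 0"
proof -
  have "(\<Sum>b\<in>K. (v \<bullet> u b) * (u b \<bullet> u c)) = (\<Sum>b\<in>K. if b = c then v \<bullet> u c else 0)"
    using assms by (intro sum.cong) (auto simp: orthonormal_on_def)
  then show ?thesis using assms by (simp add: perp_def inner_diff_left inner_sum_left sum.delta)
qed

lemma perp_inner_perp:
  assumes "finite K" "orthonormal_on K u"
  shows "perp K u v \<bullet> perp K u w = perp K u v \<bullet> w"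
  by (subst (2) perp_def) (simp add: inner_diff_right inner_sum_right inner_perp_frame[OF assms])

lemma perp_frame_0:
  assumes "finite K" "orthonormal_on K u" "c \<in> K"
  shows "perp K u (u c) = 0"
proof -
  have "perp K u (u c) \<bullet> perp K u (u c) = 0"
    using assms by (simp add: perp_inner_perp inner_perp_frame)
  then show ?thesis by simp
qed

lemma norm_perp_power2:
  assumes "finite K" "orthonormal_on K u"
  shows "(norm (perp K u v))\<^sup>2 = (norm v)\<^sup>2 - (\<Sum>b\<in>K. (v \<bullet> u b)\<^sup>2)"
  unfolding power2_norm_eq_inner perp_inner_perp[OF assms]
  by (simp add: perp_def inner_diff_left inner_diff_right inner_sum_left inner_sum_right power2_eq_square inner_commute)

lemma norm_perp_le:
  assumes "finite K" "orthonormal_on K u"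
  shows "norm (perp K u v) \<le> norm v"
proof (rule power2_le_imp_le)
  show "(norm (perp K u v))\<^sup>2 \<le> (norm v)\<^sup>2"
    unfolding norm_perp_power2[OF assms] by (simp add: sum_nonneg)
qed simp

text \<open>The gap between two subspaces of equal dimension is symmetric. In the Hilbert-Schmidt norm this is
  exact: both sides equal card K minus the sum of all squared inner products of the two frames.\<close>

lemma sum_norm_perp_sym:
  assumes "finite K" "orthonormal_on K u" "orthonormal_on K u'"
  shows "(\<Sum>b\<in>K. (norm (perp K u' (u b)))\<^sup>2) = (\<Sum>b\<in>K. (norm (perp K u (u' b)))\<^sup>2)"
proof -
  have n: "(norm (u b))\<^sup>2 = 1" "(norm (u' b))\<^sup>2 = 1" if "b \<in> K" for b
    using assms that by (auto simp: power2_norm_eq_inner orthonormal_on_def)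
  have "(\<Sum>b\<in>K. \<Sum>c\<in>K. (u b \<bullet> u' c)\<^sup>2) = (\<Sum>c\<in>K. \<Sum>b\<in>K. (u b \<bullet> u' c)\<^sup>2)"
    by (rule sum.swap)
  also have "\<dots> = (\<Sum>c\<in>K. \<Sum>b\<in>K. (u' c \<bullet> u b)\<^sup>2)" by (simp only: inner_commute)
  finally show ?thesis
    by (simp add: norm_perp_power2 assms sum_subtractf n)
qed

text \<open>If the plane of (p, u) is \<rho>-close to that of (p', u'), then x has almost the same distance from both. The
  definition of \<rho> only measures how far the first plane leaves the second one, whereas the proof needs
  the components of x - p along u', that is, the opposite direction; this is where
  \<open>sum_norm_perp_sym\<close> enters.\<close>

lemma frame_distance_shell:
  fixes r \<rho> :: real
  assumes K: "finite K" and u: "orthonormal_on K u" "orthonormal_on K u'"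
    and x: "\<And>b. b \<in> K \<Longrightarrow> (x - p) \<bullet> u b = 0" "norm (x - p) = r"
    and \<rho>: "\<rho> = norm (perp K u' (p - p')) + (\<Sum>b\<in>K. norm (perp K u' (u b)))"
  shows "\<bar>norm (perp K u' (x - p')) - r\<bar> \<le> (1 + real (card K) * r) * \<rho>"
proof -
  have r0: "r \<ge> 0" using x(2) by auto
  let ?\<sigma> = "\<Sum>b\<in>K. norm (perp K u' (u b))"
  have \<sigma>0: "?\<sigma> \<ge> 0" by (intro sum_nonneg) auto
  have px: "perp K u (x - p) = x - p" using x(1) by (simp add: perp_def)
  have le: "norm (perp K u (u' c)) \<le> ?\<sigma>" if "c \<in> K" for c
  proof (rule power2_le_imp_le[OF _ \<sigma>0])
    have "(norm (perp K u (u' c)))\<^sup>2 \<le> (\<Sum>b\<in>K. (norm (perp K u (u' b)))\<^sup>2)"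
      using that K by (intro member_le_sum) auto
    also have "\<dots> = (\<Sum>b\<in>K. (norm (perp K u' (u b)))\<^sup>2)" by (rule sum_norm_perp_sym[OF K u, symmetric])
    also have "\<dots> \<le> (\<Sum>b\<in>K. norm (perp K u' (u b)) * ?\<sigma>)"
      unfolding power2_eq_square using K by (intro sum_mono mult_left_mono member_le_sum) auto
    also have "\<dots> = ?\<sigma>\<^sup>2" by (simp add: power2_eq_square sum_distrib_right)
    finally show "(norm (perp K u (u' c)))\<^sup>2 \<le> ?\<sigma>\<^sup>2" .
  qed
  have coef: "\<bar>(x - p) \<bullet> u' c\<bar> \<le> r * ?\<sigma>" if "c \<in> K" for c
  proof -
    have "(x - p) \<bullet> u' c = (x - p) \<bullet> perp K u (u' c)"
      using perp_inner_perp[OF K u(1), of "x - p" "u' c"] px by simp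
    also have "\<bar>\<dots>\<bar> \<le> norm (x - p) * norm (perp K u (u' c))" by (rule Cauchy_Schwarz_ineq2)
    also have "\<dots> \<le> r * ?\<sigma>" using le[OF that] r0 x(2) by (intro mult_mono) auto
    finally show ?thesis .
  qed
  have nu': "norm (u' c) = 1" if "c \<in> K" for c
    using u(2) that by (simp add: norm_eq_sqrt_inner orthonormal_on_def)
  have "norm ((x - p) - perp K u' (x - p)) \<le> (\<Sum>c\<in>K. norm (((x - p) \<bullet> u' c) *\<^sub>R u' c))"
    unfolding perp_def by (rule order_trans[OF _ norm_sum]) simp
  also have "\<dots> \<le> (\<Sum>c\<in>K. r * ?\<sigma>)" using coef by (intro sum_mono) (simp add: nu')
  finally have 1: "norm ((x - p) - perp K u' (x - p)) \<le> card K * r * ?\<sigma>" by simp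
  have eq: "perp K u' (x - p') = perp K u' (x - p) + perp K u' (p - p')"
    using linear_add[OF linear_perp, of K u' "x - p" "p - p'"] by simp
  have "\<bar>norm (perp K u' (x - p')) - norm (x - p)\<bar> \<le> norm (perp K u' (x - p') - (x - p))"
    by (rule norm_triangle_ineq3)
  also have "\<dots> = norm (perp K u' (p - p') - ((x - p) - perp K u' (x - p)))" by (simp add: eq algebra_simps)
  also have "\<dots> \<le> norm (perp K u' (p - p')) + card K * r * ?\<sigma>"
    using norm_triangle_ineq4[of "perp K u' (p - p')" "(x - p) - perp K u' (x - p)"] 1 by linarith
  also have "\<dots> \<le> (1 + real (card K) * r) * norm (perp K u' (p - p')) + (1 + real (card K) * r) * ?\<sigma>"
    using r0 \<sigma>0 by (intro add_mono) (auto simp: algebra_simps)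
  also have "\<dots> = (1 + real (card K) * r) * \<rho>" by (simp add: \<rho> algebra_simps)
  finally show ?thesis using x(2) by simp
qed

text \<open>An isometric parametrisation of the affine subspace p + span (u ` K). The parameter lives in the ambient
  space, and its coordinates outside K are ignored; this keeps k-dimensional volume on the unit box equal to
  the Lebesgue measure of the whole space for every k.\<close>

definition frame_map :: "'a set \<Rightarrow> 'a \<Rightarrow> ('a \<Rightarrow> 'a) \<Rightarrow> 'a \<Rightarrow> 'a::euclidean_space" where
  "frame_map K p u t = p + (\<Sum>b\<in>K. (t \<bullet> b) *\<^sub>R u b)"

lemma continuous_frame_map: "continuous_on X (frame_map K p u)"
  unfolding frame_map_def by (intro continuous_intros)

lemma norm_frame_map_diff:
  assumes "finite K" "orthonormal_on K u"
  shows "(norm (frame_map K p u t - frame_map K p u s))\<^sup>2 = (\<Sum>b\<in>K. ((t - s) \<bullet> b)\<^sup>2)"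
proof -
  have 1: "frame_map K p u t - frame_map K p u s = (\<Sum>b\<in>K. ((t - s) \<bullet> b) *\<^sub>R u b)"
    by (simp add: frame_map_def inner_diff_left scaleR_diff_left sum_subtractf)
  have "(\<Sum>b\<in>K. ((t - s) \<bullet> b) *\<^sub>R u b) \<bullet> (\<Sum>b\<in>K. ((t - s) \<bullet> b) *\<^sub>R u b)
     = (\<Sum>b\<in>K. \<Sum>c\<in>K. ((t - s) \<bullet> b) * (((t - s) \<bullet> c) * (u b \<bullet> u c)))"
    by (simp add: inner_sum_left inner_sum_right)
       (simp add: inner_commute sum_distrib_left mult_ac)
  also have "\<dots> = (\<Sum>b\<in>K. \<Sum>c\<in>K. if b = c then ((t - s) \<bullet> b)\<^sup>2 else 0)"
    using assms(2) by (intro sum.cong) (auto simp: orthonormal_on_def power2_eq_square)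
  also have "\<dots> = (\<Sum>b\<in>K. ((t - s) \<bullet> b)\<^sup>2)" using assms(1) by (simp add: sum.delta)
  finally show ?thesis by (simp add: 1 power2_norm_eq_inner)
qed

text \<open>In the coordinates in K the preimage of a set of diameter \<delta> has extent O(\<delta>), in all others at most 1.\<close>

lemma measure_frame_preimage_le:
  fixes U :: "'a::euclidean_space set"
  assumes K: "K \<subseteq> Basis" and u: "orthonormal_on K u" and \<delta>: "\<delta> \<ge> 0"
    and U: "\<And>y z. y \<in> U \<Longrightarrow> z \<in> U \<Longrightarrow> dist y z \<le> \<delta>"
    and S: "S \<in> sets lebesgue" "S \<subseteq> {t \<in> unit_box. frame_map K p u t \<in> U}"
  shows "measure lebesgue S \<le> (2 * \<delta>) ^ card K"
proof (cases "S = {}")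
  case False
  have fK: "finite K" using K finite_Basis finite_subset by blast
  obtain s where s: "s \<in> S" using False by blast
  define l where "l = (\<Sum>b\<in>Basis. (if b \<in> K then s \<bullet> b - \<delta> else - 1/2) *\<^sub>R b)"
  define h where "h = (\<Sum>b\<in>Basis. (if b \<in> K then s \<bullet> b + \<delta> else 1/2) *\<^sub>R b)"
  have l: "l \<bullet> b = (if b \<in> K then s \<bullet> b - \<delta> else - 1/2)" and h: "h \<bullet> b = (if b \<in> K then s \<bullet> b + \<delta> else 1/2)"
    if "b \<in> Basis" for b
    using that by (auto simp: l_def h_def)
  have sub: "S \<subseteq> cbox l h"
  proof
    fix t assume t: "t \<in> S"
    have "\<bar>(t - s) \<bullet> b\<bar> \<le> \<delta>" if "b \<in> K" for b
    proof (rule power2_le_imp_le[OF _ \<delta>])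
      have "\<bar>(t - s) \<bullet> b\<bar>\<^sup>2 \<le> (\<Sum>b\<in>K. ((t - s) \<bullet> b)\<^sup>2)" using that fK
        by (simp add: member_le_sum[where f = "\<lambda>b. ((t - s) \<bullet> b)\<^sup>2"])
      also have "\<dots> = (norm (frame_map K p u t - frame_map K p u s))\<^sup>2" by (simp add: norm_frame_map_diff[OF fK u])
      also have "\<dots> \<le> \<delta>\<^sup>2" using U s t S(2) by (intro power_mono) (auto simp: dist_norm)
      finally show "\<bar>(t - s) \<bullet> b\<bar>\<^sup>2 \<le> \<delta>\<^sup>2" .
    qed
    then show "t \<in> cbox l h" using t S(2)
      by (auto simp: mem_box l h mem_unit_box inner_diff_left abs_le_iff) (smt (verit))+
  qed
  have "measure lebesgue S \<le> measure lebesgue (cbox l h)"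
    by (rule measure_mono_fmeasurable[OF sub S(1)]) auto
  also have "\<dots> = (\<Prod>b\<in>Basis. h \<bullet> b - l \<bullet> b)"
    using \<delta> by (subst measure_completion, simp, subst content_cbox) (auto simp: l h)
  also have "\<dots> = (\<Prod>b\<in>Basis. if b \<in> K then 2 * \<delta> else 1)" by (intro prod.cong) (auto simp: l h)
  also have "\<dots> = (2 * \<delta>) ^ card K"
    using K by (subst prod.If_cases) (auto simp: Int_absorb1)
  finally show ?thesis .
qed (use \<delta> in auto)

text \<open>Each summand is O(min 1 (\<delta>/\<rho>(x))) by transversality, where \<rho>(x) is the separation of the planes of x and
  x'. The number of points x with \<rho>(x) at most \<tau> is O(\<tau> \<delta>^-n), because they lie in a shell of width
  O(\<tau>) and are \<delta>-separated. So each of the dyadic ranges \<rho>(x) ~ 2^i \<delta> contributes O(\<delta>^(1-n)),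
  and there are about j of them.\<close>

lemma energy_estimate:
  fixes K :: "'a::euclidean_space set"
  assumes K: "K \<subseteq> Basis" and r: "r > 0"
  obtains C where "C > 0"
    "\<And>(j::nat) \<delta> G p u x'. \<lbrakk>\<delta> = (1/2) ^ j; finite G; G \<subseteq> cball 0 R; pairwise (\<lambda>x y. \<delta> \<le> dist x y) G;
       \<And>x. x \<in> G \<Longrightarrow> orthonormal_on K (u x);
       \<And>x. x \<in> G \<Longrightarrow> norm (x - p x) = r;
       \<And>x b. x \<in> G \<Longrightarrow> b \<in> K \<Longrightarrow> (x - p x) \<bullet> u x b = 0; x' \<in> G\<rbrakk> \<Longrightarrow>
       (\<Sum>x\<in>G. measure lebesgue {t \<in> unit_box. norm (perp K (u x') (frame_map K (p x) (u x) t - p x')) \<le> \<delta>})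
         \<le> C * (real j + 2) * \<delta> / \<delta> ^ DIM('a)"
proof -
  let ?n = "DIM('a)"
  have fK: "finite K" using K finite_Basis finite_subset by blast
  define Cs where "Cs = 2 + 9 * real ?n * measure lebesgue (cball (0::'a) (real ?n + 1))"
  define Csh where "Csh = (2 / r + 10 * (real ?n)\<^sup>2) * measure lebesgue (cball (0::'a) (R + 1 + 1))"
  define \<omega> where "\<omega> = measure lebesgue (ball (0::'a) 1)"
  have \<omega>: "\<omega> > 0" unfolding \<omega>_def by (rule measure_lebesgue_ball_1_pos)
  define C1 where "C1 = Csh * (2 + real (card K) * r) * 2 ^ ?n / \<omega>"
  define C2 where "C2 = measure lebesgue (cball (0::'a) (R + 1)) * 2 ^ ?n / \<omega>"
  have Cs: "Cs \<ge> 2" unfolding Cs_def by simp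
  have Csh0: "Csh \<ge> 0" unfolding Csh_def using r by (intro mult_nonneg_nonneg add_nonneg_nonneg) auto
  have C1: "C1 \<ge> 0" unfolding C1_def using Csh0 r \<omega> by (intro divide_nonneg_nonneg mult_nonneg_nonneg) auto
  have C2: "C2 \<ge> 0" unfolding C2_def using \<omega> by (intro divide_nonneg_nonneg mult_nonneg_nonneg) auto
  define C where "C = 2 * Cs * (C1 + C2 + 1)"
  show thesis
  proof (rule that[of C])
    show "C > 0" unfolding C_def using Cs C1 C2 by (intro mult_pos_pos) auto
  next
    fix j :: nat and \<delta> :: real and G :: "'a set" and p :: "'a \<Rightarrow> 'a" and u :: "'a \<Rightarrow> 'a \<Rightarrow> 'a" and x' :: 'a
    assume \<delta>: "\<delta> = (1/2::real) ^ j" and G: "finite G" "G \<subseteq> cball 0 R" "pairwise (\<lambda>x y. \<delta> \<le> dist x y) G"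
      and u: "\<And>x. x \<in> G \<Longrightarrow> orthonormal_on K (u x)"
      and nr: "\<And>x. x \<in> G \<Longrightarrow> norm (x - p x) = r"
      and orth: "\<And>x b. x \<in> G \<Longrightarrow> b \<in> K \<Longrightarrow> (x - p x) \<bullet> u x b = 0" and x': "x' \<in> G"
    have \<delta>0: "\<delta> > 0" "\<delta> \<le> 1" by (auto simp: \<delta> power_le_one)
    let ?A = "perp K (u x')"
    define m where "m x = measure lebesgue {t \<in> unit_box. norm (?A (frame_map K (p x) (u x) t - p x')) \<le> \<delta>}" for x
    define \<rho> where "\<rho> x = norm (?A (p x - p x')) + (\<Sum>b\<in>K. norm (?A (u x b)))" for x
    have \<rho>0: "\<rho> x \<ge> 0" for x unfolding \<rho>_def by (intro add_nonneg_nonneg sum_nonneg) auto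
    define L where "L x t = (\<Sum>b\<in>K. (t \<bullet> b) *\<^sub>R ?A (u x b))" for x t
    have linL: "linear (L x)" for x
      unfolding L_def by (rule linearI) (auto simp: inner_add_left sum.distrib algebra_simps scaleR_sum_right)
    have AL: "?A (frame_map K (p x) (u x) t - p x') = ?A (p x - p x') + L x t" for x t
    proof -
      have eq: "frame_map K (p x) (u x) t - p x' = (p x - p x') + (\<Sum>b\<in>K. (t \<bullet> b) *\<^sub>R u x b)"
        by (simp add: frame_map_def)
      note lp = linear_perp[of K "u x'"]
      show ?thesis
        unfolding eq L_def by (simp only: linear_add[OF lp] linear_sum[OF lp] linear_cmul[OF lp])
    qed
    have Lb: "L x b = (if b \<in> K then ?A (u x b) else 0)" if "b \<in> Basis" for b x
    proof -
      have "L x b = (\<Sum>c\<in>K. if c = b then ?A (u x c) else 0)"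
        unfolding L_def using K that by (intro sum.cong) (auto simp: inner_Basis)
      then show ?thesis using fK by (simp add: sum.delta)
    qed
    have sumL: "(\<Sum>b\<in>Basis. norm (L x b)) = (\<Sum>b\<in>K. norm (?A (u x b)))" for x
    proof -
      have "(\<Sum>b\<in>Basis. norm (L x b)) = (\<Sum>b\<in>Basis. if b \<in> K then norm (?A (u x b)) else 0)"
        by (intro sum.cong) (auto simp: Lb)
      also have "\<dots> = (\<Sum>b\<in>K. norm (?A (u x b)))"
        using K by (simp add: sum.If_cases Int_absorb1)
      finally show ?thesis .
    qed
    have m1: "m x \<le> 1" for x
    proof -
      have "m x \<le> measure lebesgue (unit_box :: 'a set)" unfolding m_def
      proof (rule measure_mono_fmeasurable)
        have "{t \<in> unit_box. norm (?A (frame_map K (p x) (u x) t - p x')) \<le> \<delta>}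
            = unit_box \<inter> {t. norm (?A (p x - p x') + L x t) \<le> \<delta>}" by (auto simp: AL)
        moreover have "compact \<dots>" using linL
          by (intro compact_Int_closed closed_Collect_le continuous_intros compact_cbox)
             (simp add: linear_continuous_on linear_conv_bounded_linear)
        ultimately show "{t \<in> unit_box. norm (?A (frame_map K (p x) (u x) t - p x')) \<le> \<delta>} \<in> sets lebesgue"
          by (simp add: lmeasurable_compact fmeasurableD)
      qed auto
      then show ?thesis by (simp only: measure_unit_box)
    qed
    have m2: "m x \<le> Cs * (\<delta> / \<rho> x)" if "\<rho> x > 0" for x
      unfolding m_def AL Cs_def
      by (rule measure_affine_sublevel_le[OF linL \<delta>0(1) _ that]) (simp add: \<rho>_def sumL)
    \<comment> \<open>The bound min 1 (\<delta>/\<rho>) as a sum over dyadic ranges of \<rho>; the term \<delta> covers separations above 1.\<close>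
    have mle: "m x \<le> 2 * Cs * ((\<Sum>i\<le>j. if \<rho> x \<le> 2^i * \<delta> then (1/2)^i else 0) + \<delta>)" (is "_ \<le> 2 * Cs * (?\<Sigma> + _)") for x
    proof -
      have ge: "?\<Sigma> \<ge> (1/2)^i" if "i \<le> j" "\<rho> x \<le> 2^i * \<delta>" for i
        using that member_le_sum[of i "{..j}" "\<lambda>i. if \<rho> x \<le> 2^i * \<delta> then (1/2)^i else (0::real)"] by simp
      have ge0: "?\<Sigma> \<ge> 0" by (intro sum_nonneg) auto
      consider "\<rho> x \<le> \<delta>" | "\<rho> x > 1" | "\<rho> x > \<delta>" "\<rho> x \<le> 1" by linarith
      then show ?thesis
      proof cases
        case 1
        have "1 \<le> 2 * Cs * 1" using Cs by simp
        also have "\<dots> \<le> 2 * Cs * (?\<Sigma> + \<delta>)" using ge[of 0] 1 \<delta>0 Cs by (intro mult_left_mono) auto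
        finally show ?thesis using m1[of x] by linarith
      next
        case 2
        have "m x \<le> Cs * (\<delta> / \<rho> x)" using 2 by (intro m2) auto
        also have "\<dots> \<le> (2 * Cs) * (?\<Sigma> + \<delta>)"
        proof (rule mult_mono)
          have "\<delta> / \<rho> x \<le> \<delta> / 1" using 2 \<delta>0 by (intro divide_left_mono) auto
          then show "\<delta> / \<rho> x \<le> ?\<Sigma> + \<delta>" using ge0 by simp
        qed (use Cs \<delta>0 \<rho>0 in auto)
        finally show ?thesis .
      next
        case 3
        define i where "i = (LEAST i. \<rho> x \<le> 2^i * \<delta>)"
        have ex: "\<rho> x \<le> 2^j * \<delta>" using 3 by (simp add: \<delta> power_one_over)
        have i: "\<rho> x \<le> 2^i * \<delta>" unfolding i_def by (rule LeastI[of _ j]) fact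
        have ij: "i \<le> j" unfolding i_def by (rule Least_le) fact
        have "i \<noteq> 0" using i 3 by (intro notI) auto
        then obtain l where l: "i = Suc l" by (cases i) auto
        have "\<not> \<rho> x \<le> 2^l * \<delta>" using not_less_Least[of l "\<lambda>i. \<rho> x \<le> 2^i * \<delta>"] l unfolding i_def by auto
        then have "\<delta> / \<rho> x \<le> 2 * (1/2)^i" using 3 \<delta>0 by (simp add: l field_simps power_one_over)
        also have "\<dots> \<le> 2 * (?\<Sigma> + \<delta>)" using order_trans[OF ge[OF ij i], of "?\<Sigma> + \<delta>"] \<delta>0 by (intro mult_left_mono) auto
        finally have "Cs * (\<delta> / \<rho> x) \<le> Cs * (2 * (?\<Sigma> + \<delta>))" using Cs by (intro mult_left_mono) auto
        then show ?thesis using m2[of x] 3 \<delta>0 by linarith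
      qed
    qed
    have balls: "(\<Union>x\<in>H. ball x (\<delta>/2)) \<subseteq> cball 0 (R + 1)" if "H \<subseteq> G" for H
    proof
      fix y assume "y \<in> (\<Union>x\<in>H. ball x (\<delta>/2))"
      then obtain x where x: "x \<in> H" "dist x y < \<delta>/2" by auto
      then have "norm x \<le> R" using that G(2) by auto
      moreover have "norm y \<le> norm x + dist x y" using dist_triangle[of 0 y x] by simp
      ultimately show "y \<in> cball 0 (R + 1)" using x \<delta>0 by simp
    qed
    have card_all: "real (card G) \<le> C2 / \<delta> ^ ?n"
    proof -
      have "real (card G) * ((\<delta>/2) ^ ?n * \<omega>) \<le> measure lebesgue (cball (0::'a) (R + 1))"
        unfolding \<omega>_def using balls[of G] by (intro card_separated_le G \<delta>0) auto
      then show ?thesis unfolding C2_def using \<delta>0 \<omega> by (simp add: field_simps)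
    qed
    have card_level: "real (card {x \<in> G. \<rho> x \<le> \<tau>}) \<le> C1 * \<tau> / \<delta> ^ ?n" if \<tau>: "\<tau> \<ge> \<delta>" for \<tau>
    proof -
      let ?H = "{x \<in> G. \<rho> x \<le> \<tau>}"
      let ?Y = "{z \<in> cball 0 (R + 1). \<bar>norm (?A (z - p x')) - r\<bar> \<le> (2 + real (card K) * r) * \<tau>}"
      have "real (card ?H) * ((\<delta>/2) ^ ?n * \<omega>) \<le> measure lebesgue ?Y"
        unfolding \<omega>_def
      proof (rule card_separated_le)
        show "finite ?H" using G by simp
        show "pairwise (\<lambda>x y. \<delta> \<le> dist x y) ?H" using G(3) by (rule pairwise_subset) auto
        have "?Y = cball 0 (R + 1) \<inter> {z. \<bar>norm (?A (z - p x')) - r\<bar> \<le> (2 + real (card K) * r) * \<tau>}" by auto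
        moreover have "compact \<dots>"
          unfolding perp_def by (intro compact_Int_closed closed_Collect_le continuous_intros compact_cball)
        ultimately show "?Y \<in> lmeasurable" by (simp add: lmeasurable_compact)
        show "(\<Union>x\<in>?H. ball x (\<delta>/2)) \<subseteq> ?Y"
        proof
          fix z assume z: "z \<in> (\<Union>x\<in>?H. ball x (\<delta>/2))"
          then obtain x where x: "x \<in> G" "\<rho> x \<le> \<tau>" "dist x z < \<delta>/2" by auto
          have "\<bar>norm (?A (x - p x')) - r\<bar> \<le> (1 + real (card K) * r) * \<rho> x"
            by (rule frame_distance_shell[OF fK u[OF x(1)] u[OF x'] orth[OF x(1)] nr[OF x(1)]]) (auto simp: \<rho>_def)
          also have "\<dots> \<le> (1 + real (card K) * r) * \<tau>" using x r by (intro mult_left_mono) auto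
          finally have 1: "\<bar>norm (?A (x - p x')) - r\<bar> \<le> (1 + real (card K) * r) * \<tau>" .
          have "\<bar>norm (?A (z - p x')) - norm (?A (x - p x'))\<bar> \<le> norm (?A (z - p x') - ?A (x - p x'))"
            by (rule norm_triangle_ineq3)
          also have "\<dots> = norm (?A (z - x))"
            using linear_diff[OF linear_perp, of K "u x'" "z - p x'" "x - p x'"] by simp
          also have "\<dots> \<le> norm (z - x)" by (rule norm_perp_le[OF fK u[OF x']])
          also have "\<dots> \<le> \<tau>" using x \<tau> \<delta>0 by (simp add: dist_norm norm_minus_commute)
          finally have "\<bar>norm (?A (z - p x')) - r\<bar> \<le> (2 + real (card K) * r) * \<tau>"
            using 1 by (simp add: algebra_simps)
          moreover have "z \<in> cball 0 (R + 1)" using balls[of ?H] z by blast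
          ultimately show "z \<in> ?Y" by blast
        qed
      qed (rule \<delta>0)
      also have "\<dots> \<le> Csh * ((2 + real (card K) * r) * \<tau>)"
        unfolding Csh_def using r \<tau> \<delta>0
        by (intro measure_shell_le linear_perp perp_inner_perp[OF fK u[OF x']] mult_pos_pos add_pos_nonneg) auto
      finally show ?thesis unfolding C1_def using \<delta>0 \<omega> by (simp add: field_simps)
    qed
    have "(\<Sum>x\<in>G. m x) \<le> (\<Sum>x\<in>G. 2 * Cs * ((\<Sum>i\<le>j. if \<rho> x \<le> 2^i * \<delta> then (1/2)^i else 0) + \<delta>))"
      by (intro sum_mono mle)
    also have "\<dots> = 2 * Cs * ((\<Sum>i\<le>j. \<Sum>x\<in>G. if \<rho> x \<le> 2^i * \<delta> then (1/2)^i else 0) + card G * \<delta>)"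
      by (subst sum.swap) (simp add: sum_distrib_left[symmetric] sum.distrib)
    also have "(\<Sum>i\<le>j. \<Sum>x\<in>G. if \<rho> x \<le> 2^i * \<delta> then (1/2)^i else 0) = (\<Sum>i\<le>j. (1/2)^i * real (card {x \<in> G. \<rho> x \<le> 2^i * \<delta>}))"
      using G(1) by (intro sum.cong refl) (simp add: sum.If_cases Int_def conj_commute mult.commute)
    also have "2 * Cs * ((\<Sum>i\<le>j. (1/2)^i * real (card {x \<in> G. \<rho> x \<le> 2^i * \<delta>})) + card G * \<delta>)
        \<le> 2 * Cs * ((\<Sum>i\<le>j. C1 * \<delta> / \<delta> ^ ?n) + C2 / \<delta> ^ ?n * \<delta>)"
    proof (intro mult_left_mono add_mono sum_mono mult_right_mono card_all)
      fix i
      have "(1/2)^i * real (card {x \<in> G. \<rho> x \<le> 2^i * \<delta>}) \<le> (1/2)^i * (C1 * (2^i * \<delta>) / \<delta> ^ ?n)"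
        using \<delta>0 by (intro mult_left_mono card_level) auto
      also have "\<dots> = C1 * \<delta> / \<delta> ^ ?n" by (simp add: power_one_over)
      finally show "(1/2)^i * real (card {x \<in> G. \<rho> x \<le> 2^i * \<delta>}) \<le> C1 * \<delta> / \<delta> ^ ?n" .
    qed (use Cs \<delta>0 in auto)
    also have "\<dots> = 2 * Cs * (C1 * (real j + 1) + C2) * (\<delta> / \<delta> ^ ?n)"
      by (simp add: algebra_simps add_divide_distrib)
    also have "\<dots> \<le> C * (real j + 2) * (\<delta> / \<delta> ^ ?n)"
    proof (rule mult_right_mono)
      have "C1 * (real j + 1) + C2 \<le> (C1 + C2 + 1) * (real j + 2)" using C1 C2 by (simp add: algebra_simps)
      then have "2 * Cs * (C1 * (real j + 1) + C2) \<le> 2 * Cs * ((C1 + C2 + 1) * (real j + 2))"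
        using Cs by (intro mult_left_mono) auto
      then show "2 * Cs * (C1 * (real j + 1) + C2) \<le> C * (real j + 2)" by (simp add: C_def)
    qed (use \<delta>0 in auto)
    finally show "(\<Sum>x\<in>G. measure lebesgue {t \<in> unit_box. norm (perp K (u x') (frame_map K (p x) (u x) t - p x')) \<le> \<delta>})
         \<le> C * (real j + 2) * \<delta> / \<delta> ^ ?n"
      by (simp add: m_def)
  qed
qed

section \<open>An incidence estimate for k-planes\<close>

text \<open>Cordoba's argument. Cauchy-Schwarz over the sets U i bounds the square of the total incidence by card I
  times the sum over pairs x, x' of the common incidences. If x and x' both meet a set of diameter \<delta>, then
  the piece of x is \<delta>-close to the plane of x' there, so the sum over pairs is controlled by the
  energy estimate; the factor \<delta>^k is the measure that one U i can have on the piece of x'.\<close>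

lemma incidence_estimate:
  fixes K :: "'a::euclidean_space set"
  assumes K: "K \<subseteq> Basis" and r: "r > 0"
  obtains C where "C > 0"
    "\<And>(j::nat) \<delta> G p u I U c. \<lbrakk>\<delta> = (1/2) ^ j; finite G; G \<subseteq> cball 0 R; pairwise (\<lambda>x y. \<delta> \<le> dist x y) G;
       \<And>x. x \<in> G \<Longrightarrow> orthonormal_on K (u x);
       \<And>x. x \<in> G \<Longrightarrow> norm (x - p x) = r;
       \<And>x b. x \<in> G \<Longrightarrow> b \<in> K \<Longrightarrow> (x - p x) \<bullet> u x b = 0;
       finite (I :: nat set); \<And>i. i \<in> I \<Longrightarrow> closed (U i); \<And>i. i \<in> I \<Longrightarrow> bounded (U i);
       \<And>i. i \<in> I \<Longrightarrow> diameter (U i) \<le> \<delta>; c \<ge> 0;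
       \<And>x. x \<in> G \<Longrightarrow> c \<le> measure lebesgue {t \<in> unit_box. frame_map K (p x) (u x) t \<in> (\<Union>i\<in>I. U i)}\<rbrakk> \<Longrightarrow>
       c\<^sup>2 * real (card G) * \<delta> ^ DIM('a) \<le> C * real (card I) * (real j + 2) * \<delta> ^ (card K + 1)"
proof -
  let ?n = "DIM('a)" and ?k = "card K"
  have fK: "finite K" using K finite_Basis finite_subset by blast
  obtain C where C: "C > 0" and energy:
    "\<And>(j::nat) \<delta> G p u x'. \<lbrakk>\<delta> = (1/2) ^ j; finite G; G \<subseteq> cball 0 R; pairwise (\<lambda>x y. \<delta> \<le> dist x y) G;
       \<And>x. x \<in> G \<Longrightarrow> orthonormal_on K (u x);
       \<And>x. x \<in> G \<Longrightarrow> norm (x - p x) = r;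
       \<And>x b. x \<in> G \<Longrightarrow> b \<in> K \<Longrightarrow> (x - p x) \<bullet> u x b = 0; x' \<in> G\<rbrakk> \<Longrightarrow>
       (\<Sum>x\<in>G. measure lebesgue {t \<in> unit_box. norm (perp K (u x') (frame_map K (p x) (u x) t - p x')) \<le> \<delta>})
         \<le> C * (real j + 2) * \<delta> / \<delta> ^ DIM('a)"
    using energy_estimate[OF K r, of R] by blast
  show thesis
  proof (rule that[of "2 ^ ?k * C"])
    show "2 ^ ?k * C > 0" using C by simp
  next
    fix j :: nat and \<delta> :: real and G :: "'a set" and p :: "'a \<Rightarrow> 'a" and u :: "'a \<Rightarrow> 'a \<Rightarrow> 'a"
      and I :: "nat set" and U :: "nat \<Rightarrow> 'a set" and c :: real
    assume \<delta>: "\<delta> = (1/2) ^ j" and G: "finite G" "G \<subseteq> cball 0 R" "pairwise (\<lambda>x y. \<delta> \<le> dist x y) G"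
      and u: "\<And>x. x \<in> G \<Longrightarrow> orthonormal_on K (u x)"
      and nr: "\<And>x. x \<in> G \<Longrightarrow> norm (x - p x) = r"
      and orth: "\<And>x b. x \<in> G \<Longrightarrow> b \<in> K \<Longrightarrow> (x - p x) \<bullet> u x b = 0"
      and I: "finite I" and U: "\<And>i. i \<in> I \<Longrightarrow> closed (U i)" "\<And>i. i \<in> I \<Longrightarrow> bounded (U i)"
        "\<And>i. i \<in> I \<Longrightarrow> diameter (U i) \<le> \<delta>"
      and c: "c \<ge> 0" "\<And>x. x \<in> G \<Longrightarrow> c \<le> measure lebesgue {t \<in> unit_box. frame_map K (p x) (u x) t \<in> (\<Union>i\<in>I. U i)}"
    have \<delta>0: "\<delta> > 0" by (simp add: \<delta>)
    \<comment> \<open>Making the sets disjoint lets the sum over i of the measures of their preimages be bounded by the measure of a union.\<close>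
    define D where "D i = U i - (\<Union>l\<in>{l \<in> I. l < i}. U l)" for i
    define S where "S x i = {t \<in> unit_box. frame_map K (p x) (u x) t \<in> D i}" for x i
    define a where "a x i = measure lebesgue (S x i)" for x i
    define M where "M x x' = {t \<in> unit_box. norm (perp K (u x') (frame_map K (p x) (u x) t - p x')) \<le> \<delta>}" for x x'
    have a0: "a x i \<ge> 0" for x i by (simp add: a_def)
    have Dborel: "D i \<in> sets borel" if "i \<in> I" for i
      unfolding D_def using I U(1) that by (intro sets.Diff sets.finite_UN borel_closed) auto
    have Sm: "S x i \<in> lmeasurable" if "i \<in> I" for x i
    proof (rule fmeasurableI2)
      have "frame_map K (p x) (u x) -` D i \<inter> space lborel \<in> sets lborel"
        using Dborel[OF that] by (intro measurable_sets[where A = borel])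
           (auto intro: borel_measurable_continuous_onI continuous_frame_map)
      then have "frame_map K (p x) (u x) -` D i \<in> sets lborel" by simp
      moreover have "S x i = unit_box \<inter> frame_map K (p x) (u x) -` D i" by (auto simp: S_def)
      ultimately show "S x i \<in> sets lebesgue" by (auto intro: sets.Int)
      show "S x i \<subseteq> unit_box" by (auto simp: S_def)
    qed simp
    have Sdisj: "S x i \<inter> S x l = {}" if "i \<in> I" "l \<in> I" "i \<noteq> l" for x i l
      using that by (cases "i < l") (auto simp: S_def D_def)
    have Mm: "M x x' \<in> lmeasurable" for x x'
    proof -
      have "M x x' = unit_box \<inter> {t. norm (perp K (u x') (frame_map K (p x) (u x) t - p x')) \<le> \<delta>}"
        by (auto simp: M_def)
      moreover have "compact \<dots>"
        unfolding perp_def frame_map_def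
        by (intro compact_Int_closed closed_Collect_le continuous_intros compact_cbox)
      ultimately show ?thesis by (simp add: lmeasurable_compact)
    qed
    have Ucov: "(\<Union>i\<in>I. U i) \<subseteq> (\<Union>i\<in>I. D i)"
    proof
      fix y assume "y \<in> (\<Union>i\<in>I. U i)"
      then obtain i where "i \<in> I \<and> y \<in> U i" by blast
      define i0 where "i0 = (LEAST i. i \<in> I \<and> y \<in> U i)"
      have "i0 \<in> I \<and> y \<in> U i0" unfolding i0_def by (rule LeastI) fact
      moreover have "\<not> (l \<in> I \<and> y \<in> U l)" if "l < i0" for l
        using not_less_Least that unfolding i0_def by blast
      ultimately have "y \<in> D i0" by (auto simp: D_def)
      then show "y \<in> (\<Union>i\<in>I. D i)" using \<open>i0 \<in> I \<and> y \<in> U i0\<close> by blast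
    qed
    have c_le: "c \<le> (\<Sum>i\<in>I. a x i)" if x: "x \<in> G" for x
    proof -
      have "{t \<in> unit_box. frame_map K (p x) (u x) t \<in> (\<Union>i\<in>I. U i)} = unit_box \<inter> (frame_map K (p x) (u x) -` (\<Union>i\<in>I. U i))"
        by auto
      moreover have "closed (frame_map K (p x) (u x) -` (\<Union>i\<in>I. U i))"
        using I U(1) by (intro closed_vimage continuous_frame_map closed_UN) auto
      ultimately have lm: "{t \<in> unit_box. frame_map K (p x) (u x) t \<in> (\<Union>i\<in>I. U i)} \<in> lmeasurable"
        by (simp add: lmeasurable_compact compact_Int_closed)
      have "c \<le> measure lebesgue {t \<in> unit_box. frame_map K (p x) (u x) t \<in> (\<Union>i\<in>I. U i)}"
        by (rule c(2)[OF x])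
      also have "\<dots> \<le> measure lebesgue (\<Union>i\<in>I. S x i)"
      proof (rule measure_mono_fmeasurable)
        show "{t \<in> unit_box. frame_map K (p x) (u x) t \<in> (\<Union>i\<in>I. U i)} \<subseteq> (\<Union>i\<in>I. S x i)"
          using Ucov unfolding S_def by blast
        show "(\<Union>i\<in>I. S x i) \<in> lmeasurable" using I Sm by (intro fmeasurable.finite_UN) auto
      qed (use lm in \<open>rule fmeasurableD\<close>)
      also have "\<dots> \<le> (\<Sum>i\<in>I. a x i)"
        unfolding a_def using I Sm by (intro measure_UNION_le) auto
      finally show ?thesis .
    qed
    have diam: "dist y z \<le> \<delta>" if "i \<in> I" "y \<in> D i" "z \<in> D i" for i y z
      using that diameter_bounded_bound[OF U(2), of i y z] U(3)[of i] by (auto simp: D_def)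
    have a_le: "a x i \<le> (2 * \<delta>) ^ ?k" if "x \<in> G" "i \<in> I" for x i
      unfolding a_def
    proof (rule measure_frame_preimage_le[OF K u[OF that(1)] less_imp_le[OF \<delta>0] diam[OF that(2)]])
      show "S x i \<in> sets lebesgue" using Sm[OF that(2)] by (rule fmeasurableD)
    qed (auto simp: S_def)
    have pair: "(\<Sum>i\<in>I. a x i * a x' i) \<le> (2 * \<delta>) ^ ?k * measure lebesgue (M x x')" if x: "x \<in> G" "x' \<in> G" for x x'
    proof -
      define I' where "I' = {i \<in> I. S x' i \<noteq> {}}"
      have I': "finite I'" "I' \<subseteq> I" using I by (auto simp: I'_def)
      have "(\<Sum>i\<in>I. a x i * a x' i) = (\<Sum>i\<in>I'. a x i * a x' i)"
        using I by (intro sum.mono_neutral_right) (auto simp: I'_def a_def)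
      also have "\<dots> \<le> (\<Sum>i\<in>I'. a x i * (2 * \<delta>) ^ ?k)"
        using I' x a_le a0 by (intro sum_mono mult_left_mono) auto
      also have "\<dots> = (2 * \<delta>) ^ ?k * (\<Sum>i\<in>I'. a x i)" by (simp only: sum_distrib_right[symmetric] mult.commute)
      also have "(\<Sum>i\<in>I'. a x i) = measure lebesgue (\<Union>i\<in>I'. S x i)"
        unfolding a_def
      proof (rule measure_finite_Union[symmetric])
        show "disjoint_family_on (S x) I'" unfolding disjoint_family_on_def using Sdisj I' by blast
      qed (use I' Sm in \<open>auto simp: fmeasurableD2 fmeasurableD subset_iff simp del: emeasure_completion\<close>)
      also have "\<dots> \<le> measure lebesgue (M x x')"
      proof (rule measure_mono_fmeasurable[OF _ _ Mm])
        show "(\<Union>i\<in>I'. S x i) \<in> sets lebesgue" using I' Sm by (intro sets.finite_UN fmeasurableD) auto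
        show "(\<Union>i\<in>I'. S x i) \<subseteq> M x x'"
        proof
          fix t assume "t \<in> (\<Union>i\<in>I'. S x i)"
          then obtain i t' where i: "i \<in> I" "t \<in> S x i" "t' \<in> S x' i" by (auto simp: I'_def)
          let ?\<phi> = "frame_map K (p x) (u x) t" and ?\<phi>' = "frame_map K (p x') (u x') t'"
          have d: "norm (?\<phi> - ?\<phi>') \<le> \<delta>" using diam[OF i(1)] i by (auto simp: S_def dist_norm)
          have lp: "linear (perp K (u x'))" by (rule linear_perp)
          have "perp K (u x') (?\<phi>' - p x') = (\<Sum>b\<in>K. (t' \<bullet> b) *\<^sub>R perp K (u x') (u x' b))"
            unfolding frame_map_def by (simp add: linear_sum[OF lp] linear_cmul[OF lp])
          also have "\<dots> = 0" using perp_frame_0[OF fK u[OF x(2)]] by simp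
          finally have "perp K (u x') (?\<phi> - p x') = perp K (u x') (?\<phi> - ?\<phi>')"
            using linear_add[OF lp, of "?\<phi> - ?\<phi>'" "?\<phi>' - p x'"] by simp
          also have "norm \<dots> \<le> norm (?\<phi> - ?\<phi>')" by (rule norm_perp_le[OF fK u[OF x(2)]])
          finally show "t \<in> M x x'" using d i by (auto simp: M_def S_def)
        qed
      qed
      finally show ?thesis using \<delta>0 by simp
    qed
    have "(\<Sum>i\<in>I. \<Sum>x\<in>G. \<Sum>x'\<in>G. a x i * a x' i) = (\<Sum>x\<in>G. \<Sum>i\<in>I. \<Sum>x'\<in>G. a x i * a x' i)"
      by (rule sum.swap)
    also have "\<dots> = (\<Sum>x\<in>G. \<Sum>x'\<in>G. \<Sum>i\<in>I. a x i * a x' i)"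
      by (intro sum.cong refl sum.swap)
    also have "\<dots> = (\<Sum>x'\<in>G. \<Sum>x\<in>G. \<Sum>i\<in>I. a x i * a x' i)"
      by (rule sum.swap)
    finally have reorder: "(\<Sum>i\<in>I. \<Sum>x\<in>G. \<Sum>x'\<in>G. a x i * a x' i) = (\<Sum>x'\<in>G. \<Sum>x\<in>G. \<Sum>i\<in>I. a x i * a x' i)" .
    have "(c * real (card G))\<^sup>2 \<le> (\<Sum>i\<in>I. 1 * (\<Sum>x\<in>G. a x i))\<^sup>2"
    proof (rule power_mono)
      have "c * real (card G) = (\<Sum>x\<in>G. c)" by simp
      also have "\<dots> \<le> (\<Sum>x\<in>G. \<Sum>i\<in>I. a x i)" by (intro sum_mono c_le)
      also have "\<dots> = (\<Sum>i\<in>I. 1 * (\<Sum>x\<in>G. a x i))" by (subst sum.swap) simp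
      finally show "c * real (card G) \<le> (\<Sum>i\<in>I. 1 * (\<Sum>x\<in>G. a x i))" .
    qed (use c in auto)
    also have "\<dots> \<le> (\<Sum>i\<in>I. 1\<^sup>2) * (\<Sum>i\<in>I. (\<Sum>x\<in>G. a x i)\<^sup>2)" by (rule Cauchy_Schwarz_ineq_sum)
    also have "\<dots> = card I * (\<Sum>i\<in>I. \<Sum>x\<in>G. \<Sum>x'\<in>G. a x i * a x' i)"
      by (simp add: power2_eq_square sum_product)
    also have "(\<Sum>i\<in>I. \<Sum>x\<in>G. \<Sum>x'\<in>G. a x i * a x' i) = (\<Sum>x'\<in>G. \<Sum>x\<in>G. \<Sum>i\<in>I. a x i * a x' i)"
      by (rule reorder)
    also have "card I * \<dots> \<le> card I * (\<Sum>x'\<in>G. \<Sum>x\<in>G. (2 * \<delta>) ^ ?k * measure lebesgue (M x x'))"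
      by (intro mult_left_mono sum_mono pair) auto
    also have "\<dots> = card I * (2 * \<delta>) ^ ?k * (\<Sum>x'\<in>G. \<Sum>x\<in>G. measure lebesgue (M x x'))"
      by (simp add: sum_distrib_left[symmetric] mult.assoc)
    also have "\<dots> \<le> card I * (2 * \<delta>) ^ ?k * (\<Sum>x'\<in>G. C * (real j + 2) * \<delta> / \<delta> ^ ?n)"
      unfolding M_def using \<delta>0
      by (intro mult_left_mono sum_mono energy[OF \<delta> G u nr orth]) auto
    also have "\<dots> = real (card G) * (2 ^ ?k * C * real (card I) * (real j + 2) * \<delta> ^ (?k + 1)) / \<delta> ^ ?n"
      by (simp add: power_mult_distrib mult_ac)
    finally have main: "(c * real (card G))\<^sup>2 \<le> real (card G) * (2 ^ ?k * C * real (card I) * (real j + 2) * \<delta> ^ (?k + 1)) / \<delta> ^ ?n" .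
    show "c\<^sup>2 * real (card G) * \<delta> ^ ?n \<le> 2 ^ ?k * C * real (card I) * (real j + 2) * \<delta> ^ (?k + 1)"
    proof (cases "card G = 0")
      case True
      then show ?thesis using C \<delta>0 by simp
    next
      case False
      then have "real (card G) > 0" by simp
      have "real (card G) * (c\<^sup>2 * real (card G) * \<delta> ^ ?n) \<le> real (card G) * (2 ^ ?k * C * real (card I) * (real j + 2) * \<delta> ^ (?k + 1))"
        using main \<delta>0 by (simp add: field_simps power2_eq_square)
      then show ?thesis using \<open>real (card G) > 0\<close> by (simp only: mult_le_cancel_left_pos)
    qed
  qed
qed

section \<open>The lower bound for sets containing many k-plane pieces\<close>

lemma measure_le_suminf_of_cover:
  assumes "\<And>i. A i \<in> lmeasurable" "\<And>i. measure lebesgue (A i) \<le> f i" "summable f"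
    "X \<subseteq> (\<Union>i::nat. A i)" "X \<in> lmeasurable"
  shows "measure lebesgue X \<le> suminf f"
proof -
  have f0: "f i \<ge> 0" for i using assms(2)[of i] measure_nonneg order_trans by blast
  have "emeasure lebesgue X \<le> emeasure lebesgue (\<Union>i. A i)"
    using assms by (intro emeasure_mono sets.countable_UN) (auto intro: fmeasurableD)
  also have "\<dots> \<le> (\<Sum>i. emeasure lebesgue (A i))"
    using assms by (intro emeasure_subadditive_countably) (auto intro: fmeasurableD)
  also have "\<dots> \<le> (\<Sum>i. ennreal (f i))"
    using assms by (intro suminf_le summableI) (simp add: emeasure_eq_measure2 ennreal_leI del: emeasure_completion)
  also have "\<dots> = ennreal (suminf f)" using f0 assms(3) by (intro suminf_ennreal2) auto
  finally have "ennreal (measure lebesgue X) \<le> ennreal (suminf f)"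
    using assms(5) by (simp add: emeasure_eq_measure2 del: emeasure_completion)
  then show ?thesis using f0 assms(3) by (subst (asm) ennreal_le_iff) (auto intro: suminf_nonneg)
qed

text \<open>Suppose that H^s(B) = 0 with s < k+1 and choose t between s and k+1. For the dyadic cover at exponent t,
  let X j be the set of points x for whose piece the sets of scale 2^-j cover a portion of measure q^j. As the
  sum of q^j over j at least j0 is below 1, the X j cover the unit box. But the incidence estimate
  bounds the size of a maximal 2^-j-separated subset of X j, and thereby the volume of X j, by a constant
  times (j+2) q^j, and j0 is chosen such that the sum of these volumes is below 1, too.\<close>

theorem hausdorff_dim_ge_of_frames:
  fixes K B :: "'a::euclidean_space set"
  assumes K: "K \<subseteq> Basis" and r: "r > 0"
    and frames: "\<And>x. \<exists>p u. orthonormal_on K u \<and> norm (x - p) = r \<and> (\<forall>b\<in>K. (x - p) \<bullet> u b = 0) \<and>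
        frame_map K p u ` unit_box \<subseteq> B"
  shows "ennreal (real (card K) + 1) \<le> hausdorff_dim B"
proof (rule hausdorff_dim_geI, rule notI)
  let ?n = "DIM('a)" and ?k = "card K"
  fix s assume s: "0 \<le> s" "s < real ?k + 1" and null: "hausdorff_measure s B = 0"
  obtain p u where u: "\<And>x. orthonormal_on K (u x)" and p: "\<And>x. norm (x - p x) = r"
    "\<And>x b. b \<in> K \<Longrightarrow> (x - p x) \<bullet> u x b = 0"
    and inB: "\<And>x t. t \<in> unit_box \<Longrightarrow> frame_map K (p x) (u x) t \<in> B"
    using frames unfolding image_subset_iff by metis
  define t where "t = (s + (real ?k + 1)) / 2"
  \<comment> \<open>A third of the available exponent: two of the three factors q^j are lost to the portion q^j, squared by Cauchy-Schwarz, and one is left for summability.\<close>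
  define \<eta> where "\<eta> = (real ?k + 1 - t) / 3"
  have t: "s < t" and \<eta>: "\<eta> > 0" using s by (auto simp: t_def \<eta>_def)
  define q where "q = (1/2::real) powr \<eta>"
  have q: "0 < q" "q < 1" using powr_less_mono2[of \<eta> "1/2" 1] \<eta> by (auto simp: q_def)
  have qj: "q ^ j = ((1/2)^j) powr \<eta>" for j
    unfolding q_def by (simp add: powr_realpow[symmetric] powr_powr mult.commute)
  obtain C where C: "C > 0" and inc:
    "\<And>(j::nat) \<delta> G p u I U c. \<lbrakk>\<delta> = (1/2) ^ j; finite G; G \<subseteq> cball 0 (real ?n); pairwise (\<lambda>x y. \<delta> \<le> dist x y) G;
       \<And>x. x \<in> G \<Longrightarrow> orthonormal_on K (u x);
       \<And>x. x \<in> G \<Longrightarrow> norm (x - p x) = r;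
       \<And>x b. x \<in> G \<Longrightarrow> b \<in> K \<Longrightarrow> (x - p x) \<bullet> u x b = 0;
       finite (I :: nat set); \<And>i. i \<in> I \<Longrightarrow> closed (U i); \<And>i. i \<in> I \<Longrightarrow> bounded (U i);
       \<And>i. i \<in> I \<Longrightarrow> diameter (U i) \<le> \<delta>; c \<ge> 0;
       \<And>x. x \<in> G \<Longrightarrow> c \<le> measure lebesgue {t \<in> unit_box. frame_map K (p x) (u x) t \<in> (\<Union>i\<in>I. U i)}\<rbrakk> \<Longrightarrow>
       c\<^sup>2 * real (card G) * \<delta> ^ ?n \<le> C * real (card I) * (real j + 2) * \<delta> ^ (?k + 1)"
    using incidence_estimate[OF K r, of "real ?n"] by blast
  define \<omega> where "\<omega> = measure lebesgue (ball (0::'a) 1)"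
  have \<omega>: "\<omega> > 0" unfolding \<omega>_def by (rule measure_lebesgue_ball_1_pos)
  \<comment> \<open>One sequence that dominates both q^j and the volume bound for X j.\<close>
  define f where "f j = (\<omega> * C + 1) * ((real j + 2) * q ^ j)" for j
  have f0: "f j \<ge> 0" for j using \<omega> C q by (auto simp: f_def)
  have sumf: "summable f"
  proof -
    have "summable (\<lambda>j. of_nat (Suc j) * q ^ j + q ^ j)"
      using q geometric_deriv_sums[of q] by (intro summable_add summable_geometric) (auto simp: sums_iff)
    then show ?thesis unfolding f_def by (intro summable_mult) (simp add: algebra_simps)
  qed
  obtain j0 where j0: "norm (\<Sum>j. f (j + j0)) < 1"
    using suminf_exist_split[OF zero_less_one sumf] by blast
  have sumf': "summable (\<lambda>j. f (j + j0))" using sumf by (simp add: summable_iff_shift)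
  have tail: "(\<Sum>j. f (j + j0)) < 1" using j0 by simp
  have qf: "q ^ j \<le> f j" for j
  proof -
    have "1 * (1 * q ^ j) \<le> (\<omega> * C + 1) * ((real j + 2) * q ^ j)"
      using \<omega> C q by (intro mult_mono mult_nonneg_nonneg) auto
    then show ?thesis by (simp add: f_def)
  qed
  obtain U :: "nat \<Rightarrow> 'a set" and J :: "nat \<Rightarrow> nat" where UJ:
    "B \<subseteq> (\<Union>i. U i)" "\<And>i. closed (U i)" "\<And>i. bounded (U i)" "\<And>i. diameter (U i) \<le> (1/2) ^ J i"
    "\<And>i. j0 \<le> J i" "\<And>j. finite {i. J i = j}" "\<And>j. real (card {i. J i = j}) * ((1/2)^j) powr t \<le> 1"
    using hausdorff_null_dyadic_cover[OF null s(1) t, of j0] by blast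
  define Y where "Y x j = {t \<in> unit_box. frame_map K (p x) (u x) t \<in> (\<Union>i\<in>{i. J i = j}. U i)}" for x j
  have Ym: "Y x j \<in> lmeasurable" for x j
  proof -
    have "Y x j = unit_box \<inter> (frame_map K (p x) (u x) -` (\<Union>i\<in>{i. J i = j}. U i))"
      by (auto simp: Y_def)
    moreover have "closed (frame_map K (p x) (u x) -` (\<Union>i\<in>{i. J i = j}. U i))"
      using UJ by (intro closed_vimage continuous_frame_map closed_UN) auto
    ultimately show ?thesis
      by (simp add: lmeasurable_compact compact_Int_closed)
  qed
  define X where "X j = {x \<in> unit_box. q ^ j \<le> measure lebesgue (Y x j)}" for j
  have Xcov: "unit_box \<subseteq> (\<Union>j. X (j + j0))"
  proof (rule ccontr)
    assume "\<not> ?thesis"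
    then obtain x where x: "x \<in> unit_box" "\<And>j. x \<notin> X (j + j0)" by blast
    have "measure lebesgue (unit_box :: 'a set) \<le> (\<Sum>j. f (j + j0))"
    proof (rule measure_le_suminf_of_cover[OF Ym _ sumf'])
      show "measure lebesgue (Y x (j + j0)) \<le> f (j + j0)" for j
        using x(1) x(2)[of j] qf[of "j + j0"] by (auto simp: X_def)
      show "unit_box \<subseteq> (\<Union>j. Y x (j + j0))"
      proof
        fix t :: 'a assume t: "t \<in> unit_box"
        then obtain i where i: "frame_map K (p x) (u x) t \<in> U i" using inB UJ(1) by blast
        then have "t \<in> Y x (J i)" using t by (auto simp: Y_def)
        then have "t \<in> Y x ((J i - j0) + j0)" using UJ(5)[of i] by simp
        then show "t \<in> (\<Union>j. Y x (j + j0))" by blast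
      qed
    qed simp
    then show False using tail unfolding measure_unit_box by simp
  qed
  have "\<exists>A\<in>lmeasurable. X j \<subseteq> A \<and> measure lebesgue A \<le> f j" for j
  proof -
    define \<delta> where "\<delta> = (1/2::real) ^ j"
    have \<delta>: "\<delta> > 0" by (simp add: \<delta>_def)
    have "bounded (X j)" by (rule bounded_subset[OF bounded_cbox]) (auto simp: X_def)
    then obtain G where G: "finite G" "G \<subseteq> X j" "pairwise (\<lambda>x y. \<delta> \<le> dist x y) G" "X j \<subseteq> (\<Union>x\<in>G. ball x \<delta>)"
      using maximal_separated_subset \<delta> by blast
    let ?I = "{i. J i = j}"
    have "(q ^ j)\<^sup>2 * real (card G) * \<delta> ^ ?n \<le> C * real (card ?I) * (real j + 2) * \<delta> ^ (?k + 1)"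
    proof (rule inc[OF \<delta>_def G(1) _ G(3) u p])
      show "G \<subseteq> cball 0 (real ?n)" using G(2) unit_box_subset_cball unfolding X_def by blast
      show "q ^ j \<le> measure lebesgue {t \<in> unit_box. frame_map K (p x) (u x) t \<in> (\<Union>i\<in>?I. U i)}" if "x \<in> G" for x
        using that G(2) unfolding X_def Y_def by blast
      show "diameter (U i) \<le> \<delta>" if "i \<in> ?I" for i using that UJ(4)[of i] by (simp add: \<delta>_def)
      show "finite ?I" by (rule UJ(6))
      show "0 \<le> q ^ j" using q by simp
    qed (assumption | rule UJ)+
    also have "\<delta> ^ (?k + 1) = \<delta> powr t * (q ^ j) ^ 3"
    proof -
      have "(q ^ j) ^ 3 = \<delta> powr (3 * \<eta>)"
        using \<delta> by (simp add: qj \<delta>_def powr_realpow[symmetric] powr_powr mult_ac)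
      then have "\<delta> powr t * (q ^ j) ^ 3 = \<delta> powr (t + 3 * \<eta>)" by (simp add: powr_add)
      also have "t + 3 * \<eta> = real (?k + 1)" by (simp add: \<eta>_def field_simps)
      also have "\<delta> powr real (?k + 1) = \<delta> ^ (?k + 1)" using \<delta> by (rule powr_realpow)
      finally show ?thesis by simp
    qed
    also have "C * real (card ?I) * (real j + 2) * (\<delta> powr t * (q ^ j) ^ 3)
        = (real (card ?I) * \<delta> powr t) * (C * (real j + 2) * (q ^ j) ^ 3)" by simp
    also have "\<dots> \<le> 1 * (C * (real j + 2) * (q ^ j) ^ 3)"
      using UJ(7)[of j] C q unfolding \<delta>_def by (intro mult_right_mono) auto
    finally have "(q ^ j)\<^sup>2 * (real (card G) * \<delta> ^ ?n) \<le> (q ^ j)\<^sup>2 * (C * (real j + 2) * q ^ j)"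
      by (simp add: power2_eq_square power3_eq_cube mult_ac)
    then have *: "real (card G) * \<delta> ^ ?n \<le> C * (real j + 2) * q ^ j"
      using q by (subst (asm) mult_le_cancel_left_pos) auto
    have "measure lebesgue (\<Union>x\<in>G. ball x \<delta>) \<le> (\<Sum>x\<in>G. measure lebesgue (ball x \<delta>))"
      using G(1) by (intro measure_UNION_le) auto
    also have "\<dots> = \<omega> * (real (card G) * \<delta> ^ ?n)"
      using \<delta> by (subst sum.cong[OF refl measure_lebesgue_ball]) (auto simp: \<omega>_def)
    also have "\<dots> \<le> \<omega> * (C * (real j + 2) * q ^ j)" using * \<omega> by (intro mult_left_mono) auto
    also have "\<dots> \<le> f j" using q by (simp add: f_def algebra_simps)
    finally have "measure lebesgue (\<Union>x\<in>G. ball x \<delta>) \<le> f j" .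
    moreover have "(\<Union>x\<in>G. ball x \<delta>) \<in> lmeasurable" using G(1) by (intro fmeasurable.finite_UN) auto
    ultimately show ?thesis using G(4) by blast
  qed
  then obtain A where A: "\<And>j. A j \<in> lmeasurable" "\<And>j. X j \<subseteq> A j" "\<And>j. measure lebesgue (A j) \<le> f j"
    by metis
  have "measure lebesgue (unit_box :: 'a set) \<le> (\<Sum>j. f (j + j0))"
  proof (rule measure_le_suminf_of_cover[OF A(1) A(3) sumf'])
    show "unit_box \<subseteq> (\<Union>j. A (j + j0))" using Xcov A(2) by blast
  qed simp
  then show False using tail unfolding measure_unit_box by simp
qed

section \<open>The lower bounds for affine subspaces and for cube skeletons\<close>

lemma frame_of_affine_subspace:
  fixes P K :: "'a::euclidean_space set"
  assumes P: "affine P" "aff_dim P = int (card K)" and K: "K \<subseteq> Basis"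
  obtains p u where "orthonormal_on K u" "norm (x - p) = infdist x P" "\<And>b. b \<in> K \<Longrightarrow> (x - p) \<bullet> u b = 0"
    "range (frame_map K p u) \<subseteq> P"
proof -
  have "P \<noteq> {}" using P(2) by auto
  then obtain p where p: "p \<in> P" "infdist x P = dist x p"
    using infdist_attains_inf[OF affine_closed[OF P(1)]] by blast
  define V where "V = (\<lambda>y. y - p) ` P"
  have V: "subspace V" unfolding V_def using affine_diffs_subspace_subtract[OF P(1) p(1)] .
  have VP: "p + v \<in> P" if "v \<in> V" for v using that by (auto simp: V_def)
  have dimV: "dim V = card K"
  proof -
    have "aff_dim P = int (dim V)"
      unfolding V_def using p(1) by (intro aff_dim_eq_dim_subtract hull_inc)
    then show ?thesis using P(2) by simp
  qed
  obtain Bs where Bs: "Bs \<subseteq> V" "pairwise orthogonal Bs" "\<And>v. v \<in> Bs \<Longrightarrow> norm v = 1"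
    "independent Bs" "card Bs = dim V" "span Bs = V"
    using orthonormal_basis_subspace[OF V] by blast
  have "finite K" using K finite_Basis finite_subset by blast
  moreover have "finite Bs" using Bs(4) independent_imp_finite by blast
  ultimately obtain u where u: "bij_betw u K Bs"
    using finite_same_card_bij Bs(5) dimV by metis
  have uB: "u b \<in> Bs" if "b \<in> K" for b using u that by (auto simp: bij_betw_def)
  have orth: "orthonormal_on K u"
    unfolding orthonormal_on_def
  proof (intro ballI)
    fix b c assume bc: "b \<in> K" "c \<in> K"
    show "u b \<bullet> u c = (if b = c then 1 else 0)"
    proof (cases "b = c")
      case True
      then show ?thesis using Bs(3)[OF uB[OF bc(1)]] by (simp add: norm_eq_sqrt_inner)
    next
      case False
      then have "u b \<noteq> u c" using u bc by (auto simp: bij_betw_def inj_on_def)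
      then show ?thesis using False Bs(2) uB bc by (auto simp: pairwise_def orthogonal_def)
    qed
  qed
  have perp: "(x - p) \<bullet> v = 0" if v: "v \<in> V" "norm v = 1" for v
  proof -
    define w where "w = x - p"
    define c where "c = w \<bullet> v"
    have vv: "v \<bullet> v = 1" using v(2) by (simp add: norm_eq_sqrt_inner)
    have "p + c *\<^sub>R v \<in> P" using v V by (intro VP) (auto simp: subspace_def)
    then have "dist x p \<le> dist x (p + c *\<^sub>R v)" using infdist_le p(2) by metis
    then have "(norm w)\<^sup>2 \<le> (norm (w - c *\<^sub>R v))\<^sup>2"
      by (intro power_mono) (auto simp: dist_norm w_def algebra_simps)
    also have "\<dots> = w \<bullet> w - 2 * c * (w \<bullet> v) + c * c * (v \<bullet> v)"
      unfolding power2_norm_eq_inner by (simp add: algebra_simps inner_commute)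
    also have "\<dots> = (norm w)\<^sup>2 - c * c" by (simp add: vv power2_norm_eq_inner flip: c_def)
    finally have "c * c \<le> 0" by simp
    then have "c = 0" by (auto simp: mult_le_0_iff)
    then show ?thesis by (simp add: c_def w_def)
  qed
  show thesis
  proof (rule that[OF orth])
    show "norm (x - p) = infdist x P" using p by (simp add: dist_norm)
    show "(x - p) \<bullet> u b = 0" if "b \<in> K" for b using perp uB[OF that] Bs by blast
    show "range (frame_map K p u) \<subseteq> P"
    proof safe
      fix t
      have "(\<Sum>b\<in>K. (t \<bullet> b) *\<^sub>R u b) \<in> V"
        using V uB Bs(1) by (intro subspace_sum subspace_scale) auto
      then show "frame_map K p u t \<in> P" using VP by (simp add: frame_map_def)
    qed
  qed
qed

theorem hausdorff_dim_ge_of_affine_subspaces: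
  fixes B :: "'a::euclidean_space set"
  assumes "k \<le> DIM('a)" "d > 0" "\<And>x. contains_affine_subspace_at_dist k d x B"
  shows "ennreal (real k + 1) \<le> hausdorff_dim B"
proof -
  obtain K :: "'a set" where K: "K \<subseteq> Basis" "card K = k"
    using obtain_subset_with_card_n[OF assms(1)] by metis
  have "ennreal (real (card K) + 1) \<le> hausdorff_dim B"
  proof (rule hausdorff_dim_ge_of_frames[OF K(1) assms(2)])
    fix x
    from assms(3)[of x] obtain P where P: "affine P" "aff_dim P = int k" "infdist x P = d" "P \<subseteq> B"
      by (auto simp: contains_affine_subspace_at_dist_def)
    obtain p u where "orthonormal_on K u" "norm (x - p) = d" "\<And>b. b \<in> K \<Longrightarrow> (x - p) \<bullet> u b = 0"
      "range (frame_map K p u) \<subseteq> P"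
      using frame_of_affine_subspace[of P K x] P K by metis
    then show "\<exists>p u. orthonormal_on K u \<and> norm (x - p) = d \<and> (\<forall>b\<in>K. (x - p) \<bullet> u b = 0) \<and>
        frame_map K p u ` unit_box \<subseteq> B" using P(4) by blast
  qed
  then show ?thesis by (simp add: K)
qed

text \<open>The face of the unit box through the corner (1/2, ..., 1/2) in the directions of K.\<close>

definition corner_face :: "'a set \<Rightarrow> 'a::euclidean_space set" where
  "corner_face K = {y \<in> unit_box. \<forall>b\<in>Basis - K. y \<bullet> b = 1/2}"

lemma corner_face_face_of: "corner_face K face_of unit_box"
  unfolding face_of_def
proof (intro conjI ballI impI)
  show "corner_face K \<subseteq> unit_box" by (auto simp: corner_face_def)
  show "convex (corner_face K)"
  proof -
    have "corner_face K = unit_box \<inter> (\<Inter>b\<in>Basis - K. {y. b \<bullet> y = 1/2})"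
      by (auto simp: corner_face_def inner_commute)
    also have "convex \<dots>" by (intro convex_Int convex_box convex_INT convex_hyperplane)
    finally show ?thesis .
  qed
  fix a b x assume ab: "a \<in> unit_box" "b \<in> unit_box" and x: "x \<in> corner_face K" "x \<in> open_segment a b"
  obtain u where u: "0 < u" "u < 1" "x = (1 - u) *\<^sub>R a + u *\<^sub>R b" using x(2) by (auto simp: in_segment)
  have *: "a \<bullet> c = 1/2 \<and> b \<bullet> c = 1/2" if c: "c \<in> Basis - K" for c
  proof -
    have eq: "(1 - u) * (1/2 - a \<bullet> c) + u * (1/2 - b \<bullet> c) = 0"
    proof -
      have "x \<bullet> c = 1/2" using x(1) c by (auto simp: corner_face_def)
      then have "(1 - u) * (a \<bullet> c) + u * (b \<bullet> c) = 1/2" unfolding u(3) by (simp add: inner_add_left)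
      then show ?thesis by (simp add: field_simps)
    qed
    have "1/2 - a \<bullet> c \<ge> 0" "1/2 - b \<bullet> c \<ge> 0" using ab c by (auto simp: mem_unit_box abs_le_iff)
    then have "(1 - u) * (1/2 - a \<bullet> c) \<ge> 0" "u * (1/2 - b \<bullet> c) \<ge> 0" using u by auto
    then have "(1 - u) * (1/2 - a \<bullet> c) = 0" "u * (1/2 - b \<bullet> c) = 0" using eq by linarith+
    then show ?thesis using u by auto
  qed
  then show "a \<in> corner_face K" "b \<in> corner_face K" using ab by (auto simp: corner_face_def)
qed

lemma aff_dim_corner_face:
  fixes K :: "'a::euclidean_space set"
  assumes K: "K \<subseteq> Basis"
  shows "aff_dim (corner_face K) = int (card K)"
proof -
  define c where "c = (\<Sum>b\<in>Basis - K. (1/2::real) *\<^sub>R b)"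
  have cb: "c \<bullet> b = (if b \<in> K then 0 else 1/2)" if "b \<in> Basis" for b
    using that by (auto simp: c_def inner_sum_left inner_Basis if_distrib sum.delta cong: if_cong)
  define G where "G = {y. (\<forall>b\<in>K. \<bar>y \<bullet> b\<bar> \<le> 1/2) \<and> (\<forall>b\<in>Basis. b \<notin> K \<longrightarrow> y \<bullet> b = 0)}"
  have "corner_face K = (+) c ` G"
  proof (intro equalityI subsetI)
    fix y assume "y \<in> corner_face K"
    then have "y - c \<in> G" using K by (auto simp: corner_face_def G_def mem_unit_box inner_diff_left cb subset_iff)
    then show "y \<in> (+) c ` G" by (metis add_diff_cancel_left' add_diff_eq image_eqI)
  next
    fix y assume "y \<in> (+) c ` G"
    then show "y \<in> corner_face K" using K by (auto simp: corner_face_def G_def mem_unit_box inner_add_left cb subset_iff)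
  qed
  then have "aff_dim (corner_face K) = aff_dim G" by (simp add: aff_dim_translation_eq)
  also have "\<dots> = int (dim G)"
    by (rule aff_dim_zero) (auto intro!: hull_inc simp: G_def)
  also have "dim G = card K"
  proof (rule antisym)
    have "dim G \<le> dim {y::'a. \<forall>b\<in>Basis. b \<notin> K \<longrightarrow> y \<bullet> b = 0}"
      by (rule dim_subset) (auto simp: G_def)
    also have "\<dots> = card K" by (rule dim_substandard[OF K])
    finally show "dim G \<le> card K" .
    have "K \<subseteq> span G"
    proof
      fix b assume b: "b \<in> K"
      then have "(1/2) *\<^sub>R b \<in> G" using K by (auto simp: G_def inner_Basis subset_iff)
      then have "2 *\<^sub>R (1/2) *\<^sub>R b \<in> span G" by (intro span_scale span_base)
      then show "b \<in> span G" by simp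
    qed
    then have "dim K \<le> dim (span G)" by (rule dim_subset)
    moreover have "dim K = card K" using K independent_Basis independent_mono by (intro dim_eq_card_independent) blast
    ultimately show "card K \<le> dim G" by (simp add: dim_span)
  qed
  finally show ?thesis .
qed

lemma mem_unit_box_cart: "(y :: real^'n) \<in> unit_box \<longleftrightarrow> (\<forall>i. \<bar>y $ i\<bar> \<le> 1/2)"
proof -
  have *: "y $ i = y \<bullet> axis i 1" for i by (simp add: inner_axis)
  have "y \<in> unit_box \<longleftrightarrow> (\<forall>b\<in>range (\<lambda>i::'n. axis i (1::real)). \<bar>y \<bullet> b\<bar> \<le> 1/2)"
    unfolding mem_unit_box by (rule ball_cong) (auto simp: Basis_vec_def)
  then show ?thesis by (simp add: *)
qed

lemma cube_eq_scaled_unit_box: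
  assumes "l > 0"
  shows "cbox (\<chi> i. - l / 2) (\<chi> i. l / 2) = (*\<^sub>R) l ` (unit_box :: (real^'n) set)"
proof -
  have "y \<in> cbox (\<chi> i. - l / 2) (\<chi> i. l / 2) \<longleftrightarrow> (1/l) *\<^sub>R y \<in> unit_box" for y :: "real^'n"
  proof -
    have "- l / 2 \<le> y $ i \<and> y $ i \<le> l / 2 \<longleftrightarrow> \<bar>y $ i\<bar> \<le> l / 2" for i by auto
    also have "\<bar>y $ i\<bar> \<le> l / 2 \<longleftrightarrow> \<bar>((1/l) *\<^sub>R y) $ i\<bar> \<le> 1/2" for i
      using assms by (simp add: field_simps)
    finally show ?thesis by (subst mem_unit_box_cart, subst mem_box_cart) simp
  qed
  moreover have "(1/l) *\<^sub>R y \<in> X \<longleftrightarrow> y \<in> (*\<^sub>R) l ` X" for y :: "real^'n" and X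
  proof
    assume "(1/l) *\<^sub>R y \<in> X"
    then have "l *\<^sub>R (1/l) *\<^sub>R y \<in> (*\<^sub>R) l ` X" by (rule imageI)
    then show "y \<in> (*\<^sub>R) l ` X" using assms by simp
  qed (use assms in auto)
  ultimately show ?thesis by blast
qed

lemma rotated_cube_eq:
  assumes "l > 0"
  shows "rotated_cube x l \<alpha> = (\<lambda>y. x + l *\<^sub>R (\<alpha> *v y)) ` unit_box"
  unfolding rotated_cube_def cube_eq_scaled_unit_box[OF assms] image_image
  by (simp add: matrix_vector_mult_scaleR)

lemma rotation_matrix_isometry:
  assumes "rotation_matrix (\<alpha> :: real^'n^'n)"
  shows "orthogonal_transformation ((*v) \<alpha>)" "(\<alpha> *v v) \<bullet> (\<alpha> *v w) = v \<bullet> w" "norm (\<alpha> *v v) = norm v" "inj ((*v) \<alpha>)"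
proof -
  show 1: "orthogonal_transformation ((*v) \<alpha>)"
    using assms by (simp add: orthogonal_transformation_matrix rotation_matrix_def)
  then show "(\<alpha> *v v) \<bullet> (\<alpha> *v w) = v \<bullet> w" by (simp add: orthogonal_transformation_def)
  show "norm (\<alpha> *v v) = norm v" using 1 orthogonal_transformation_norm by blast
  show "inj ((*v) \<alpha>)" using 1 orthogonal_transformation_inj by blast
qed

lemma skeleton_rotated_cube:
  fixes \<alpha> :: "real^'n^'n"
  assumes l: "l > 0" and \<alpha>: "rotation_matrix \<alpha>"
  shows "skeleton k (rotated_cube x l \<alpha>) =
    (\<Union>F\<in>{F. F face_of unit_box \<and> aff_dim F = int k}. (\<lambda>y. x + l *\<^sub>R (\<alpha> *v y)) ` F)"
proof -
  let ?f = "\<lambda>y. l *\<^sub>R (\<alpha> *v y)" and ?g = "\<lambda>y. x + l *\<^sub>R (\<alpha> *v y)"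
  have lin: "linear ?f" using matrix_vector_mul_linear[of \<alpha>] by (rule linear_compose_scale_right)
  have inj: "inj ?f" using l rotation_matrix_isometry(4)[OF \<alpha>] by (auto simp: inj_def)
  have img: "?g ` S = (+) x ` ?f ` S" for S by (simp add: image_image)
  have face: "?g ` F face_of ?g ` unit_box \<longleftrightarrow> F face_of unit_box" for F
    unfolding img face_of_translation_eq using face_of_linear_image[OF lin inj] .
  have dim: "aff_dim (?g ` F) = aff_dim F" for F
    unfolding img using aff_dim_injective_linear_image[OF lin inj] by (simp add: aff_dim_translation_eq)
  show ?thesis
  proof (intro equalityI subsetI)
    fix y assume "y \<in> skeleton k (rotated_cube x l \<alpha>)"
    then obtain F where F: "y \<in> F" "F face_of ?g ` unit_box" "aff_dim F = int k"
      by (auto simp: skeleton_def rotated_cube_eq[OF l])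
    from face_of_imp_subset[OF F(2)] obtain H where H: "F = ?g ` H" by (metis subset_image_iff)
    then show "y \<in> (\<Union>F\<in>{F. F face_of unit_box \<and> aff_dim F = int k}. ?g ` F)"
      using F face dim by auto
  next
    fix y assume "y \<in> (\<Union>F\<in>{F. F face_of unit_box \<and> aff_dim F = int k}. ?g ` F)"
    then obtain F where F: "F face_of unit_box" "aff_dim F = int k" "y \<in> ?g ` F" by blast
    then have "?g ` F face_of rotated_cube x l \<alpha> \<and> aff_dim (?g ` F) = int k"
      using face[of F] dim[of F] by (simp only: rotated_cube_eq[OF l])
    then show "y \<in> skeleton k (rotated_cube x l \<alpha>)"
      using F(3) unfolding skeleton_def by (intro UnionI[of "?g ` F"]) (simp only: mem_Collect_eq)
  qed
qed

text \<open>For a cube with centre x the point p below is the centre of the image of the corner face. As this image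
  is orthogonal to x - p, its affine hull has the fixed distance norm c from x.\<close>

theorem hausdorff_dim_ge_of_cube_skeletons:
  fixes B :: "(real^'n) set"
  assumes k: "k < CARD('n)" and B: "\<And>x. contains_cube_skeleton k 1 x B"
  shows "ennreal (real k + 1) \<le> hausdorff_dim B"
proof -
  have "k \<le> card (Basis :: (real^'n) set)" using k by simp
  then obtain K :: "(real^'n) set" where K: "K \<subseteq> Basis" "card K = k"
    using obtain_subset_with_card_n by metis
  define c where "c = (\<Sum>b\<in>Basis - K. (1/2::real) *\<^sub>R b)"
  have cb: "c \<bullet> b = (if b \<in> K then 0 else 1/2)" if "b \<in> Basis" for b
    using that by (auto simp: c_def inner_sum_left inner_Basis if_distrib sum.delta cong: if_cong)
  have "c \<noteq> 0"
  proof
    assume "c = 0"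
    have "Basis \<subseteq> K"
    proof
      fix b :: "real^'n" assume "b \<in> Basis"
      then show "b \<in> K" using cb[of b] \<open>c = 0\<close> by (auto split: if_splits)
    qed
    then have "card (Basis :: (real^'n) set) \<le> card K" using K by (intro card_mono) (auto intro: finite_subset)
    then show False using k K by simp
  qed
  then have "norm c > 0" by simp
  have "ennreal (real (card K) + 1) \<le> hausdorff_dim B"
  proof (rule hausdorff_dim_ge_of_frames[OF K(1) \<open>norm c > 0\<close>])
    fix x
    from B[of x] obtain \<alpha> where \<alpha>: "rotation_matrix \<alpha>" "skeleton k (rotated_cube x 1 \<alpha>) \<subseteq> B"
      by (auto simp: contains_cube_skeleton_def)
    define p where "p = x + \<alpha> *v c"
    have "orthonormal_on K ((*v) \<alpha>)"
      unfolding orthonormal_on_def using K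
      by (auto simp: rotation_matrix_isometry(2)[OF \<alpha>(1)] subset_iff inner_Basis)
    moreover have "norm (x - p) = norm c" by (simp add: p_def rotation_matrix_isometry(3)[OF \<alpha>(1)])
    moreover have "(x - p) \<bullet> (\<alpha> *v b) = 0" if "b \<in> K" for b
      using that cb[of b] K by (auto simp: p_def rotation_matrix_isometry(2)[OF \<alpha>(1)])
    moreover have "frame_map K p ((*v) \<alpha>) t \<in> B" if t: "t \<in> unit_box" for t
    proof -
      define w where "w = c + (\<Sum>b\<in>K. (t \<bullet> b) *\<^sub>R b)"
      have wb: "w \<bullet> b = (if b \<in> K then t \<bullet> b else 1/2)" if "b \<in> Basis" for b
      proof -
        have "(\<Sum>i\<in>K. (t \<bullet> i) * (i \<bullet> b)) = (\<Sum>i\<in>K. if i = b then t \<bullet> b else 0)"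
          using K that by (intro sum.cong) (auto simp: inner_Basis subset_iff)
        also have "\<dots> = (if b \<in> K then t \<bullet> b else 0)"
          using K finite_subset[OF K(1)] by (simp add: sum.delta)
        finally show ?thesis using cb[OF that] by (simp add: w_def inner_add_left inner_sum_left)
      qed
      have "w \<in> corner_face K" using t wb by (auto simp: corner_face_def mem_unit_box)
      then have "x + 1 *\<^sub>R (\<alpha> *v w) \<in> skeleton k (rotated_cube x 1 \<alpha>)"
        unfolding skeleton_rotated_cube[OF zero_less_one \<alpha>(1)]
        using corner_face_face_of[of K] aff_dim_corner_face[OF K(1)] K(2) by blast
      moreover have "x + 1 *\<^sub>R (\<alpha> *v w) = frame_map K p ((*v) \<alpha>) t"
        by (simp add: w_def frame_map_def p_def matrix_vector_right_distrib linear_sum[OF matrix_vector_mul_linear]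
            matrix_vector_mult_scaleR add.assoc)
      ultimately show ?thesis using \<alpha>(2) by auto
    qed
    ultimately show "\<exists>p u. orthonormal_on K u \<and> norm (x - p) = norm c \<and> (\<forall>b\<in>K. (x - p) \<bullet> u b = 0) \<and>
        frame_map K p u ` unit_box \<subseteq> B" by blast
  qed
  then show ?thesis by (simp add: K)
qed

section \<open>Covering numbers and a union of (k+1)-planes\<close>

text \<open>In Euclidean space this says that the upper Minkowski content of dimension d is finite.\<close>

definition covering_bound :: "nat \<Rightarrow> 'a::metric_space set \<Rightarrow> bool" where
  "covering_bound d A \<longleftrightarrow> (\<exists>C. \<forall>\<epsilon>. 0 < \<epsilon> \<and> \<epsilon> \<le> 1 \<longrightarrow>
     (\<exists>G. finite G \<and> real (card G) * \<epsilon> ^ d \<le> C \<and> A \<subseteq> (\<Union>c\<in>G. cball c \<epsilon>)))"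

lemma covering_bound_empty: "covering_bound d {}"
  unfolding covering_bound_def by (intro exI[of _ 0]) (auto intro!: exI[of _ "{}"])

lemma covering_bound_Un:
  assumes "covering_bound d A" "covering_bound d B"
  shows "covering_bound d (A \<union> B)"
proof -
  obtain C where C: "\<And>\<epsilon>. 0 < \<epsilon> \<Longrightarrow> \<epsilon> \<le> 1 \<Longrightarrow> \<exists>G. finite G \<and> real (card G) * \<epsilon> ^ d \<le> C \<and> A \<subseteq> (\<Union>c\<in>G. cball c \<epsilon>)"
    using assms(1) by (auto simp: covering_bound_def)
  obtain D where D: "\<And>\<epsilon>. 0 < \<epsilon> \<Longrightarrow> \<epsilon> \<le> 1 \<Longrightarrow> \<exists>G. finite G \<and> real (card G) * \<epsilon> ^ d \<le> D \<and> B \<subseteq> (\<Union>c\<in>G. cball c \<epsilon>)"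
    using assms(2) by (auto simp: covering_bound_def)
  have "\<exists>G. finite G \<and> real (card G) * \<epsilon> ^ d \<le> C + D \<and> A \<union> B \<subseteq> (\<Union>c\<in>G. cball c \<epsilon>)"
    if \<epsilon>: "0 < \<epsilon>" "\<epsilon> \<le> 1" for \<epsilon>
  proof -
    obtain G H where G: "finite G" "real (card G) * \<epsilon> ^ d \<le> C" "A \<subseteq> (\<Union>c\<in>G. cball c \<epsilon>)"
      and H: "finite H" "real (card H) * \<epsilon> ^ d \<le> D" "B \<subseteq> (\<Union>c\<in>H. cball c \<epsilon>)"
      using C D \<epsilon> by metis
    have "real (card (G \<union> H)) * \<epsilon> ^ d \<le> (real (card G) + real (card H)) * \<epsilon> ^ d"
      using \<epsilon> card_Un_le[of G H] by (intro mult_right_mono) auto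
    also have "\<dots> \<le> C + D" using G H by (simp add: distrib_right)
    finally show ?thesis using G H by (intro exI[of _ "G \<union> H"]) auto
  qed
  then show ?thesis unfolding covering_bound_def by blast
qed

lemma covering_bound_UN:
  assumes "finite I" "\<And>i. i \<in> I \<Longrightarrow> covering_bound d (A i)"
  shows "covering_bound d (\<Union>i\<in>I. A i)"
  using assms by (induction I rule: finite_induct) (auto simp: covering_bound_empty covering_bound_Un)

text \<open>A grid of mesh size proportional to \<epsilon> in coordinates with respect to an orthonormal basis of V.\<close>

lemma covering_bound_affine:
  fixes V :: "'a::euclidean_space set"
  assumes V: "subspace V" "dim V \<le> d"
  shows "covering_bound d ((+) x0 ` V \<inter> cball 0 R)"
proof -
  obtain Bs where Bs: "Bs \<subseteq> V" "pairwise orthogonal Bs" "\<And>v. v \<in> Bs \<Longrightarrow> norm v = 1"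
    "independent Bs" "card Bs = dim V" "span Bs = V"
    using orthonormal_basis_subspace[OF V(1)] by blast
  have fB: "finite Bs" using Bs(4) independent_imp_finite by blast
  define m where "m = card Bs"
  define R' where "R' = \<bar>R\<bar> + norm x0"
  have R': "R' \<ge> 0" by (simp add: R'_def)
  define C where "C = (2 * R' * (real m + 1) + 3) ^ m"
  have "\<exists>G. finite G \<and> real (card G) * \<epsilon> ^ d \<le> C \<and> (+) x0 ` V \<inter> cball 0 R \<subseteq> (\<Union>c\<in>G. cball c \<epsilon>)"
    if \<epsilon>: "0 < \<epsilon>" "\<epsilon> \<le> 1" for \<epsilon>
  proof -
    define e where "e = \<epsilon> / (real m + 1)"
    have e: "e > 0" using \<epsilon> by (simp add: e_def)
    define N where "N = \<lceil>R' / e\<rceil>"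
    have N0: "N \<ge> 0" using divide_nonneg_pos[OF R' e] unfolding N_def by linarith
    define E where "E = PiE Bs (\<lambda>_. {-N..N})"
    define g where "g h = x0 + (\<Sum>b\<in>Bs. (real_of_int (h b) * e) *\<^sub>R b)" for h :: "'a \<Rightarrow> int"
    have fE: "finite E" unfolding E_def using fB by (intro finite_PiE) auto
    have "real (card (g ` E)) * \<epsilon> ^ d \<le> real (card E) * \<epsilon> ^ m"
      using fE card_image_le[OF fE, of g] \<epsilon> V(2) Bs(5) by (intro mult_mono power_decreasing) (auto simp: m_def)
    also have "real (card E) = real (nat (2 * N + 1)) ^ m"
      unfolding E_def using fB N0 by (simp add: card_PiE m_def)
    also have "real (nat (2 * N + 1)) = 2 * real_of_int N + 1" using N0 by simp
    also have "(2 * real_of_int N + 1) ^ m * \<epsilon> ^ m = ((2 * real_of_int N + 1) * \<epsilon>) ^ m" by (simp add: power_mult_distrib)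
    also have "\<dots> \<le> C"
      unfolding C_def
    proof (rule power_mono)
      have "real_of_int N \<le> R' / e + 1" unfolding N_def by linarith
      then have "(2 * real_of_int N + 1) * \<epsilon> \<le> (2 * (R' / e + 1) + 1) * \<epsilon>" using \<epsilon> by (intro mult_right_mono) auto
      also have "\<dots> = 2 * R' * (real m + 1) + 3 * \<epsilon>" using \<epsilon> by (simp add: e_def field_simps)
      finally show "(2 * real_of_int N + 1) * \<epsilon> \<le> 2 * R' * (real m + 1) + 3" using \<epsilon> by simp
    qed (use N0 \<epsilon> in auto)
    finally have card: "real (card (g ` E)) * \<epsilon> ^ d \<le> C" .
    have "(+) x0 ` V \<inter> cball 0 R \<subseteq> (\<Union>c\<in>g ` E. cball c \<epsilon>)"
    proof
      fix y assume "y \<in> (+) x0 ` V \<inter> cball 0 R"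
      then obtain v where v: "v \<in> V" "y = x0 + v" "norm (x0 + v) \<le> R" by auto
      have "norm v \<le> R'" using v(3) norm_triangle_ineq4[of "x0 + v" x0] by (simp add: R'_def)
      have vrep: "v = (\<Sum>b\<in>Bs. (v \<bullet> b) *\<^sub>R b)"
        using orthonormal_basis_expand[OF Bs(2,3) _ fB, of v] v(1) Bs(6) by simp
      define h where "h b = (if b \<in> Bs then \<lfloor>(v \<bullet> b) / e\<rfloor> else undefined)" for b
      have "h \<in> E"
        unfolding E_def
      proof (intro PiE_I)
        fix b assume b: "b \<in> Bs"
        have "\<bar>v \<bullet> b\<bar> \<le> norm v * norm b" by (rule Cauchy_Schwarz_ineq2)
        also have "\<dots> \<le> R'" using Bs(3)[OF b] \<open>norm v \<le> R'\<close> by simp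
        finally have "\<bar>(v \<bullet> b) / e\<bar> \<le> R' / e" using e by (simp add: divide_right_mono)
        then show "h b \<in> {-N..N}" using b unfolding h_def N_def by (auto; linarith)
      qed (simp add: h_def)
      have "dist (g h) y = norm (\<Sum>b\<in>Bs. (v \<bullet> b - real_of_int (h b) * e) *\<^sub>R b)"
        unfolding dist_commute[of "g h"] dist_norm v(2) g_def
        by (subst vrep) (simp add: scaleR_diff_left sum_subtractf norm_minus_commute)
      also have "\<dots> \<le> (\<Sum>b\<in>Bs. e)"
      proof (rule order_trans[OF norm_sum sum_mono])
        fix b assume b: "b \<in> Bs"
        have "real_of_int (h b) \<le> (v \<bullet> b) / e" "(v \<bullet> b) / e \<le> real_of_int (h b) + 1"
          using b by (simp_all add: h_def)
        then have "\<bar>v \<bullet> b - real_of_int (h b) * e\<bar> \<le> e" using e by (simp add: field_simps abs_le_iff)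
        then show "norm ((v \<bullet> b - real_of_int (h b) * e) *\<^sub>R b) \<le> e" using Bs(3)[OF b] by simp
      qed
      also have "\<dots> = real m * e" by (simp add: m_def)
      also have "\<dots> \<le> \<epsilon>" using \<epsilon> by (simp add: e_def field_simps)
      finally show "y \<in> (\<Union>c\<in>g ` E. cball c \<epsilon>)" using \<open>h \<in> E\<close> by auto
    qed
    then show ?thesis using card fE by (intro exI[of _ "g ` E"]) auto
  qed
  then show ?thesis unfolding covering_bound_def by blast
qed

lemma covering_bound_small_cover:
  assumes "covering_bound d A" "real d < s" "e > 0"
  obtains G \<epsilon> where "finite G" "0 < \<epsilon>" "\<epsilon> \<le> e" "\<epsilon> \<le> 1" "real (card G) * \<epsilon> powr s \<le> e" "A \<subseteq> (\<Union>c\<in>G. cball c \<epsilon>)"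
proof -
  obtain C where C: "\<And>\<epsilon>. 0 < \<epsilon> \<Longrightarrow> \<epsilon> \<le> 1 \<Longrightarrow> \<exists>G. finite G \<and> real (card G) * \<epsilon> ^ d \<le> C \<and> A \<subseteq> (\<Union>c\<in>G. cball c \<epsilon>)"
    using assms(1) by (auto simp: covering_bound_def)
  have C0: "C \<ge> 0"
    using C[of 1] by auto
  have "((\<lambda>\<epsilon>. \<epsilon> powr (s - d)) \<longlongrightarrow> 0 powr (s - d)) (at_right 0)"
    using assms(2) by (intro tendsto_powr' tendsto_intros) (auto simp: eventually_at_right_less eventually_at_right_field intro: exI[of _ 1])
  then have "((\<lambda>\<epsilon>. \<epsilon> powr (s - d)) \<longlongrightarrow> 0) (at_right 0)" by simp
  then have "eventually (\<lambda>\<epsilon>. \<epsilon> powr (s - d) < e / (C + 1)) (at_right 0)"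
    by (rule order_tendstoD) (use assms(3) C0 in auto)
  moreover have "eventually (\<lambda>\<epsilon>. \<epsilon> \<in> {0<..<min e 1}) (at_right (0::real))"
    using assms(3) by (intro eventually_at_right_real) auto
  ultimately have "eventually (\<lambda>\<epsilon>. \<epsilon> powr (s - d) < e / (C + 1) \<and> \<epsilon> \<in> {0<..<min e 1}) (at_right 0)"
    by (rule eventually_conj)
  then obtain \<epsilon> where \<epsilon>: "\<epsilon> powr (s - d) < e / (C + 1)" "0 < \<epsilon>" "\<epsilon> < e" "\<epsilon> < 1"
    using eventually_happens'[OF trivial_limit_at_right_real] by fastforce
  obtain G where G: "finite G" "real (card G) * \<epsilon> ^ d \<le> C" "A \<subseteq> (\<Union>c\<in>G. cball c \<epsilon>)" using C[of \<epsilon>] \<epsilon> by auto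
  have "\<epsilon> powr s = \<epsilon> ^ d * \<epsilon> powr (s - d)"
    using \<epsilon> by (simp add: powr_realpow[symmetric] powr_add[symmetric])
  then have "real (card G) * \<epsilon> powr s = (real (card G) * \<epsilon> ^ d) * \<epsilon> powr (s - d)" by simp
  also have "\<dots> \<le> C * (e / (C + 1))" using G \<epsilon> C0 by (intro mult_mono) auto
  also have "\<dots> \<le> e" using C0 assms(3) by (simp add: field_simps)
  finally show thesis using that G \<epsilon> by (meson less_imp_le)
qed

lemma hausdorff_measure_0_affine:
  fixes V :: "'a::euclidean_space set"
  assumes V: "subspace V" "dim V \<le> d" and s: "s > real d"
  shows "hausdorff_measure s ((+) x0 ` V) = 0"
proof (rule hausdorff_measure_0_mono)
  show "(+) x0 ` V \<subseteq> (\<Union>R::nat. (+) x0 ` V \<inter> cball 0 (real R))"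
    using real_arch_simple by fastforce
  show "hausdorff_measure s (\<Union>R::nat. (+) x0 ` V \<inter> cball 0 (real R)) = 0"
  proof (intro hausdorff_measure_0_UN hausdorff_measure_0_ball_covers)
    fix R :: nat and e :: real assume "e > 0"
    then show "\<exists>G r. finite G \<and> 0 < r \<and> r \<le> e \<and> real (card G) * r powr s \<le> e \<and>
          (+) x0 ` V \<inter> cball 0 (real R) \<subseteq> (\<Union>c\<in>G. cball c r)"
      using covering_bound_small_cover[OF covering_bound_affine[OF V, of x0 "real R"] s] by metis
  qed (use s in auto)
qed

text \<open>Let h < d be the distance of x from a translate of V that comes close enough. A k-plane in this
  translate at distance sqrt (d^2 - h^2) from the foot point of x has distance d from x.\<close>

theorem exists_borel_affine_subspaces:
  assumes k: "k < DIM('a::euclidean_space)"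
  obtains B :: "'a::euclidean_space set" where "B \<in> sets borel" "\<And>x d. d > 0 \<Longrightarrow> contains_affine_subspace_at_dist k d x B"
    "hausdorff_dim B \<le> ennreal (real k + 1)"
proof -
  have "Suc k \<le> card (Basis :: 'a set)" using k by simp
  then obtain K1 :: "'a set" where K1: "K1 \<subseteq> Basis" "card K1 = Suc k"
    by (rule obtain_subset_with_card_n) blast
  then obtain u where u: "u \<in> K1" by (metis card.empty ex_in_conv nat.distinct(1))
  have fK1: "finite K1" using K1 finite_Basis finite_subset by blast
  define V where "V = span K1"
  define W where "W = span (K1 - {u})"
  have dims: "dim V = Suc k" "dim W = k" "subspace V" "subspace W" "W \<subseteq> V"
  proof -
    have "independent K1" using K1 independent_Basis independent_mono by blast
    then show "dim V = Suc k" unfolding V_def dim_span using K1 by (simp add: dim_eq_card_independent)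
    have "independent (K1 - {u})" using \<open>independent K1\<close> independent_mono by blast
    then show "dim W = k" unfolding W_def dim_span using K1 u fK1 by (simp add: dim_eq_card_independent)
    show "W \<subseteq> V" unfolding V_def W_def by (rule span_mono) auto
  qed (auto simp: V_def W_def)
  have uV: "u \<in> V" using u by (simp add: V_def span_base)
  have uu: "u \<bullet> u = 1" using u K1 by (auto simp: inner_Basis)
  have uW: "w \<bullet> u = 0" if "w \<in> W" for w
  proof -
    have "orthogonal u w"
      using that unfolding W_def
    proof (rule orthogonal_to_span)
      show "orthogonal u y" if "y \<in> K1 - {u}" for y using that u K1 by (auto simp: orthogonal_def inner_Basis subset_iff)
    qed
    then show ?thesis by (simp add: orthogonal_def inner_commute)
  qed
  obtain D :: "'a set" where D: "countable D" "\<And>X. open X \<Longrightarrow> X \<noteq> {} \<Longrightarrow> \<exists>d\<in>D. d \<in> X"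
    using countable_dense_exists by blast
  define B where "B = (\<Union>q\<in>D. (+) q ` V)"
  show thesis
  proof (rule that[of B])
    have "(+) q ` V \<in> sets borel" for q
      by (intro borel_closed closed_translation closed_subspace dims)
    then show "B \<in> sets borel" unfolding B_def by (intro sets.countable_UN'[OF D(1)]) auto
    show "hausdorff_dim B \<le> ennreal (real k + 1)"
    proof (rule hausdorff_dim_leI)
      fix s :: real assume s: "real k + 1 < s"
      show "hausdorff_measure s B = 0" unfolding B_def
        using D(1) dims s by (intro hausdorff_measure_0_Union) (auto intro!: hausdorff_measure_0_affine[of V "Suc k"])
    qed simp
    fix x :: 'a and d :: real assume d: "d > 0"
    obtain q where q: "q \<in> D" "q \<in> ball x d" using D(2)[of "ball x d"] d by auto
    obtain y z where yz: "y \<in> V" "\<And>w. w \<in> V \<Longrightarrow> orthogonal z w" "x - q = y + z"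
      using orthogonal_subspace_decomp_exists[of V "x - q"] dims(3) by (metis span_eq_iff)
    have zV: "z \<bullet> w = 0" if "w \<in> V" for w using yz(2)[OF that] by (simp add: orthogonal_def)
    have "(norm (x - q))\<^sup>2 = (norm y)\<^sup>2 + (norm z)\<^sup>2"
      unfolding yz(3) power2_norm_eq_inner using zV[OF yz(1)] by (simp add: inner_add_left inner_add_right inner_commute)
    moreover have "norm (x - q) < d" using q by (simp add: dist_norm)
    ultimately have zd: "(norm z)\<^sup>2 \<le> d\<^sup>2"
      by (smt (verit) d norm_ge_zero power_mono zero_le_power2)
    define \<tau> where "\<tau> = sqrt (d\<^sup>2 - (norm z)\<^sup>2)"
    have \<tau>: "\<tau>\<^sup>2 = d\<^sup>2 - (norm z)\<^sup>2" using zd by (simp add: \<tau>_def)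
    define P where "P = (+) (q + y + \<tau> *\<^sub>R u) ` W"
    have dist: "(dist x (q + y + \<tau> *\<^sub>R u + w))\<^sup>2 = d\<^sup>2 + (norm w)\<^sup>2" if w: "w \<in> W" for w
    proof -
      have wV: "w \<in> V" using w dims by blast
      have eq: "x - (q + y + \<tau> *\<^sub>R u + w) = z - \<tau> *\<^sub>R u - w" using yz(3) by (simp add: algebra_simps)
      have "(dist x (q + y + \<tau> *\<^sub>R u + w))\<^sup>2 = (z - \<tau> *\<^sub>R u - w) \<bullet> (z - \<tau> *\<^sub>R u - w)"
        unfolding dist_norm eq power2_norm_eq_inner ..
      also have "\<dots> = z \<bullet> z + \<tau> * \<tau> + w \<bullet> w"
        using zV[OF wV] zV[OF uV] uW[OF w] uu
        by (simp add: inner_diff_left inner_diff_right inner_commute)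
      also have "\<dots> = d\<^sup>2 + (norm w)\<^sup>2" using \<tau>[unfolded power2_norm_eq_inner] unfolding power2_norm_eq_inner
          by (simp add: power2_eq_square)
      finally show ?thesis .
    qed
    have "infdist x P = d"
    proof (rule antisym)
      have "0 \<in> W" using dims subspace_0 by blast
      have "(dist x (q + y + \<tau> *\<^sub>R u + 0))\<^sup>2 = d\<^sup>2" using dist[OF \<open>0 \<in> W\<close>] by simp
      then have "dist x (q + y + \<tau> *\<^sub>R u + 0) = d" using d by (simp add: power2_eq_iff_nonneg)
      moreover have "q + y + \<tau> *\<^sub>R u + 0 \<in> P" unfolding P_def using \<open>0 \<in> W\<close> by (rule imageI)
      ultimately show "infdist x P \<le> d" using infdist_le by metis
      have "d \<le> dist x p" if p: "p \<in> P" for p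
      proof -
        obtain w where "w \<in> W" "p = q + y + \<tau> *\<^sub>R u + w" using p by (auto simp: P_def)
        then have "d\<^sup>2 \<le> (dist x p)\<^sup>2" using dist by simp
        then show ?thesis by (rule power2_le_imp_le) simp
      qed
      moreover have "P \<noteq> {}" unfolding P_def using \<open>0 \<in> W\<close> by blast
      ultimately show "d \<le> infdist x P" by (simp add: infdist_notempty cINF_greatest)
    qed
    moreover have "affine P" unfolding P_def using dims by (simp add: subspace_imp_affine affine_translation[symmetric])
    moreover have "aff_dim P = int k" unfolding P_def aff_dim_translation_eq using dims by (simp add: aff_dim_subspace)
    moreover have "P \<subseteq> B"
    proof
      fix p assume "p \<in> P"
      then obtain w where w: "w \<in> W" "p = q + y + \<tau> *\<^sub>R u + w" by (auto simp: P_def)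
      then have "y + \<tau> *\<^sub>R u + w \<in> V" using yz uV dims by (auto intro!: subspace_add subspace_scale)
      then have "q + (y + \<tau> *\<^sub>R u + w) \<in> B" using q unfolding B_def by blast
      then show "p \<in> B" using w by (simp add: add.assoc)
    qed
    ultimately show "contains_affine_subspace_at_dist k d x B"
      unfolding contains_affine_subspace_at_dist_def by blast
  qed
qed

section \<open>Rotating a face of a cube into a (k+1)-plane\<close>

definition reflect :: "'a::euclidean_space \<Rightarrow> 'a \<Rightarrow> 'a" where
  "reflect u v = v - (2 * (u \<bullet> v)) *\<^sub>R u"

lemma orthogonal_transformation_reflect:
  assumes "norm u = 1"
  shows "orthogonal_transformation (reflect u)"
proof -
  have uu: "u \<bullet> u = 1" using assms by (simp add: norm_eq_sqrt_inner)
  have "linear (reflect u)"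
    unfolding reflect_def by (rule linearI) (simp_all add: inner_add_right scaleR_add_left scaleR_diff_right distrib_left mult.left_commute)
  moreover have "reflect u v \<bullet> reflect u w = v \<bullet> w" for v w
    unfolding reflect_def by (simp add: inner_diff_left inner_diff_right uu inner_commute[of v u] inner_commute[of w u])
  ultimately show ?thesis by (simp add: orthogonal_transformation_def)
qed

text \<open>Any two reflections are conjugate by an orthogonal map. Hence the product of two of them has a square as
  its determinant, which makes it a rotation.\<close>

lemma det_matrix_reflect_eq:
  fixes a c :: "real^'n"
  assumes "norm a = 1" "norm c = 1"
  shows "det (matrix (reflect c)) = det (matrix (reflect a))"
proof -
  obtain f where f: "orthogonal_transformation f" "f a = c"
    using orthogonal_transformation_exists[of a c] assms by auto
  have lf: "linear f" using f(1) by (simp add: orthogonal_transformation_def)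
  have la: "linear (reflect a)" "linear (reflect c)"
    using orthogonal_transformation_reflect assms by (auto simp: orthogonal_transformation_def)
  have "reflect c \<circ> f = f \<circ> reflect a"
  proof
    fix v
    have "c \<bullet> f v = a \<bullet> v" using f by (metis orthogonal_transformation_def)
    then show "(reflect c \<circ> f) v = (f \<circ> reflect a) v"
      using f(2) lf by (simp add: reflect_def linear_diff linear_cmul)
  qed
  then have "matrix (reflect c) ** matrix f = matrix f ** matrix (reflect a)"
    using matrix_compose[OF lf la(2)] matrix_compose[OF la(1) lf] by simp
  then have "det (matrix (reflect c)) * det (matrix f) = det (matrix f) * det (matrix (reflect a))"
    by (metis det_mul)
  moreover have "det (matrix f) \<noteq> 0"
    using f(1) det_orthogonal_matrix[of "matrix f"] by (auto simp: orthogonal_transformation_matrix)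
  ultimately show ?thesis by simp
qed

text \<open>The reflection in the hyperplane orthogonal to a followed by the one in the hyperplane orthogonal to
  a + b sends a to -a and then to b, and it fixes everything orthogonal to both vectors.\<close>

lemma rotation_between_unit_vectors:
  fixes a b :: "real^'n"
  assumes a: "norm a = 1" and b: "norm b = 1" and ab: "a \<bullet> b \<ge> 0"
  obtains R where "rotation_matrix R" "R *v a = b" "\<And>w. w \<bullet> a = 0 \<Longrightarrow> w \<bullet> b = 0 \<Longrightarrow> R *v w = w"
    "\<And>v. norm (R *v v - v) \<le> 3 * norm (b - a) * norm v"
proof -
  have aa: "a \<bullet> a = 1" "b \<bullet> b = 1" using a b by (simp_all add: norm_eq_sqrt_inner)
  have nab: "(norm (a + b))\<^sup>2 = 2 * (1 + a \<bullet> b)"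
    unfolding power2_norm_eq_inner by (simp add: inner_add_left inner_add_right aa inner_commute)
  have nab1: "norm (a + b) \<ge> 1" by (rule power2_le_imp_le) (use nab ab in auto)
  define c where "c = (1 / norm (a + b)) *\<^sub>R (a + b)"
  have c: "norm c = 1" using nab1 by (auto simp: c_def)
  have oa: "orthogonal_transformation (reflect a)" and oc: "orthogonal_transformation (reflect c)"
    using orthogonal_transformation_reflect a c by auto
  define R where "R = matrix (reflect c) ** matrix (reflect a)"
  have Rv: "R *v v = reflect c (reflect a v)" for v
    using oa oc by (simp add: R_def matrix_vector_mul_assoc[symmetric] matrix_works orthogonal_transformation_def)
  have om: "orthogonal_matrix (matrix (reflect a))" "orthogonal_matrix (matrix (reflect c))"
    using oa oc by (simp_all add: orthogonal_transformation_matrix)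
  have "det R = (det (matrix (reflect a)))\<^sup>2"
    unfolding R_def det_mul det_matrix_reflect_eq[OF a c] by (simp add: power2_eq_square)
  also have "\<dots> = 1" using det_orthogonal_matrix[OF om(1)] by auto
  finally have rot: "rotation_matrix R"
    using om by (simp add: rotation_matrix_def R_def orthogonal_matrix_mul)
  have Ra: "R *v a = b"
  proof -
    have "reflect a a = - a" by (simp add: reflect_def aa scaleR_2)
    moreover have "reflect c (- a) = - a + (2 * ((a + b) \<bullet> a) / (norm (a + b))\<^sup>2) *\<^sub>R (a + b)"
      by (simp add: reflect_def c_def power2_eq_square)
    moreover have "2 * ((a + b) \<bullet> a) = (norm (a + b))\<^sup>2"
      unfolding nab by (simp add: inner_add_left aa inner_commute[of b a])
    moreover have "a + b \<noteq> 0" using nab1 by auto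
    ultimately show ?thesis by (simp add: Rv)
  qed
  have cw: "R *v w = w - (2 * (b \<bullet> w) / norm (a + b)) *\<^sub>R c" if "w \<bullet> a = 0" for w
    using that by (simp add: Rv reflect_def c_def inner_add_left inner_add_right inner_commute)
  show thesis
  proof (rule that[OF rot Ra])
    show "R *v w = w" if "w \<bullet> a = 0" "w \<bullet> b = 0" for w
      using cw[OF that(1)] that(2) by (simp add: inner_commute)
    fix v
    define s where "s = v \<bullet> a"
    define w where "w = v - s *\<^sub>R a"
    have wa: "w \<bullet> a = 0" by (simp add: w_def s_def inner_diff_left aa)
    have v: "v = s *\<^sub>R a + w" by (simp add: w_def)
    have s: "\<bar>s\<bar> \<le> norm v" using Cauchy_Schwarz_ineq2[of v a] a by (simp add: s_def)
    have "(norm v)\<^sup>2 = s\<^sup>2 + (norm w)\<^sup>2"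
      unfolding v power2_norm_eq_inner using wa by (simp add: inner_add_left inner_add_right inner_commute aa power2_eq_square)
    then have w: "norm w \<le> norm v" by (intro power2_le_imp_le[OF _ norm_ge_zero]) (simp add: zero_le_power2)
    have "R *v v - v = s *\<^sub>R (b - a) - (2 * (b \<bullet> w) / norm (a + b)) *\<^sub>R c"
      using cw[OF wa] Ra by (subst (1 2) v) (simp add: matrix_vector_right_distrib matrix_vector_mult_scaleR algebra_simps)
    also have "norm \<dots> \<le> \<bar>s\<bar> * norm (b - a) + 2 * \<bar>b \<bullet> w\<bar> / norm (a + b)"
      by (rule order_trans[OF norm_triangle_ineq4]) (use c in simp)
    also have "2 * \<bar>b \<bullet> w\<bar> / norm (a + b) \<le> 2 * \<bar>b \<bullet> w\<bar> / 1"
      using nab1 by (intro divide_left_mono) auto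
    also have "\<bar>b \<bullet> w\<bar> = \<bar>(b - a) \<bullet> w\<bar>" using wa by (simp add: inner_diff_left inner_diff_right inner_commute)
    also have "\<bar>s\<bar> * norm (b - a) + 2 * \<bar>(b - a) \<bullet> w\<bar> / 1 \<le> norm v * norm (b - a) + 2 * (norm (b - a) * norm v)"
    proof -
      have "\<bar>(b - a) \<bullet> w\<bar> \<le> norm (b - a) * norm w" by (rule Cauchy_Schwarz_ineq2)
      also have "\<dots> \<le> norm (b - a) * norm v" using w by (intro mult_left_mono) auto
      finally show ?thesis using mult_right_mono[OF s norm_ge_zero[of "b - a"]] by linarith
    qed
    also have "\<dots> = 3 * norm (b - a) * norm v" by simp
    finally show "norm (R *v v - v) \<le> 3 * norm (b - a) * norm v" by simp
  qed
qed

lemma norm_matrix_vector_mult_le: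
  fixes A :: "real^'n^'n"
  shows "norm (A *v v) \<le> real CARD('n) * norm A * norm v"
proof -
  have "norm (A *v v) \<le> (\<Sum>i\<in>UNIV. \<bar>(A *v v) $ i\<bar>)" by (rule norm_le_l1_cart)
  also have "\<dots> \<le> (\<Sum>i\<in>(UNIV::'n set). norm A * norm v)"
  proof (rule sum_mono)
    fix i
    have "(A *v v) $ i = A $ i \<bullet> v" by (simp add: matrix_vector_mult_def inner_vec_def)
    also have "\<bar>\<dots>\<bar> \<le> norm (A $ i) * norm v" by (rule Cauchy_Schwarz_ineq2)
    also have "\<dots> \<le> norm A * norm v" by (intro mult_right_mono Finite_Cartesian_Product.norm_nth_le) auto
    finally show "\<bar>(A *v v) $ i\<bar> \<le> norm A * norm v" .
  qed
  finally show ?thesis by (simp add: mult.assoc)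
qed

lemma norm_matrix_le:
  fixes A :: "real^'n^'n"
  assumes "\<And>v. norm (A *v v) \<le> c * norm v"
  shows "norm A \<le> (real CARD('n))\<^sup>2 * c"
proof -
  have entry: "\<bar>A $ i $ j\<bar> \<le> c" for i j
  proof -
    have "(A *v axis j 1) $ i = A $ i $ j" by (simp add: matrix_vector_mult_basis column_def)
    then have "\<bar>A $ i $ j\<bar> \<le> norm (A *v axis j 1)" using component_le_norm_cart[of "A *v axis j 1" i] by simp
    also have "\<dots> \<le> c" using assms[of "axis j 1"] by simp
    finally show ?thesis .
  qed
  have "norm (A $ i) \<le> (\<Sum>j\<in>(UNIV::'n set). c)" for i
    by (rule order_trans[OF norm_le_l1_cart sum_mono[OF entry]])
  then have "norm (A $ i) \<le> CARD('n) * c" for i by simp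
  then have "(\<Sum>i\<in>UNIV. norm (A $ i)) \<le> (\<Sum>i\<in>(UNIV::'n set). CARD('n) * c)" by (intro sum_mono)
  then have "(\<Sum>i\<in>UNIV. norm (A $ i)) \<le> (real CARD('n))\<^sup>2 * c" by (simp add: power2_eq_square mult.assoc)
  moreover have "norm A \<le> (\<Sum>i\<in>UNIV. norm (A $ i))" unfolding norm_vec_def by (rule L2_set_le_sum) auto
  ultimately show ?thesis by linarith
qed

lemma rotation_matrix_limit:
  fixes \<alpha> :: "nat \<Rightarrow> real^'n^'n"
  assumes "\<And>m. rotation_matrix (\<alpha> m)" "\<alpha> \<longlonglongrightarrow> \<beta>"
  shows "rotation_matrix \<beta>"
proof -
  have "(\<lambda>m. transpose (\<alpha> m) ** \<alpha> m) \<longlonglongrightarrow> transpose \<beta> ** \<beta>"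
    unfolding matrix_matrix_mult_def transpose_def by (intro tendsto_intros assms(2))
  moreover have "(\<lambda>m. transpose (\<alpha> m) ** \<alpha> m) = (\<lambda>m. mat 1)"
    using assms(1) by (simp add: rotation_matrix_def orthogonal_matrix_def)
  ultimately have "transpose \<beta> ** \<beta> = mat 1" using LIMSEQ_unique tendsto_const by metis
  moreover have "(\<lambda>m. det (\<alpha> m)) \<longlonglongrightarrow> det \<beta>"
    unfolding det_def by (intro tendsto_intros assms(2))
  then have "det \<beta> = 1" using assms(1) by (simp add: rotation_matrix_def LIMSEQ_const_iff)
  ultimately show ?thesis by (simp add: rotation_matrix_def orthogonal_matrix)
qed

text \<open>Let V be the image of span (insert c W) under \<alpha>, let h be the component of x - x0 orthogonal to V, and let a
  be the direction of \<alpha> c. The face with centre x + l \<alpha> c lies in x0 + V + h, so the task is to tilt a by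
  -h / (l norm c) without leaving the unit sphere and without moving \<alpha> W. The rotation in the plane of
  a and h does this, since both vectors are orthogonal to \<alpha> W.\<close>

lemma rotate_into_subspace:
  fixes x x0 c :: "real^'n" and \<alpha> :: "real^'n^'n"
  assumes \<alpha>: "rotation_matrix \<alpha>" and c: "c \<noteq> 0" "\<And>w. w \<in> W \<Longrightarrow> c \<bullet> w = 0"
    and l: "l > 0" and near: "norm (x - x0) \<le> l * norm c"
  obtains \<beta> where "rotation_matrix \<beta>"
    "norm (\<beta> - \<alpha>) \<le> 6 * (real CARD('n))\<^sup>2 * (norm (x - x0) / (l * norm c))"
    "\<And>w. w \<in> W \<Longrightarrow> x + l *\<^sub>R (\<beta> *v (c + w)) \<in> (+) x0 ` ((*v) \<alpha> ` span (insert c W))"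
proof -
  define r where "r = norm c"
  have r: "r > 0" using c by (simp add: r_def)
  define V where "V = (*v) \<alpha> ` span (insert c W)"
  have V: "subspace V" unfolding V_def by (intro linear_subspace_image matrix_vector_mul_linear subspace_span)
  have cV: "\<alpha> *v c \<in> V" and wV: "\<And>w. w \<in> W \<Longrightarrow> \<alpha> *v w \<in> V"
    unfolding V_def by (intro imageI span_base; simp)+
  obtain z h where zh: "z \<in> V" "\<And>v. v \<in> V \<Longrightarrow> orthogonal h v" "x - x0 = z + h"
    using orthogonal_subspace_decomp_exists[of V "x - x0"] V by (metis span_eq_iff)
  have hV: "h \<bullet> v = 0" "v \<bullet> h = 0" if "v \<in> V" for v using zh(2)[OF that] by (auto simp: orthogonal_def inner_commute)
  have "(norm (x - x0))\<^sup>2 = (norm z)\<^sup>2 + (norm h)\<^sup>2"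
    unfolding zh(3) power2_norm_eq_inner by (simp add: inner_add_left inner_add_right hV[OF zh(1)])
  then have hle: "norm h \<le> norm (x - x0)"
    by (intro power2_le_imp_le[OF _ norm_ge_zero]) simp
  define q where "q = norm h / (l * r)"
  have q0: "q \<ge> 0" using l r by (simp add: q_def)
  have qle: "q \<le> norm (x - x0) / (l * norm c)" unfolding q_def r_def using hle l c by (intro divide_right_mono) auto
  also have "\<dots> \<le> 1" using near l c by simp
  finally have q1: "q \<le> 1" .
  have q2: "q\<^sup>2 \<le> 1" using q0 q1 by (simp add: power_le_one)
  define a where "a = (1 / r) *\<^sub>R (\<alpha> *v c)"
  define \<sigma> where "\<sigma> = sqrt (1 - q\<^sup>2)"
  define b where "b = \<sigma> *\<^sub>R a - (1 / (l * r)) *\<^sub>R h"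
  have \<sigma>: "\<sigma>\<^sup>2 = 1 - q\<^sup>2" "\<sigma> \<ge> 0" using q2 by (auto simp: \<sigma>_def)
  have aV: "a \<in> V" unfolding a_def by (intro subspace_scale V cV)
  have na: "norm a = 1" using r by (simp add: a_def rotation_matrix_isometry(3)[OF \<alpha>] r_def)
  have aa: "a \<bullet> a = 1" using na by (simp add: norm_eq_sqrt_inner)
  have hh: "h \<bullet> h = q\<^sup>2 * (l * r)\<^sup>2" using l r by (simp add: q_def power_divide power2_norm_eq_inner)
  have "b \<bullet> b = \<sigma>\<^sup>2 + (h \<bullet> h) / (l * r)\<^sup>2"
    by (simp add: b_def inner_diff_left inner_diff_right hV[OF aV] aa power2_eq_square)
  also have "\<dots> = 1" using \<sigma>(1) l r by (simp add: hh)
  finally have nb: "norm b = 1" by (simp add: norm_eq_sqrt_inner)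
  have ab: "a \<bullet> b = \<sigma>" by (simp add: b_def inner_diff_right hV[OF aV] aa)
  have bb: "b \<bullet> b = 1" using nb by (simp add: norm_eq_sqrt_inner)
  have "(norm (b - a))\<^sup>2 = 2 - 2 * \<sigma>"
    unfolding power2_norm_eq_inner using ab by (simp add: inner_diff_left inner_diff_right inner_commute[of b a] aa bb)
  also have "\<dots> \<le> (2 * q)\<^sup>2"
  proof -
    have "(1 - q\<^sup>2) * (1 - q\<^sup>2) \<le> (1 - q\<^sup>2) * 1" using q2 by (intro mult_left_mono) auto
    then have "(1 - q\<^sup>2)\<^sup>2 \<le> \<sigma>\<^sup>2" unfolding \<sigma>(1) by (simp add: power2_eq_square)
    then have "1 - q\<^sup>2 \<le> \<sigma>" using \<sigma>(2) by (rule power2_le_imp_le)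
    moreover have "(2 * q)\<^sup>2 = 4 * q\<^sup>2" by (simp add: power_mult_distrib)
    ultimately show ?thesis using zero_le_power2[of q] by linarith
  qed
  finally have ba: "norm (b - a) \<le> 2 * q" by (rule power2_le_imp_le) (use q0 in simp)
  obtain R where R: "rotation_matrix R" "R *v a = b" "\<And>w. w \<bullet> a = 0 \<Longrightarrow> w \<bullet> b = 0 \<Longrightarrow> R *v w = w"
    "\<And>v. norm (R *v v - v) \<le> 3 * norm (b - a) * norm v"
    using rotation_between_unit_vectors[OF na nb] ab \<sigma>(2) by metis
  show thesis
  proof (rule that[of "R ** \<alpha>"])
    show "rotation_matrix (R ** \<alpha>)"
      using \<alpha> R(1) by (simp add: rotation_matrix_def orthogonal_matrix_mul det_mul)
    have "norm (R ** \<alpha> - \<alpha>) \<le> (real CARD('n))\<^sup>2 * (6 * q)"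
    proof (rule norm_matrix_le)
      fix v
      have "norm ((R ** \<alpha> - \<alpha>) *v v) = norm (R *v (\<alpha> *v v) - \<alpha> *v v)"
        by (simp add: matrix_vector_mult_diff_rdistrib matrix_vector_mul_assoc)
      also have "\<dots> \<le> 3 * norm (b - a) * norm (\<alpha> *v v)" by (rule R)
      also have "\<dots> \<le> 6 * q * norm v"
        unfolding rotation_matrix_isometry(3)[OF \<alpha>] using ba by (intro mult_right_mono) auto
      finally show "norm ((R ** \<alpha> - \<alpha>) *v v) \<le> 6 * q * norm v" .
    qed
    also have "\<dots> \<le> (real CARD('n))\<^sup>2 * (6 * (norm (x - x0) / (l * norm c)))"
      using qle by (intro mult_left_mono) auto
    finally show "norm (R ** \<alpha> - \<alpha>) \<le> 6 * (real CARD('n))\<^sup>2 * (norm (x - x0) / (l * norm c))" by (simp add: mult_ac)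
    fix w assume w: "w \<in> W"
    have "(\<alpha> *v w) \<bullet> a = 0" using c(2)[OF w] by (simp add: a_def rotation_matrix_isometry(2)[OF \<alpha>] inner_commute)
    moreover from this have "(\<alpha> *v w) \<bullet> b = 0" by (simp add: b_def inner_diff_right hV[OF wV[OF w]])
    ultimately have Rw: "R *v (\<alpha> *v w) = \<alpha> *v w" by (rule R(3))
    have "\<alpha> *v c = r *\<^sub>R a" using r by (simp add: a_def)
    then have Rc: "R *v (\<alpha> *v c) = r *\<^sub>R b" by (simp add: matrix_vector_mult_scaleR R(2))
    have "x + l *\<^sub>R ((R ** \<alpha>) *v (c + w)) = x + l *\<^sub>R (r *\<^sub>R b + \<alpha> *v w)"
      by (simp add: matrix_vector_mul_assoc[symmetric] matrix_vector_right_distrib Rc Rw)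
    also have "\<dots> = x + ((l * r * \<sigma>) *\<^sub>R a - h) + l *\<^sub>R (\<alpha> *v w)"
      using l r by (simp add: b_def algebra_simps)
    also have "\<dots> = x0 + (z + (l * r * \<sigma>) *\<^sub>R a + l *\<^sub>R (\<alpha> *v w))"
      using zh(3) by (simp add: algebra_simps)
    finally have eq: "x + l *\<^sub>R ((R ** \<alpha>) *v (c + w)) = x0 + (z + (l * r * \<sigma>) *\<^sub>R a + l *\<^sub>R (\<alpha> *v w))" .
    have "z + (l * r * \<sigma>) *\<^sub>R a + l *\<^sub>R (\<alpha> *v w) \<in> V"
      by (intro subspace_add subspace_scale V zh(1) aV wV w)
    then show "x + l *\<^sub>R ((R ** \<alpha>) *v (c + w)) \<in> (+) x0 ` ((*v) \<alpha> ` span (insert c W))"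
      unfolding eq V_def by (rule imageI)
  qed
qed

text \<open>Here c is the point of the affine hull of F closest to the centre 0. It is not 0, because a face is the
  intersection of the box with its affine hull and a proper face misses the interior.\<close>

lemma unit_box_face_decomposition:
  fixes F :: "'a::euclidean_space set"
  assumes F: "F face_of unit_box" "aff_dim F = int k" and k: "k < DIM('a)"
  obtains c W where "subspace W" "dim W = k" "c \<noteq> 0" "\<And>w. w \<in> W \<Longrightarrow> c \<bullet> w = 0" "F \<subseteq> (+) c ` W"
proof -
  have "(0::'a) \<in> box (- ((1/2) *\<^sub>R One)) ((1/2) *\<^sub>R One)" by (auto simp: mem_box)
  then have int0: "(0::'a) \<in> interior unit_box" by (simp only: interior_cbox)
  have "F \<noteq> unit_box"
  proof
    assume "F = unit_box"
    then have "aff_dim F = DIM('a)" using int0 by (metis aff_dim_nonempty_interior empty_iff)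
    then show False using F k by simp
  qed
  then have "F \<inter> interior unit_box = {}" using face_of_disjoint_interior[OF F(1)] by blast
  then have "0 \<notin> F" using int0 by blast
  have "F = affine hull F \<inter> unit_box" by (rule face_of_imp_eq_affine_Int[OF _ F(1)]) (rule convex_box)
  moreover have "(0::'a) \<in> unit_box" using int0 interior_subset by blast
  ultimately have 0: "0 \<notin> affine hull F" using \<open>0 \<notin> F\<close> by blast
  have "F \<noteq> {}" using F(2) by auto
  then obtain p where p: "p \<in> F" by blast
  then have pA: "p \<in> affine hull F" by (rule hull_inc)
  define W where "W = (\<lambda>y. y - p) ` (affine hull F)"
  have W: "subspace W" unfolding W_def by (rule affine_diffs_subspace_subtract[OF affine_affine_hull pA])
  have "aff_dim F = aff_dim (affine hull F)" by simp
  also have "\<dots> = int (dim W)" unfolding W_def using pA by (intro aff_dim_eq_dim_subtract) (simp add: hull_hull)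
  finally have dimW: "dim W = k" using F(2) by simp
  obtain w0 c where wc: "w0 \<in> W" "\<And>w. w \<in> W \<Longrightarrow> orthogonal c w" "p = w0 + c"
    using orthogonal_subspace_decomp_exists[of W p] W by (metis span_eq_iff)
  show thesis
  proof (rule that[OF W dimW])
    show "c \<noteq> 0"
    proof
      assume "c = 0"
      then have "p \<in> W" using wc by simp
      then have "- p \<in> W" using W by (simp add: subspace_neg)
      then show False using 0 by (auto simp: W_def)
    qed
    show "c \<bullet> w = 0" if "w \<in> W" for w using wc(2)[OF that] by (simp add: orthogonal_def)
    show "F \<subseteq> (+) c ` W"
    proof
      fix y assume "y \<in> F"
      then have "y - p \<in> W" unfolding W_def by (intro imageI hull_inc)
      then have "(y - p) + w0 \<in> W" using wc(1) W by (intro subspace_add)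
      moreover have "y = c + ((y - p) + w0)" using wc(3) by simp
      ultimately show "y \<in> (+) c ` W" by blast
    qed
  qed
qed

section \<open>A set containing all cube skeletons\<close>

text \<open>The pairs of centre and side length are exhausted by these bounded pieces, on which the side length also
  stays away from 0.\<close>

definition param_box :: "real \<Rightarrow> ((real^'n) \<times> real) set" where
  "param_box m = {(x, l). norm x \<le> m \<and> 1 / m \<le> l \<and> l \<le> m}"

text \<open>One parameter e bounds the radius, the total cost and the excess of the exponent over d. A set contained in
  such covers for a sequence of e tending to 0 is null for H^s for all s > d.\<close>

definition economical_cover :: "nat \<Rightarrow> real \<Rightarrow> 'a::metric_space set \<Rightarrow> bool" where
  "economical_cover d e O' \<longleftrightarrow> (\<exists>G \<epsilon>. finite G \<and> 0 < \<epsilon> \<and> \<epsilon> \<le> e \<and> \<epsilon> \<le> 1 \<and>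
     real (card G) * \<epsilon> powr (real d + e) \<le> e \<and> O' = (\<Union>c\<in>G. cball c \<epsilon>))"

lemma economical_cover_closed: "economical_cover d e (O' :: 'a::heine_borel set) \<Longrightarrow> closed O'"
  unfolding economical_cover_def by (auto intro: closed_UN)

lemma bounded_rotations: "bounded {A :: real^'n^'n. rotation_matrix A}"
  unfolding bounded_iff
proof (intro exI ballI)
  fix A :: "real^'n^'n" assume "A \<in> {A. rotation_matrix A}"
  then show "norm A \<le> (real CARD('n))\<^sup>2 * 1"
    by (intro norm_matrix_le) (simp add: rotation_matrix_isometry(3))
qed

text \<open>One stage of the construction. A finite net of pairs (x0, \<alpha>0) is chosen, and the face over (x, l) is
  rotated into the (k+1)-plane belonging to a pair close to (x, \<alpha> (x, l)). The net consists of pairs with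
  arbitrary rotations, so \<alpha> may depend on (x, l) in any way. The bounded parts of these finitely many planes have a finite cover by balls of radius \<epsilon>, and
  doubling the radii leaves a margin \<eta>' for all later perturbations.\<close>

lemma perturb_rotations_for_face:
  fixes F :: "(real^'n) set" and \<alpha> :: "(real^'n) \<times> real \<Rightarrow> real^'n^'n"
  assumes F: "F face_of unit_box" "aff_dim F = int k" and k: "k < CARD('n)"
    and m: "m \<ge> 1" and \<alpha>: "\<And>y. rotation_matrix (\<alpha> y)" and \<eta>: "\<eta> > 0" and e: "e > 0"
  obtains \<alpha>' \<eta>' O' where "\<And>y. rotation_matrix (\<alpha>' y)" "\<And>y. y \<in> param_box m \<Longrightarrow> norm (\<alpha>' y - \<alpha> y) \<le> \<eta>"
    "\<eta>' > 0" "economical_cover (k + 1) e O'"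
    "\<And>x l \<beta> t. (x, l) \<in> param_box m \<Longrightarrow> norm (\<beta> - \<alpha>' (x, l)) \<le> \<eta>' \<Longrightarrow> t \<in> F \<Longrightarrow> x + l *\<^sub>R (\<beta> *v t) \<in> O'"
proof -
  let ?n = "real CARD('n)"
  have n: "?n \<ge> 1" by (simp add: Suc_leI)
  have kd: "k < DIM(real^'n)" using k by simp
  then obtain c W where W: "subspace W" "dim W = k" and c: "c \<noteq> 0" "\<And>w. w \<in> W \<Longrightarrow> c \<bullet> w = 0"
    and FW: "F \<subseteq> (+) c ` W"
    using unit_box_face_decomposition[OF F kd] by metis
  define r where "r = norm c"
  have r: "r > 0" using c by (simp add: r_def)
  have normF: "norm t \<le> ?n" if "t \<in> F" for t
  proof -
    have "t \<in> cball 0 (real DIM(real^'n))"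
      using that face_of_imp_subset[OF F(1)] unit_box_subset_cball by blast
    then show ?thesis by simp
  qed
  \<comment> \<open>The Lipschitz constant in \<open>rotate_into_subspace\<close>, for l at least 1/m.\<close>
  define Cst where "Cst = 6 * ?n\<^sup>2 * m / r"
  have Cst: "Cst \<ge> 0" using m r by (simp add: Cst_def)
  define \<kappa> where "\<kappa> = min (r / m) (\<eta> / (Cst + 1))"
  have \<kappa>: "\<kappa> > 0" using r m \<eta> Cst by (simp add: \<kappa>_def)
  define T where "T = {(x :: real^'n, A :: real^'n^'n). norm x \<le> m \<and> rotation_matrix A}"
  have "T = cball 0 m \<times> {A. rotation_matrix A}" by (auto simp: T_def)
  then have "bounded T" by (simp add: bounded_Times bounded_rotations)
  then obtain N where N: "finite N" "N \<subseteq> T" "T \<subseteq> (\<Union>p\<in>N. ball p \<kappa>)"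
    using maximal_separated_subset[OF _ \<kappa>] by metis
  define V where "V p = (+) (fst p) ` ((*v) (snd p) ` span (insert c W))" for p :: "(real^'n) \<times> (real^'n^'n)"
  have step: "\<exists>\<beta>. rotation_matrix \<beta> \<and> norm (\<beta> - \<alpha> (x, l)) \<le> \<eta> \<and> (\<exists>p\<in>N. \<forall>t\<in>F. x + l *\<^sub>R (\<beta> *v t) \<in> V p)"
    if y: "(x, l) \<in> param_box m" for x l
  proof -
    have y': "norm x \<le> m" "1 / m \<le> l" "l \<le> m" using y by (auto simp: param_box_def)
    have l: "l > 0" using y'(2) m by (meson less_le_trans zero_less_divide_1_iff zero_less_one)
    have "(x, \<alpha> (x, l)) \<in> T" using y' \<alpha> by (auto simp: T_def)
    then obtain p where p: "p \<in> N" "dist p (x, \<alpha> (x, l)) < \<kappa>" using N(3) by auto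
    obtain x0 \<alpha>0 where p_eq: "p = (x0, \<alpha>0)" by (cases p)
    have rot0: "rotation_matrix \<alpha>0" using N(2) p(1) by (auto simp: T_def p_eq)
    have d1: "norm (x - x0) \<le> \<kappa>" using dist_fst_le[of p "(x, \<alpha> (x, l))"] p(2)
      by (simp add: p_eq dist_norm norm_minus_commute)
    have d2: "norm (\<alpha>0 - \<alpha> (x, l)) \<le> \<kappa>" using dist_snd_le[of p "(x, \<alpha> (x, l))"] p(2)
      by (simp add: p_eq dist_norm)
    have lr: "r / m \<le> l * norm c" using mult_right_mono[OF y'(2) less_imp_le[OF r]] by (simp add: r_def)
    have near: "norm (x - x0) \<le> l * norm c" using d1 lr by (simp add: \<kappa>_def)
    obtain \<beta> where \<beta>: "rotation_matrix \<beta>"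
      "norm (\<beta> - \<alpha>0) \<le> 6 * ?n\<^sup>2 * (norm (x - x0) / (l * norm c))"
      "\<And>w. w \<in> W \<Longrightarrow> x + l *\<^sub>R (\<beta> *v (c + w)) \<in> (+) x0 ` ((*v) \<alpha>0 ` span (insert c W))"
      using rotate_into_subspace[OF rot0 c l near] by metis
    have "norm (x - x0) / (l * norm c) \<le> \<kappa> / (r / m)"
      using d1 lr r m \<kappa> by (intro frac_le) auto
    then have "6 * ?n\<^sup>2 * (norm (x - x0) / (l * norm c)) \<le> 6 * ?n\<^sup>2 * (\<kappa> / (r / m))"
      by (intro mult_left_mono) auto
    also have "\<dots> = Cst * \<kappa>" by (simp add: Cst_def)
    finally have "norm (\<beta> - \<alpha>0) \<le> Cst * \<kappa>" using \<beta>(2) by linarith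
    then have "norm (\<beta> - \<alpha> (x, l)) \<le> Cst * \<kappa> + \<kappa>"
      using d2 norm_triangle_ineq[of "\<beta> - \<alpha>0" "\<alpha>0 - \<alpha> (x, l)"] by simp
    also have "\<dots> = (Cst + 1) * \<kappa>" by (simp add: algebra_simps)
    also have "\<dots> \<le> (Cst + 1) * (\<eta> / (Cst + 1))" using Cst by (intro mult_left_mono) (auto simp: \<kappa>_def)
    also have "\<dots> = \<eta>" using Cst by simp
    finally have "norm (\<beta> - \<alpha> (x, l)) \<le> \<eta>" .
    moreover have "x + l *\<^sub>R (\<beta> *v t) \<in> V p" if "t \<in> F" for t
      using that FW \<beta>(3) by (force simp: V_def p_eq)
    ultimately show ?thesis using \<beta>(1) p(1) by blast
  qed
  then obtain \<beta> where \<beta>: "\<And>x l. (x, l) \<in> param_box m \<Longrightarrow> rotation_matrix (\<beta> x l) \<and> norm (\<beta> x l - \<alpha> (x, l)) \<le> \<eta> \<and>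
      (\<exists>p\<in>N. \<forall>t\<in>F. x + l *\<^sub>R (\<beta> x l *v t) \<in> V p)"
    by metis
  define \<alpha>' where "\<alpha>' y = (if y \<in> param_box m then \<beta> (fst y) (snd y) else \<alpha> y)" for y
  define Z where "Z = (\<Union>p\<in>N. V p \<inter> cball 0 (m + m * ?n))"
  have Zin: "x + l *\<^sub>R (\<alpha>' (x, l) *v t) \<in> Z" if y: "(x, l) \<in> param_box m" and t: "t \<in> F" for x l t
  proof -
    have eq: "\<alpha>' (x, l) = \<beta> x l" using y by (simp add: \<alpha>'_def)
    have y': "norm x \<le> m" "1 / m \<le> l" "l \<le> m" using y by (auto simp: param_box_def)
    have l: "l > 0" using y'(2) m by (meson less_le_trans zero_less_divide_1_iff zero_less_one)
    have "norm (x + l *\<^sub>R (\<beta> x l *v t)) \<le> norm x + l * norm t"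
      using norm_triangle_ineq[of x "l *\<^sub>R (\<beta> x l *v t)"] \<beta>[OF y] l by (simp add: rotation_matrix_isometry(3))
    also have "\<dots> \<le> m + m * ?n" using y' normF[OF t] l m by (intro add_mono mult_mono) auto
    finally show ?thesis unfolding Z_def eq using \<beta>[OF y] t by auto
  qed
  have covZ: "covering_bound (k + 1) Z"
    unfolding Z_def
  proof (rule covering_bound_UN[OF N(1)])
    fix p assume "p \<in> N"
    have sub: "subspace ((*v) (snd p) ` span (insert c W))"
      by (intro linear_subspace_image matrix_vector_mul_linear subspace_span)
    have "dim ((*v) (snd p) ` span (insert c W)) \<le> dim (span (insert c W))"
      by (intro dim_image_le matrix_vector_mul_linear)
    also have "\<dots> \<le> k + 1" using W(2) by (simp add: dim_insert)
    finally show "covering_bound (k + 1) (V p \<inter> cball 0 (m + m * ?n))"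
      unfolding V_def using sub by (intro covering_bound_affine)
  qed
  define s where "s = real (k + 1) + e"
  define e' where "e' = min (min (e / 2) (1 / 2)) (e / 2 powr s)"
  have e': "e' > 0" "e' \<le> e / 2" "e' \<le> 1 / 2" "e' \<le> e / 2 powr s"
    unfolding e'_def using e by (simp, linarith, linarith, simp)
  have "real (k + 1) < s" using e by (simp add: s_def)
  then obtain G \<epsilon> where G: "finite G" "0 < \<epsilon>" "\<epsilon> \<le> e'" "real (card G) * \<epsilon> powr s \<le> e'" "Z \<subseteq> (\<Union>c\<in>G. cball c \<epsilon>)"
    using covering_bound_small_cover[OF covZ _ e'(1), of s] by metis
  define O' where "O' = (\<Union>c\<in>G. cball c (2 * \<epsilon>))"
  define \<eta>' where "\<eta>' = \<epsilon> / (m * (?n * ?n))"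
  have \<eta>': "\<eta>' > 0" using G m n by (simp add: \<eta>'_def)
  show thesis
  proof (rule that[of \<alpha>' \<eta>' O'])
    show "rotation_matrix (\<alpha>' y)" for y using \<alpha> \<beta>[of "fst y" "snd y"] by (simp add: \<alpha>'_def)
    show "norm (\<alpha>' y - \<alpha> y) \<le> \<eta>" if "y \<in> param_box m" for y using \<beta>[of "fst y" "snd y"] that by (simp add: \<alpha>'_def)
    show "\<eta>' > 0" by fact
    have "real (card G) * (2 * \<epsilon>) powr s = 2 powr s * (real (card G) * \<epsilon> powr s)"
      using G by (simp add: powr_mult)
    also have "\<dots> \<le> 2 powr s * (e / 2 powr s)" using G(4) e'(4) by (intro mult_left_mono) auto
    finally have "real (card G) * (2 * \<epsilon>) powr s \<le> e" by simp
    then show "economical_cover (k + 1) e O'"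
      unfolding economical_cover_def using G e'
      by (intro exI[of _ G] exI[of _ "2 * \<epsilon>"]) (auto simp: O'_def s_def)
    fix x l \<gamma> t
    assume y: "(x, l) \<in> param_box m" and \<gamma>: "norm (\<gamma> - \<alpha>' (x, l)) \<le> \<eta>'" and t: "t \<in> F"
    have y': "1 / m \<le> l" "l \<le> m" using y by (auto simp: param_box_def)
    have l: "l > 0" using y'(1) m by (meson less_le_trans zero_less_divide_1_iff zero_less_one)
    obtain g where g: "g \<in> G" "x + l *\<^sub>R (\<alpha>' (x, l) *v t) \<in> cball g \<epsilon>" using Zin[OF y t] G(5) by blast
    have "dist (x + l *\<^sub>R (\<alpha>' (x, l) *v t)) (x + l *\<^sub>R (\<gamma> *v t)) = norm (l *\<^sub>R ((\<gamma> - \<alpha>' (x, l)) *v t))"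
      unfolding dist_commute[of "x + l *\<^sub>R (\<alpha>' (x, l) *v t)"] dist_norm
      by (simp add: matrix_vector_mult_diff_rdistrib scaleR_diff_right norm_minus_commute)
    also have "\<dots> = l * norm ((\<gamma> - \<alpha>' (x, l)) *v t)" using l by simp
    also have "\<dots> \<le> m * (?n * \<eta>' * ?n)"
    proof (intro mult_mono y'(2))
      have "norm ((\<gamma> - \<alpha>' (x, l)) *v t) \<le> ?n * norm (\<gamma> - \<alpha>' (x, l)) * norm t" by (rule norm_matrix_vector_mult_le)
      also have "\<dots> \<le> ?n * \<eta>' * ?n" using \<gamma> normF[OF t] \<eta>' by (intro mult_mono mult_nonneg_nonneg) auto
      finally show "norm ((\<gamma> - \<alpha>' (x, l)) *v t) \<le> ?n * \<eta>' * ?n" .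
    qed (use m in auto)
    also have "\<dots> = \<epsilon>" using m n by (simp add: \<eta>'_def)
    finally have "dist g (x + l *\<^sub>R (\<gamma> *v t)) \<le> 2 * \<epsilon>"
      using g(2) dist_triangle[of g "x + l *\<^sub>R (\<gamma> *v t)" "x + l *\<^sub>R (\<alpha>' (x, l) *v t)"] by simp
    then show "x + l *\<^sub>R (\<gamma> *v t) \<in> O'" using g(1) by (auto simp: O'_def)
  qed
qed

lemma hausdorff_measure_0_economical_covers:
  fixes A :: "'a::euclidean_space set"
  assumes "\<And>j::nat. \<exists>i\<ge>j. \<exists>O'. economical_cover d (1 / (real i + 1)) O' \<and> A \<subseteq> O'" and s: "s > real d"
  shows "hausdorff_measure s A = 0"
proof (rule hausdorff_measure_0_ball_covers)
  show "s > 0" using s by simp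
  fix e :: real assume e: "e > 0"
  define \<mu> where "\<mu> = min e (s - real d)"
  have \<mu>: "\<mu> > 0" "\<mu> \<le> e" "\<mu> \<le> s - real d" using e s by (auto simp: \<mu>_def)
  obtain j :: nat where j: "real j > 1 / \<mu>" using reals_Archimedean2 by blast
  obtain i O' where i: "i \<ge> j" "economical_cover d (1 / (real i + 1)) O'" "A \<subseteq> O'" using assms(1) by blast
  have "1 / \<mu> < real i + 1" using i(1) j by linarith
  then have "1 / (real i + 1) < \<mu>" using \<mu>(1) by (simp add: field_simps)
  then have le: "1 / (real i + 1) \<le> e" "real d + 1 / (real i + 1) \<le> s" using \<mu> by auto
  obtain G \<epsilon> where G: "finite G" "0 < \<epsilon>" "\<epsilon> \<le> 1 / (real i + 1)" "\<epsilon> \<le> 1"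
     "real (card G) * \<epsilon> powr (real d + 1 / (real i + 1)) \<le> 1 / (real i + 1)" "O' = (\<Union>c\<in>G. cball c \<epsilon>)"
    using i(2) unfolding economical_cover_def by blast
  have "real (card G) * \<epsilon> powr s \<le> real (card G) * \<epsilon> powr (real d + 1 / (real i + 1))"
    using G le by (intro mult_left_mono powr_mono') auto
  then show "\<exists>G r. finite G \<and> 0 < r \<and> r \<le> e \<and> real (card G) * r powr s \<le> e \<and> A \<subseteq> (\<Union>c\<in>G. cball c r)"
    using G i(3) le(1) by (intro exI[of _ G] exI[of _ \<epsilon>]) auto
qed

text \<open>The stages are chained by dependent choice: the i-th state consists of a choice of rotations, of the
  amount by which it may still be changed, and of the cover that is reserved for the face Fs i. Each
  stage uses up at most half of that amount, so the choices converge to a limit that respects all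
  reservations.\<close>

lemma exists_cube_skeleton_set_param_box:
  assumes k: "k < CARD('n)" and m: "m \<ge> 1"
  obtains B :: "(real^'n) set" where "B \<in> sets borel"
    "\<And>x l. (x, l) \<in> param_box m \<Longrightarrow> contains_cube_skeleton k l x B"
    "\<And>s. s > real (k + 1) \<Longrightarrow> hausdorff_measure s B = 0"
proof -
  define \<F> where "\<F> = {F :: (real^'n) set. F face_of unit_box \<and> aff_dim F = int k}"
  have fin: "finite \<F>"
    unfolding \<F>_def by (rule finite_subset[OF _ finite_polytope_faces[OF polytope_interval]]) auto
  have "k \<le> card (Basis :: (real^'n) set)" using k by simp
  then obtain K :: "(real^'n) set" where "K \<subseteq> Basis" "card K = k"
    by (rule obtain_subset_with_card_n) blast
  then have "corner_face K \<in> \<F>" using corner_face_face_of aff_dim_corner_face unfolding \<F>_def by blast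
  then have ne: "\<F> \<noteq> {}" by blast
  \<comment> \<open>An enumeration in which every face occurs infinitely often.\<close>
  define Fs where "Fs i = from_nat_into \<F> (fst (prod_decode i))" for i
  have Fs: "Fs i face_of unit_box" "aff_dim (Fs i) = int k" for i
    using from_nat_into[OF ne, of "fst (prod_decode i)"] by (auto simp: Fs_def \<F>_def)
  have Fs_inf: "\<exists>i\<ge>j. Fs i = F" if F: "F \<in> \<F>" for F j
  proof -
    obtain a where "from_nat_into \<F> a = F" using F fin by (metis countable_finite from_nat_into_surj)
    then have "Fs (prod_encode (a, j)) = F" by (simp add: Fs_def)
    then show ?thesis using le_prod_encode_2 by blast
  qed
  define Q where "Q = (param_box m :: ((real^'n) \<times> real) set)"
  define e where "e i = 1 / (real i + 1)" for i :: nat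
  define P where "P i = (\<lambda>(\<alpha> :: (real^'n) \<times> real \<Rightarrow> real^'n^'n, \<eta> :: real, O'). (\<forall>y. rotation_matrix (\<alpha> y)) \<and> 0 < \<eta> \<and> \<eta> \<le> (1/2) ^ i \<and>
      economical_cover (k + 1) (e i) O' \<and>
      (\<forall>x l \<beta>. (x, l) \<in> Q \<longrightarrow> norm (\<beta> - \<alpha> (x, l)) \<le> \<eta> \<longrightarrow> (\<forall>t\<in>Fs i. x + l *\<^sub>R (\<beta> *v t) \<in> O')))" for i :: nat
  define Rel where "Rel = (\<lambda>(\<alpha> :: (real^'n) \<times> real \<Rightarrow> real^'n^'n, \<eta> :: real, O' :: (real^'n) set) (\<alpha>' :: (real^'n) \<times> real \<Rightarrow> real^'n^'n, \<eta>' :: real, O'' :: (real^'n) set).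
      \<eta>' \<le> \<eta> / 2 \<and> (\<forall>y\<in>Q. norm (\<alpha>' y - \<alpha> y) \<le> \<eta> / 2))"
  have ext: "\<exists>\<alpha>' \<eta>' O'. P i (\<alpha>', \<eta>', O') \<and> \<eta>' \<le> \<eta> \<and> (\<forall>y\<in>Q. norm (\<alpha>' y - \<alpha> y) \<le> \<eta>)"
    if rot: "\<And>y. rotation_matrix (\<alpha> y)" and \<eta>: "\<eta> > 0" for i \<alpha> \<eta>
  proof -
    have "e i > 0" by (simp add: e_def)
    obtain \<alpha>' \<eta>' O' where *: "\<And>y. rotation_matrix (\<alpha>' y)" "\<And>y. y \<in> param_box m \<Longrightarrow> norm (\<alpha>' y - \<alpha> y) \<le> \<eta>"
      "\<eta>' > 0" "economical_cover (k + 1) (e i) O'"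
      "\<And>x l \<beta> t. (x, l) \<in> param_box m \<Longrightarrow> norm (\<beta> - \<alpha>' (x, l)) \<le> \<eta>' \<Longrightarrow> t \<in> Fs i \<Longrightarrow> x + l *\<^sub>R (\<beta> *v t) \<in> O'"
      using perturb_rotations_for_face[where F = "Fs i" and \<alpha> = \<alpha> and \<eta> = \<eta> and e = "e i", OF Fs k m rot \<eta> \<open>e i > 0\<close>] by metis
    define \<eta>'' where "\<eta>'' = min \<eta>' (min \<eta> ((1/2) ^ i))"
    have "P i (\<alpha>', \<eta>'', O')" using * \<eta> unfolding P_def \<eta>''_def Q_def by auto
    moreover have "\<eta>'' \<le> \<eta>" by (simp add: \<eta>''_def)
    ultimately show ?thesis using *(2) unfolding Q_def by blast
  qed
  have "\<exists>f. \<forall>i. P i (f i) \<and> Rel (f i) (f (Suc i))"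
  proof (rule dependent_nat_choice)
    have "rotation_matrix (mat 1 :: real^'n^'n)" by (simp add: rotation_matrix_def orthogonal_matrix_id)
    then show "\<exists>x. P 0 x" using ext[of "\<lambda>_. mat 1" 1 0] by auto
    fix x i assume x: "P i x"
    obtain \<alpha> \<eta> O' where xe: "x = (\<alpha>, \<eta>, O')" by (cases x)
    have "\<And>y. rotation_matrix (\<alpha> y)" "\<eta> / 2 > 0" using x by (auto simp: P_def xe)
    from ext[OF this, of "Suc i"] show "\<exists>y. P (Suc i) y \<and> Rel x y"
      unfolding xe Rel_def by auto
  qed
  then obtain f where f: "\<And>i. P i (f i)" "\<And>i. Rel (f i) (f (Suc i))" by blast
  define \<alpha> where "\<alpha> i = fst (f i)" for i
  define \<eta> where "\<eta> i = fst (snd (f i))" for i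
  define Oc where "Oc i = snd (snd (f i))" for i
  have f_eq: "f i = (\<alpha> i, \<eta> i, Oc i)" for i by (simp add: \<alpha>_def \<eta>_def Oc_def)
  have rot: "rotation_matrix (\<alpha> i y)" and \<eta>: "0 < \<eta> i" "\<eta> i \<le> (1/2) ^ i" and Oc: "economical_cover (k + 1) (e i) (Oc i)"
    and stage: "\<And>x l \<beta> t. (x, l) \<in> Q \<Longrightarrow> norm (\<beta> - \<alpha> i (x, l)) \<le> \<eta> i \<Longrightarrow> t \<in> Fs i \<Longrightarrow> x + l *\<^sub>R (\<beta> *v t) \<in> Oc i" for i y
    using f(1)[of i] unfolding f_eq P_def prod.case by blast+
  have stepr: "\<eta> (Suc i) \<le> \<eta> i / 2" "\<And>y. y \<in> Q \<Longrightarrow> norm (\<alpha> (Suc i) y - \<alpha> i y) \<le> \<eta> i / 2" for i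
    using f(2)[of i] unfolding f_eq Rel_def by auto
  have close: "norm (\<alpha> (i + j) y - \<alpha> i y) \<le> \<eta> i - \<eta> (i + j)" if y: "y \<in> Q" for i j y
  proof (induction j)
    case (Suc j)
    have "norm (\<alpha> (i + Suc j) y - \<alpha> i y) \<le> norm (\<alpha> (Suc (i + j)) y - \<alpha> (i + j) y) + norm (\<alpha> (i + j) y - \<alpha> i y)"
      using norm_triangle_ineq[of "\<alpha> (Suc (i + j)) y - \<alpha> (i + j) y" "\<alpha> (i + j) y - \<alpha> i y"] by simp
    also have "\<dots> \<le> \<eta> (i + j) / 2 + (\<eta> i - \<eta> (i + j))" using stepr(2)[OF y, of "i + j"] Suc by linarith
    also have "\<dots> \<le> \<eta> i - \<eta> (i + Suc j)" using stepr(1)[of "i + j"] by simp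
    finally show ?case .
  qed simp
  have lim: "\<exists>\<beta>. rotation_matrix \<beta> \<and> (\<forall>i. norm (\<beta> - \<alpha> i y) \<le> \<eta> i)" if y: "y \<in> Q" for y
  proof -
    have close': "norm (\<alpha> j y - \<alpha> i y) \<le> \<eta> i" if "j \<ge> i" for i j
      using close[OF y, of i "j - i"] \<eta>(1)[of j] that by simp
    have "Cauchy (\<lambda>i. \<alpha> i y)"
      unfolding Cauchy_altdef2
    proof (intro allI impI)
      fix \<epsilon> :: real assume "\<epsilon> > 0"
      then obtain N where N: "(1/2::real) ^ N < \<epsilon>" using real_arch_pow_inv[of \<epsilon> "1/2"] by auto
      have "dist (\<alpha> n y) (\<alpha> N y) < \<epsilon>" if "n \<ge> N" for n
        using close'[OF that] \<eta>(2)[of N] N by (simp add: dist_norm)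
      then show "\<exists>N. \<forall>n\<ge>N. dist (\<alpha> n y) (\<alpha> N y) < \<epsilon>" by blast
    qed
    then obtain \<beta> where \<beta>: "(\<lambda>i. \<alpha> i y) \<longlonglongrightarrow> \<beta>" by (metis Cauchy_convergent convergent_def)
    have "rotation_matrix \<beta>" by (rule rotation_matrix_limit[OF rot \<beta>])
    moreover have "norm (\<beta> - \<alpha> i y) \<le> \<eta> i" for i
    proof (rule LIMSEQ_le_const2)
      show "(\<lambda>j. norm (\<alpha> j y - \<alpha> i y)) \<longlonglongrightarrow> norm (\<beta> - \<alpha> i y)" by (intro tendsto_intros \<beta>)
      show "\<exists>N. \<forall>j\<ge>N. norm (\<alpha> j y - \<alpha> i y) \<le> \<eta> i" using close' by blast
    qed
    ultimately show ?thesis by blast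
  qed
  define BF where "BF F = (\<Inter>i\<in>{i. Fs i = F}. Oc i)" for F
  define B where "B = (\<Union>F\<in>\<F>. BF F)"
  show thesis
  proof (rule that[of B])
    have "closed (BF F)" for F
      unfolding BF_def using Oc economical_cover_closed by blast
    then show "B \<in> sets borel" unfolding B_def using fin by (intro borel_closed closed_UN) auto
    show "hausdorff_measure s B = 0" if s: "s > real (k + 1)" for s
      unfolding B_def
    proof (rule hausdorff_measure_0_Union)
      show "countable (BF ` \<F>)" using fin by (intro countable_finite) auto
      fix A assume "A \<in> BF ` \<F>"
      then obtain F where F: "F \<in> \<F>" "A = BF F" by blast
      show "hausdorff_measure s A = 0"
      proof (rule hausdorff_measure_0_economical_covers[OF _ s])
        fix j :: nat
        obtain i where i: "i \<ge> j" "Fs i = F" using Fs_inf[OF F(1)] by blast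
        then have "A \<subseteq> Oc i" unfolding F(2) BF_def by blast
        then show "\<exists>i\<ge>j. \<exists>O'. economical_cover (k + 1) (1 / (real i + 1)) O' \<and> A \<subseteq> O'"
          using Oc[of i] i(1) unfolding e_def by blast
      qed
    qed
    fix x :: "real^'n" and l assume "(x, l) \<in> param_box m"
    then have y: "(x, l) \<in> Q" by (simp add: Q_def)
    have l: "l > 0" using y m unfolding Q_def param_box_def
      by auto (meson less_le_trans zero_less_divide_1_iff zero_less_one)
    obtain \<beta> where \<beta>: "rotation_matrix \<beta>" "\<And>i. norm (\<beta> - \<alpha> i (x, l)) \<le> \<eta> i" using lim[OF y] by blast
    have "skeleton k (rotated_cube x l \<beta>) \<subseteq> B"
      unfolding skeleton_rotated_cube[OF l \<beta>(1)]
    proof (rule UN_least)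
      fix F :: "(real^'n) set" assume "F \<in> {F. F face_of unit_box \<and> aff_dim F = int k}"
      then have F: "F \<in> \<F>" by (simp add: \<F>_def)
      have "(\<lambda>y. x + l *\<^sub>R (\<beta> *v y)) ` F \<subseteq> BF F"
        unfolding BF_def using stage[OF y \<beta>(2)] by blast
      then show "(\<lambda>y. x + l *\<^sub>R (\<beta> *v y)) ` F \<subseteq> B" using F unfolding B_def by blast
    qed
    then show "contains_cube_skeleton k l x B"
      unfolding contains_cube_skeleton_def using \<beta>(1) by blast
  qed
qed

theorem exists_borel_cube_skeletons:
  assumes k: "k < CARD('n)"
  obtains B :: "(real^'n) set" where "B \<in> sets borel"
    "\<And>x l. l > 0 \<Longrightarrow> contains_cube_skeleton k l x B" "hausdorff_dim B \<le> ennreal (real k + 1)"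
proof -
  have "\<exists>B :: (real^'n) set. B \<in> sets borel \<and> (\<forall>x l. (x, l) \<in> param_box (real m + 1) \<longrightarrow> contains_cube_skeleton k l x B) \<and>
    (\<forall>s. s > real (k + 1) \<longrightarrow> hausdorff_measure s B = 0)" for m :: nat
    using exists_cube_skeleton_set_param_box[OF k, of "real m + 1"] by (metis le_add_same_cancel2 of_nat_0_le_iff)
  then obtain B :: "nat \<Rightarrow> (real^'n) set" where B: "\<And>m. B m \<in> sets borel"
    "\<And>m x l. (x, l) \<in> param_box (real m + 1) \<Longrightarrow> contains_cube_skeleton k l x (B m)"
    "\<And>m s. s > real (k + 1) \<Longrightarrow> hausdorff_measure s (B m) = 0"
    by metis
  show thesis
  proof (rule that[of "\<Union>m. B m"])
    show "(\<Union>m. B m) \<in> sets borel" using B(1) by (intro sets.countable_UN) auto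
    show "hausdorff_dim (\<Union>m. B m) \<le> ennreal (real k + 1)"
    proof (rule hausdorff_dim_leI)
      fix s :: real assume "real k + 1 < s"
      then have "real (k + 1) < s" by simp
      then show "hausdorff_measure s (\<Union>m. B m) = 0" by (intro hausdorff_measure_0_UN B(3))
    qed simp
    fix x :: "real^'n" and l :: real assume l: "l > 0"
    obtain m :: nat where m: "real m > max (norm x) (max l (1 / l))" using reals_Archimedean2 by blast
    have "1 / (real m + 1) \<le> l" using m l by (simp add: field_simps)
    then have "(x, l) \<in> param_box (real m + 1)" using m by (auto simp: param_box_def)
    then have "contains_cube_skeleton k l x (B m)" by (rule B(2))
    then obtain \<alpha> where \<alpha>: "rotation_matrix \<alpha>" "skeleton k (rotated_cube x l \<alpha>) \<subseteq> B m"
      unfolding contains_cube_skeleton_def by blast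
    have "B m \<subseteq> (\<Union>m. B m)" by (rule UN_upper) simp
    with \<alpha>(2) have "skeleton k (rotated_cube x l \<alpha>) \<subseteq> (\<Union>m. B m)" by (rule order_trans)
    with \<alpha>(1) show "contains_cube_skeleton k l x (\<Union>m. B m)"
      unfolding contains_cube_skeleton_def by blast
  qed
qed

section \<open>The minimal Hausdorff dimension\<close>

theorem corollary6p5:
  fixes k :: nat
  assumes "k < CARD('n::finite)"
  shows
    "is_min_hausdorff_dim
       (\<lambda>B :: (real^'n) set. \<forall>x. contains_cube_skeleton k 1 x B) (of_nat (k + 1)) \<and>
     is_min_hausdorff_dim
       (\<lambda>B :: (real^'n) set. \<forall>x. \<forall>l>0. contains_cube_skeleton k l x B) (of_nat (k + 1)) \<and>
     is_min_hausdorff_dim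
       (\<lambda>B :: (real^'n) set. \<forall>x. contains_affine_subspace_at_dist k 1 x B) (of_nat (k + 1)) \<and>
     is_min_hausdorff_dim
       (\<lambda>B :: (real^'n) set. \<forall>x. \<forall>d>0. contains_affine_subspace_at_dist k d x B) (of_nat (k + 1))"
proof -
  have dim: "k < DIM(real^'n)" using assms by simp
  have d: "(of_nat (k + 1) :: ennreal) = ennreal (real k + 1)"
    by (simp add: ennreal_of_nat_eq_real_of_nat add.commute flip: ennreal_plus ennreal_1)
  have low1: "of_nat (k + 1) \<le> hausdorff_dim B" if "\<And>x. contains_cube_skeleton k 1 x B" for B :: "(real^'n) set"
    unfolding d using hausdorff_dim_ge_of_cube_skeletons[OF assms that] .
  have low2: "of_nat (k + 1) \<le> hausdorff_dim B" if "\<And>x. contains_affine_subspace_at_dist k 1 x B" for B :: "(real^'n) set"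
    unfolding d using hausdorff_dim_ge_of_affine_subspaces[OF less_imp_le[OF dim] zero_less_one that] .
  obtain B1 :: "(real^'n) set" where B1: "B1 \<in> sets borel"
    "\<And>x l. l > 0 \<Longrightarrow> contains_cube_skeleton k l x B1" "hausdorff_dim B1 \<le> ennreal (real k + 1)"
    using exists_borel_cube_skeletons[OF assms] by blast
  obtain B2 :: "(real^'n) set" where B2: "B2 \<in> sets borel"
    "\<And>x d. d > 0 \<Longrightarrow> contains_affine_subspace_at_dist k d x B2" "hausdorff_dim B2 \<le> ennreal (real k + 1)"
    using exists_borel_affine_subspaces[OF dim] by blast
  have eq1: "hausdorff_dim B1 = of_nat (k + 1)" using low1[of B1] B1(2,3) unfolding d by (intro antisym) auto
  have eq2: "hausdorff_dim B2 = of_nat (k + 1)" using low2[of B2] B2(2,3) unfolding d by (intro antisym) auto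
  show ?thesis
    unfolding is_min_hausdorff_dim_def
  proof (intro conjI)
    show "\<forall>B :: (real^'n) set. B \<in> sets borel \<and> (\<forall>x. contains_cube_skeleton k 1 x B) \<longrightarrow> of_nat (k + 1) \<le> hausdorff_dim B"
      using low1 by blast
    show "\<forall>B :: (real^'n) set. B \<in> sets borel \<and> (\<forall>x. \<forall>l>0. contains_cube_skeleton k l x B) \<longrightarrow> of_nat (k + 1) \<le> hausdorff_dim B"
      using low1 zero_less_one by blast
    show "\<forall>B :: (real^'n) set. B \<in> sets borel \<and> (\<forall>x. contains_affine_subspace_at_dist k 1 x B) \<longrightarrow> of_nat (k + 1) \<le> hausdorff_dim B"
      using low2 by blast
    show "\<forall>B :: (real^'n) set. B \<in> sets borel \<and> (\<forall>x. \<forall>d>0. contains_affine_subspace_at_dist k d x B) \<longrightarrow> of_nat (k + 1) \<le> hausdorff_dim B"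
      using low2 zero_less_one by blast
    show "\<exists>B :: (real^'n) set. B \<in> sets borel \<and> (\<forall>x. contains_cube_skeleton k 1 x B) \<and> hausdorff_dim B = of_nat (k + 1)"
      using B1(1,2) eq1 zero_less_one by blast
    show "\<exists>B :: (real^'n) set. B \<in> sets borel \<and> (\<forall>x. \<forall>l>0. contains_cube_skeleton k l x B) \<and> hausdorff_dim B = of_nat (k + 1)"
      using B1(1,2) eq1 by blast
    show "\<exists>B :: (real^'n) set. B \<in> sets borel \<and> (\<forall>x. contains_affine_subspace_at_dist k 1 x B) \<and> hausdorff_dim B = of_nat (k + 1)"
      using B2(1,2) eq2 zero_less_one by blast
    show "\<exists>B :: (real^'n) set. B \<in> sets borel \<and> (\<forall>x. \<forall>d>0. contains_affine_subspace_at_dist k d x B) \<and> hausdorff_dim B = of_nat (k + 1)"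
      using B2(1,2) eq2 by blast
  qed
qed

end
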